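(* Let $V$ be a complex vector space of dimension $N$ with basis $x_1,\dots,x_N$. For each multiparameter quantum hyperplane $S_Q(V)$ with generic deformation parameters $q_{ij}$ there exists a scaling automorphism $\sigma$ of $S_Q(V)$, $\sigma(x_i)=p_ix_i$ with $p_i\in\mathbb{C}\setminus\{0\}$, such that the top natural twisted Hochschild homology group of $S_Q(V)$ is of dimension $N$ (i.e. the top non-vanishing group is in degree $N$: $HH_N(S_Q(V),S_Q^\sigma(V))\neq 0$ and $HH_n(S_Q(V),S_Q^\sigma(V))=0$ for all $n>N$). In particular, there exists a unique choice of the scaling parameters $(p_1,\dots,p_N)$ such that the top class in the twisted Hochschild homology (the class in $HH_N(S_Q(V),S_Q^\sigma(V))$) is given by $1\otimes x_1\wedge x_2\wedge\cdots\wedge x_N$ in the Koszul complex.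
   Context: All algebras are over $\mathbb{C}$. Let $T(V)$ be the tensor algebra of $V$, and let $Q=(q_{ij})$ be a complex matrix with nonzero entries, $q_{ii}=1$ for all $i$ and $q_{ji}=q_{ij}^{-1}$ for $i<j$. The quantum hyperplane is $S_Q(V)=T(V)/I_Q$, where $I_Q$ is the ideal generated by $x_i\otimes x_j-q_{ij}\,x_j\otimes x_i$ for $i<j$. It has the basis $x^\alpha=x_1^{\alpha(1)}\cdots x_N^{\alpha(N)}$, $\alpha\in\mathbb{N}^N$ (with $0\in\mathbb{N}$). Let $\kappa_i$ denote the $i$-th unit multiindex. Genericity: the parameters $q_{ij}$ are called not generic if there exists $\gamma\in\mathbb{N}^N$, with $\gamma\neq 0$ and $\gamma$ not equal to any of the $\kappa_j$, $j=1,\dots,N$, such that for every $i$ with $\gamma(i)>0$ we have $\prod_{k=1}^N (q_{ki})^{\gamma(k)}=1$. Otherwise they are called generic. Scaling automorphisms of $S_Q(V)$ are the algebra automorphisms given on generators by $\sigma(x_i)=p_ix_i$, $p_i\in\mathbb{C}$, $p_i\neq 0$, $i=1,\dots,N$. Natural twisted Hochschild homology: for an algebra $A$ with automorphism $\sigma$, let $A_\sigma$ be the vector space $A$ with right $A\otimes A^{op}$-action $m\cdot(a_0,a_1)=\sigma(a_1)\,m\,a_0$. The natural twisted Hochschild homology $HH_*(A,A_\sigma)$ is the Hochschild homology of $A$ with values in $A_\sigma$, i.e. the homology of the complex $C_n=A_\sigma\otimes A^{\otimes n}$ with $$b(a_0\otimes\cdots\otimes a_n)=\sum_{i=0}^{n-1}(-1)^i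 a_0\otimes\cdots\otimes a_ia_{i+1}\otimes\cdots\otimes a_n+(-1)^n\sigma(a_n)a_0\otimes a_1\otimes\cdots\otimes a_{n-1}.$$ For $A=S_Q(V)$ we write $S_Q^\sigma(V)$ for $A_\sigma$. Koszul complex: let $\Lambda_Q(V)$ be the quotient of $T(V)$ by the ideal generated by $x_i\otimes x_j+q_{ij}^{-1}x_j\otimes x_i$ ($i<j$) and $x_i\otimes x_i$. It has the basis $x^\beta=x_1^{\beta(1)}\wedge\cdots\wedge x_N^{\beta(N)}$, $\beta\in\{0,1\}^N$. The Koszul complex $K_*(S_Q(V),S_Q^\sigma(V))$ has $K_n=S_Q(V)\otimes\Lambda_Q^n(V)$, with basis $x^\alpha\otimes x^\beta$, $|\beta|=\sum_i\beta(i)=n$, and differential $$d(x^\alpha\otimes x^\beta)=\sum_{i:\,\beta(i)=1}\Omega(\alpha,\beta,i)\,x^{\alpha+\kappa_i}\otimes x^{\beta-\kappa_i},$$ $$\Omega(\alpha,\beta,i)=(-1)^{\sum_{s<i}\beta(s)}\Big(\prod_{s<i}q_{si}^{\beta(s)}\prod_{r>i}q_{ir}^{-\alpha(r)}-p_i\prod_{s>i}q_{is}^{\beta(s)}\prod_{r<i}q_{ri}^{-\alpha(r)}\Big).$$ It arises by applying $S_Q^\sigma(V)\otimes_{S_Q(V)\otimes S_Q(V)^{op}}-$ to Wambst's Koszul resolution of $S_Q(V)$, and its homology is identified with $HH_*(S_Q(V),S_Q^\sigma(V))$.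
   Formalization: Genericity exempts all multiples of the unit multiindices, not only 0 and κ_j (as printed, 2κ_j always violates it, so no parameters would be generic); that the top class spans HH_N is claimed only for N≠1, since it fails for C[x]. *)

theory Defs
  imports
    Complex_Main
    "HOL-Library.Poly_Mapping"
    "HOL-Library.FuncSet"
    "HOL-Combinatorics.Multiset_Permutations"
    "HOL-Algebra.QuotRing"
    "HOL-Algebra.Module"
begin

section \<open>Free complex vector spaces\<close>

text \<open>The free complex vector space on a type is the type of finitely supported functions
  into the complex numbers; a basis vector is \<open>Poly_Mapping.single x 1\<close>.\<close>

definition fscale :: "complex \<Rightarrow> ('a \<Rightarrow>\<^sub>0 complex) \<Rightarrow> ('a \<Rightarrow>\<^sub>0 complex)" where
  "fscale c f = Poly_Mapping.map (\<lambda>z. c * z) f"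

lemma lookup_fscale [simp]: "Poly_Mapping.lookup (fscale c f) x = c * Poly_Mapping.lookup f x"
  by (simp add: fscale_def Poly_Mapping.map.rep_eq when_def)

global_interpretation free_vs: vector_space fscale
  by unfold_locales (auto intro!: poly_mapping_eqI simp: lookup_add algebra_simps)

definition lin_ext :: "('a \<Rightarrow> ('b \<Rightarrow>\<^sub>0 complex)) \<Rightarrow> ('a \<Rightarrow>\<^sub>0 complex) \<Rightarrow> ('b \<Rightarrow>\<^sub>0 complex)" where
  "lin_ext g f = (\<Sum>x\<in>Poly_Mapping.keys f. fscale (Poly_Mapping.lookup f x) (g x))"


section \<open>Twisted Hochschild homology of an algebra\<close>

text \<open>A complex algebra is a record of type \<open>(complex, 'a) module\<close>: the ring together with
  the scalar multiplication. The homology is defined for every such record.\<close>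

definition algebra_automorphism ::
  "(complex, 'a, 'm) module_scheme \<Rightarrow> ('a \<Rightarrow> 'a) \<Rightarrow> bool" where
  "algebra_automorphism A \<sigma> \<longleftrightarrow>
     \<sigma> \<in> ring_iso A A \<and> (\<forall>c. \<forall>a\<in>carrier A. \<sigma> (c \<odot>\<^bsub>A\<^esub> a) = c \<odot>\<^bsub>A\<^esub> \<sigma> a)"

text \<open>The tensor power of \<open>A\<close> with \<open>n + 1\<close> factors is the free vector space on the lists
  \<open>[a\<^sub>0, \<dots>, a\<^sub>n]\<close> (standing for the pure tensors) modulo the multilinearity relations.\<close>

definition free_tensors ::
  "(complex, 'a, 'm) module_scheme \<Rightarrow> nat \<Rightarrow> ('a list \<Rightarrow>\<^sub>0 complex) set" where
  "free_tensors A n = {z. \<forall>xs\<in>Poly_Mapping.keys z. length xs = n + 1 \<and> set xs \<subseteq> carrier A}"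

definition tensor_relations ::
  "(complex, 'a, 'm) module_scheme \<Rightarrow> nat \<Rightarrow> ('a list \<Rightarrow>\<^sub>0 complex) set" where
  "tensor_relations A n = free_vs.span
     ({Poly_Mapping.single (xs[i := a \<oplus>\<^bsub>A\<^esub> b]) 1
         - Poly_Mapping.single (xs[i := a]) 1 - Poly_Mapping.single (xs[i := b]) 1 | xs i a b.
         length xs = n + 1 \<and> set xs \<subseteq> carrier A \<and> i \<le> n \<and> a \<in> carrier A \<and> b \<in> carrier A}
      \<union> {Poly_Mapping.single (xs[i := c \<odot>\<^bsub>A\<^esub> a]) 1 - Poly_Mapping.single (xs[i := a]) c | xs i c a.
         length xs = n + 1 \<and> set xs \<subseteq> carrier A \<and> i \<le> n \<and> a \<in> carrier A})"

text \<open>The value of the twisted boundary on the pure tensor \<open>[a\<^sub>0, \<dots>, a\<^sub>n]\<close>; it is zero for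
  \<open>n = 0\<close>. In the last summand \<open>tl (butlast xs)\<close> is \<open>[a\<^sub>1, \<dots>, a\<^bsub>n-1\<^esub>]\<close>.\<close>

definition hochschild_b_pure ::
  "(complex, 'a, 'm) module_scheme \<Rightarrow> ('a \<Rightarrow> 'a) \<Rightarrow> 'a list \<Rightarrow> ('a list \<Rightarrow>\<^sub>0 complex)" where
  "hochschild_b_pure A \<sigma> xs = (let n = length xs - 1 in
     if n = 0 then 0
     else (\<Sum>i<n. Poly_Mapping.single
              (take i xs @ (xs ! i \<otimes>\<^bsub>A\<^esub> xs ! (i + 1)) # drop (i + 2) xs) ((-1) ^ i))
        + Poly_Mapping.single
            ((\<sigma> (last xs) \<otimes>\<^bsub>A\<^esub> hd xs) # tl (butlast xs)) ((-1) ^ n))"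

definition hochschild_b ::
  "(complex, 'a, 'm) module_scheme \<Rightarrow> ('a \<Rightarrow> 'a) \<Rightarrow> ('a list \<Rightarrow>\<^sub>0 complex) \<Rightarrow> ('a list \<Rightarrow>\<^sub>0 complex)" where
  "hochschild_b A \<sigma> = lin_ext (hochschild_b_pure A \<sigma>)"

text \<open>Cycles and boundaries are the full preimages, in the free vector space, of the cycles and
  boundaries of the complex \<open>C\<^sub>n = free_tensors A n / tensor_relations A n\<close>. Hence the homology
  of that complex is the quotient of the former by the latter. Its elements are cosets; the
  zero element is the class of 0. (For \<open>n = 0\<close> every chain is a cycle since \<open>b\<close> vanishes.)\<close>

definition hochschild_cycles ::
  "(complex, 'a, 'm) module_scheme \<Rightarrow> ('a \<Rightarrow> 'a) \<Rightarrow> nat \<Rightarrow> ('a list \<Rightarrow>\<^sub>0 complex) set" where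
  "hochschild_cycles A \<sigma> n =
     {z \<in> free_tensors A n. hochschild_b A \<sigma> z \<in> tensor_relations A (n - 1)}"

definition hochschild_boundaries ::
  "(complex, 'a, 'm) module_scheme \<Rightarrow> ('a \<Rightarrow> 'a) \<Rightarrow> nat \<Rightarrow> ('a list \<Rightarrow>\<^sub>0 complex) set" where
  "hochschild_boundaries A \<sigma> n =
     {r + hochschild_b A \<sigma> y | r y. r \<in> tensor_relations A n \<and> y \<in> free_tensors A (n + 1)}"

definition HH_class ::
  "(complex, 'a, 'm) module_scheme \<Rightarrow> ('a \<Rightarrow> 'a) \<Rightarrow> nat \<Rightarrow> ('a list \<Rightarrow>\<^sub>0 complex)
    \<Rightarrow> ('a list \<Rightarrow>\<^sub>0 complex) set" where
  "HH_class A \<sigma> n z = {z + y | y. y \<in> hochschild_boundaries A \<sigma> n}"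

definition HH ::
  "(complex, 'a, 'm) module_scheme \<Rightarrow> ('a \<Rightarrow> 'a) \<Rightarrow> nat \<Rightarrow> ('a list \<Rightarrow>\<^sub>0 complex) set set" where
  "HH A \<sigma> n = HH_class A \<sigma> n ` hochschild_cycles A \<sigma> n"

definition HH_zero ::
  "(complex, 'a, 'm) module_scheme \<Rightarrow> ('a \<Rightarrow> 'a) \<Rightarrow> nat \<Rightarrow> ('a list \<Rightarrow>\<^sub>0 complex) set" where
  "HH_zero A \<sigma> n = HH_class A \<sigma> n 0"


section \<open>The quantum hyperplane\<close>

text \<open>The tensor algebra of the vector space with basis \<open>x\<^sub>1, \<dots>, x\<^sub>N\<close>: a word
  \<open>[i\<^sub>1, \<dots>, i\<^sub>k]\<close> over \<open>{1..N}\<close> stands for the tensor of \<open>x\<close> with these indices.\<close>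

definition tensor_algebra :: "nat \<Rightarrow> (complex, nat list \<Rightarrow>\<^sub>0 complex) module" where
  "tensor_algebra N =
     \<lparr>carrier = {f. \<forall>w\<in>Poly_Mapping.keys f. set w \<subseteq> {1..N}},
      mult = (\<lambda>f g. \<Sum>u\<in>Poly_Mapping.keys f. \<Sum>v\<in>Poly_Mapping.keys g. Poly_Mapping.single (u @ v) (Poly_Mapping.lookup f u * Poly_Mapping.lookup g v)),
      one = Poly_Mapping.single [] 1,
      zero = 0,
      add = (+),
      smult = fscale\<rparr>"

definition quotient_algebra ::
  "(complex, 'a, 'm) module_scheme \<Rightarrow> 'a set \<Rightarrow> (complex, 'a set) module" where
  "quotient_algebra A I = ring.extend (A Quot I)
     (module.fields (\<lambda>c X. \<Union>a\<in>X. I +>\<^bsub>A\<^esub> (c \<odot>\<^bsub>A\<^esub> a)))"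

definition hyperplane_parameters :: "nat \<Rightarrow> (nat \<Rightarrow> nat \<Rightarrow> complex) \<Rightarrow> bool" where
  "hyperplane_parameters N q \<longleftrightarrow>
     (\<forall>i\<in>{1..N}. \<forall>j\<in>{1..N}. q i j \<noteq> 0) \<and>
     (\<forall>i\<in>{1..N}. q i i = 1) \<and>
     (\<forall>i\<in>{1..N}. \<forall>j\<in>{1..N}. i < j \<longrightarrow> q j i = inverse (q i j))"

definition hyperplane_ideal ::
  "nat \<Rightarrow> (nat \<Rightarrow> nat \<Rightarrow> complex) \<Rightarrow> (nat list \<Rightarrow>\<^sub>0 complex) set" where
  "hyperplane_ideal N q = Idl\<^bsub>tensor_algebra N\<^esub>
     {Poly_Mapping.single [i, j] 1 - Poly_Mapping.single [j, i] (q i j) | i j. 1 \<le> i \<and> i < j \<and> j \<le> N}"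

definition hyperplane ::
  "nat \<Rightarrow> (nat \<Rightarrow> nat \<Rightarrow> complex) \<Rightarrow> (complex, (nat list \<Rightarrow>\<^sub>0 complex) set) module" where
  "hyperplane N q = quotient_algebra (tensor_algebra N) (hyperplane_ideal N q)"

definition word_class ::
  "nat \<Rightarrow> (nat \<Rightarrow> nat \<Rightarrow> complex) \<Rightarrow> nat list \<Rightarrow> (nat list \<Rightarrow>\<^sub>0 complex) set" where
  "word_class N q w = hyperplane_ideal N q +>\<^bsub>tensor_algebra N\<^esub> Poly_Mapping.single w 1"

definition hyperplane_gen ::
  "nat \<Rightarrow> (nat \<Rightarrow> nat \<Rightarrow> complex) \<Rightarrow> nat \<Rightarrow> (nat list \<Rightarrow>\<^sub>0 complex) set" where
  "hyperplane_gen N q i = word_class N q [i]"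

text \<open>Multiindices are functions \<open>nat \<Rightarrow> nat\<close> vanishing outside \<open>{1..N}\<close>.\<close>

definition multiindices :: "nat \<Rightarrow> (nat \<Rightarrow> nat) set" where
  "multiindices N = {\<gamma>. \<forall>i. i \<notin> {1..N} \<longrightarrow> \<gamma> i = 0}"

definition unit_index :: "nat \<Rightarrow> nat \<Rightarrow> nat" where
  "unit_index j = (\<lambda>i. if i = j then 1 else 0)"

definition hyperplane_monomial ::
  "nat \<Rightarrow> (nat \<Rightarrow> nat \<Rightarrow> complex) \<Rightarrow> (nat \<Rightarrow> nat) \<Rightarrow> (nat list \<Rightarrow>\<^sub>0 complex) set" where
  "hyperplane_monomial N q \<alpha> = word_class N q (concat (map (\<lambda>i. replicate (\<alpha> i) i) [1..<N + 1]))"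

definition scaling_automorphism ::
  "nat \<Rightarrow> (nat \<Rightarrow> nat \<Rightarrow> complex) \<Rightarrow> (nat \<Rightarrow> complex)
    \<Rightarrow> ((nat list \<Rightarrow>\<^sub>0 complex) set \<Rightarrow> (nat list \<Rightarrow>\<^sub>0 complex) set) \<Rightarrow> bool" where
  "scaling_automorphism N q p \<sigma> \<longleftrightarrow>
     algebra_automorphism (hyperplane N q) \<sigma> \<and>
     (\<forall>i\<in>{1..N}. p i \<noteq> 0 \<and>
        \<sigma> (hyperplane_gen N q i) = p i \<odot>\<^bsub>hyperplane N q\<^esub> hyperplane_gen N q i)"


section \<open>Genericity\<close>

text \<open>The multiindices that are exempt from the genericity condition are the multiples
  \<open>m \<kappa>\<^sub>j\<close> of the unit multiindices (including 0), not just 0 and the \<open>\<kappa>\<^sub>j\<close>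
  themselves: since \<open>q\<^sub>j\<^sub>j = 1\<close>, the index \<open>m \<kappa>\<^sub>j\<close> satisfies the
  condition for every matrix. Exempting only \<open>m \<le> 1\<close> would leave no generic parameters at all
  for \<open>N \<ge> 1\<close>; that literal reading implies the one used here. Both facts are proved below.\<close>

definition bad_index :: "nat \<Rightarrow> (nat \<Rightarrow> nat \<Rightarrow> complex) \<Rightarrow> (nat \<Rightarrow> nat) \<Rightarrow> bool" where
  "bad_index N q \<gamma> \<longleftrightarrow>
     \<gamma> \<in> multiindices N \<and> (\<forall>i\<in>{1..N}. \<gamma> i > 0 \<longrightarrow> (\<Prod>k=1..N. q k i ^ \<gamma> k) = 1)"

definition generic :: "nat \<Rightarrow> (nat \<Rightarrow> nat \<Rightarrow> complex) \<Rightarrow> bool" where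
  "generic N q \<longleftrightarrow>
     \<not> (\<exists>\<gamma>. bad_index N q \<gamma> \<and> \<gamma> \<noteq> (\<lambda>_. 0) \<and>
           (\<forall>j\<in>{1..N}. \<forall>m. \<gamma> \<noteq> (\<lambda>i. m * unit_index j i)))"

definition literally_generic :: "nat \<Rightarrow> (nat \<Rightarrow> nat \<Rightarrow> complex) \<Rightarrow> bool" where
  "literally_generic N q \<longleftrightarrow>
     \<not> (\<exists>\<gamma>. bad_index N q \<gamma> \<and> \<gamma> \<noteq> (\<lambda>_. 0) \<and> (\<forall>j\<in>{1..N}. \<gamma> \<noteq> unit_index j))"

lemma literally_generic_imp_generic: "literally_generic N q \<Longrightarrow> generic N q"
  unfolding literally_generic_def generic_def
  by (metis (no_types, lifting) ext mult_1)

lemma not_literally_generic: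
  assumes "hyperplane_parameters N q" "N \<ge> 1"
  shows "\<not> literally_generic N q"
proof -
  define \<gamma> where "\<gamma> = (\<lambda>i. 2 * unit_index 1 i)"
  have "(\<Prod>k=1..N. q k 1 ^ \<gamma> k) = 1"
    using assms by (intro prod.neutral) (auto simp: \<gamma>_def unit_index_def hyperplane_parameters_def)
  hence "bad_index N q \<gamma>"
    using assms(2) by (auto simp: bad_index_def \<gamma>_def unit_index_def multiindices_def)
  moreover have "\<gamma> 1 = 2" by (simp add: \<gamma>_def unit_index_def)
  hence "\<gamma> \<noteq> (\<lambda>_. 0)" "\<forall>j\<in>{1..N}. \<gamma> \<noteq> unit_index j"
    by (auto simp: unit_index_def split: if_splits)
  ultimately show ?thesis
    unfolding literally_generic_def by blast
qed


section \<open>The Koszul complex\<close>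

text \<open>The basis vector \<open>x\<^sup>\<alpha> \<otimes> x\<^sup>\<beta>\<close> is the pair \<open>(\<alpha>, \<beta>)\<close>.\<close>

definition koszul_chains ::
  "nat \<Rightarrow> nat \<Rightarrow> ((nat \<Rightarrow> nat) \<times> (nat \<Rightarrow> nat) \<Rightarrow>\<^sub>0 complex) set" where
  "koszul_chains N n =
     {z. \<forall>(\<alpha>, \<beta>)\<in>Poly_Mapping.keys z. \<alpha> \<in> multiindices N \<and> \<beta> \<in> multiindices N \<and>
           (\<forall>i. \<beta> i \<le> 1) \<and> (\<Sum>i=1..N. \<beta> i) = n}"

definition Omega ::
  "nat \<Rightarrow> (nat \<Rightarrow> nat \<Rightarrow> complex) \<Rightarrow> (nat \<Rightarrow> complex)
    \<Rightarrow> (nat \<Rightarrow> nat) \<Rightarrow> (nat \<Rightarrow> nat) \<Rightarrow> nat \<Rightarrow> complex" where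
  "Omega N q p \<alpha> \<beta> i = (-1) ^ (\<Sum>s\<in>{1..<i}. \<beta> s) *
     ((\<Prod>s\<in>{1..<i}. q s i ^ \<beta> s) * (\<Prod>r\<in>{i<..N}. q i r powi (- int (\<alpha> r)))
      - p i * (\<Prod>s\<in>{i<..N}. q i s ^ \<beta> s) * (\<Prod>r\<in>{1..<i}. q r i powi (- int (\<alpha> r))))"

definition koszul_d ::
  "nat \<Rightarrow> (nat \<Rightarrow> nat \<Rightarrow> complex) \<Rightarrow> (nat \<Rightarrow> complex)
    \<Rightarrow> ((nat \<Rightarrow> nat) \<times> (nat \<Rightarrow> nat) \<Rightarrow>\<^sub>0 complex) \<Rightarrow> ((nat \<Rightarrow> nat) \<times> (nat \<Rightarrow> nat) \<Rightarrow>\<^sub>0 complex)" where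
  "koszul_d N q p = lin_ext (\<lambda>(\<alpha>, \<beta>).
     \<Sum>i\<in>{i\<in>{1..N}. \<beta> i = 1}.
       Poly_Mapping.single (\<lambda>j. \<alpha> j + unit_index i j, \<lambda>j. \<beta> j - unit_index i j) (Omega N q p \<alpha> \<beta> i))"

definition koszul_cycles ::
  "nat \<Rightarrow> (nat \<Rightarrow> nat \<Rightarrow> complex) \<Rightarrow> (nat \<Rightarrow> complex) \<Rightarrow> nat
    \<Rightarrow> ((nat \<Rightarrow> nat) \<times> (nat \<Rightarrow> nat) \<Rightarrow>\<^sub>0 complex) set" where
  "koszul_cycles N q p n = {z \<in> koszul_chains N n. koszul_d N q p z = 0}"

text \<open>The chain \<open>1 \<otimes> x\<^sub>1 \<and> \<dots> \<and> x\<^sub>N\<close>.\<close>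

definition koszul_top :: "nat \<Rightarrow> ((nat \<Rightarrow> nat) \<times> (nat \<Rightarrow> nat) \<Rightarrow>\<^sub>0 complex)" where
  "koszul_top N = Poly_Mapping.single (\<lambda>_. 0, \<lambda>i. if i \<in> {1..N} then 1 else 0) 1"

text \<open>The identification of Koszul homology with Hochschild homology is induced by the
  embedding of the Koszul resolution into the bar resolution, i.e. by
  \<open>x\<^sup>\<alpha> \<otimes> x\<^sup>\<beta> \<mapsto> \<Sum>w. c(w) x\<^sup>\<alpha> \<otimes> x\<^bsub>w(1)\<^esub> \<otimes> \<dots> \<otimes> x\<^bsub>w(n)\<^esub>\<close>, where \<open>w\<close> runs over the arrangements
  of the support of \<open>\<beta>\<close> and \<open>c(w)\<close> is the product of \<open>- q\<^sub>s\<^sub>t\<close> over the pairs \<open>s < t\<close> such that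
  \<open>t\<close> precedes \<open>s\<close> in \<open>w\<close>. For instance, \<open>1 \<otimes> x\<^sub>i \<and> x\<^sub>j\<close> is sent to
  \<open>1 \<otimes> (x\<^sub>i \<otimes> x\<^sub>j - q\<^sub>i\<^sub>j x\<^sub>j \<otimes> x\<^sub>i)\<close> for \<open>i < j\<close>. In the boundary of the image, the inner faces
  cancel in pairs by the defining relations and the two outer faces give the two terms of
  \<open>Omega\<close>. The map does not depend on the automorphism.\<close>

definition arrangement_coeff :: "(nat \<Rightarrow> nat \<Rightarrow> complex) \<Rightarrow> nat list \<Rightarrow> complex" where
  "arrangement_coeff q w =
     (\<Prod>(a, b)\<in>{(a, b). a < b \<and> b < length w \<and> w ! b < w ! a}. - q (w ! b) (w ! a))"

definition koszul_to_hochschild ::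
  "nat \<Rightarrow> (nat \<Rightarrow> nat \<Rightarrow> complex) \<Rightarrow> ((nat \<Rightarrow> nat) \<times> (nat \<Rightarrow> nat) \<Rightarrow>\<^sub>0 complex)
    \<Rightarrow> ((nat list \<Rightarrow>\<^sub>0 complex) set list \<Rightarrow>\<^sub>0 complex)" where
  "koszul_to_hochschild N q = lin_ext (\<lambda>(\<alpha>, \<beta>).
     \<Sum>w\<in>permutations_of_set {i\<in>{1..N}. \<beta> i = 1}.
       Poly_Mapping.single (hyperplane_monomial N q \<alpha> # map (hyperplane_gen N q) w)
         (arrangement_coeff q w))"

end

theory Submission
  imports Defs "HOL-Library.Function_Algebras"
begin

text \<open>The Koszul chain \<open>1 \<otimes> x\<^sub>1 \<and> \<dots> \<and> x\<^sub>N\<close> is a cycle exactly if \<open>p\<^sub>i\<close> is the product of all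
  \<open>q\<^sub>s\<^sub>i\<close>, which determines the automorphism. Sorting words shows that the algebra has a basis of
  monomials with \<open>x\<^sup>\<alpha> x\<^sup>\<beta>\<close> a multiple of \<open>x\<^bsup>\<alpha>+\<beta>\<^esup>\<close>, so its Hochschild complex is spanned by tuples of
  multiindices. Instead of comparing resolutions, we contract this complex by an acyclic matching
  in the style of Anick: the only critical cells are \<open>x\<^sup>\<alpha> \<otimes> x\<^sub>i \<otimes> x\<^sub>j \<otimes> \<dots>\<close> with decreasing indices
  \<open>i > j > \<dots>\<close>. There are none above degree \<open>N\<close>, and in degree \<open>N\<close> they are the leading terms of the
  images of the Koszul chains \<open>x\<^sup>\<alpha> \<otimes> x\<^sub>1 \<and> \<dots> \<and> x\<^sub>N\<close>. A combination of these images is a cycle only if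
  the product over \<open>r\<close> of \<open>q\<^sub>r\<^sub>i\<close> to the power \<open>\<alpha>(r)\<close> is 1 for all \<open>i\<close> and all \<open>\<alpha>\<close> that occur, and
  genericity leaves only \<open>\<alpha> = 0\<close>. The class is not zero, because no cell of degree \<open>N + 1\<close>
  has the cell \<open>1 \<otimes> x\<^sub>1 \<otimes> \<dots> \<otimes> x\<^sub>N\<close> in its boundary.\<close>

text \<open>One triangularity statement is used twice. The boundary of the partner of a source is a
  nonzero multiple of that source plus smaller sources and non-sources. Hence the sources of a chain
  can be cleared by boundaries, and a cycle carried by partners alone is 0. The complex is not
  normalised, so zero exponents behind slot 0 occur and need a matching of their own, by parity of
  the first run of zeros. Slot 0 is arbitrary and faces can move letters into it; the order
  therefore counts the letters of the tail only, whereas the argument that the top class does not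
  bound counts all letters. Genericity tolerates the multiples m \<kappa>_j. They are excluded in
  the top degree because the cycle condition holds for every i and not only for i in the support of
  \<alpha>; this needs a second index. For N = 1 the cycle condition gives p_1 = 1, the algebra is
  C[x] with the identity, and the first homology is infinite-dimensional, so the description of the
  whole top group is restricted to N \<noteq> 1.\<close>

abbreviation "keys \<equiv> Poly_Mapping.keys"
abbreviation "lookup \<equiv> Poly_Mapping.lookup"
abbreviation "single \<equiv> Poly_Mapping.single"

section \<open>Linear extension of maps and supports of vectors\<close>

lemma lin_ext_superset:
  assumes "finite S" "keys f \<subseteq> S"
  shows "lin_ext g f = (\<Sum>x\<in>S. fscale (lookup f x) (g x))"
  unfolding lin_ext_def
  using assms by (intro sum.mono_neutral_left) (auto simp: in_keys_iff)

lemma lin_ext_add: "lin_ext g (f + h) = lin_ext g f + lin_ext g h"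
proof -
  let ?S = "keys f \<union> keys h"
  have "keys (f + h) \<subseteq> ?S" by (rule Poly_Mapping.keys_add)
  then show ?thesis
    by (simp add: lin_ext_superset[of ?S] lookup_add free_vs.scale_left_distrib sum.distrib)
qed

lemma lin_ext_fscale: "lin_ext g (fscale c f) = fscale c (lin_ext g f)"
proof -
  have "keys (fscale c f) \<subseteq> keys f" by (auto simp: in_keys_iff)
  then show ?thesis
    by (simp add: lin_ext_superset[of "keys f"] free_vs.scale_sum_right)
qed

lemma linear_lin_ext: "Vector_Spaces.linear fscale fscale (lin_ext g)"
  by (intro Vector_Spaces.linear_iff[THEN iffD2] conjI)
     (auto simp: lin_ext_add lin_ext_fscale free_vs.vector_space_axioms)

lemma lin_ext_zero [simp]: "lin_ext g 0 = 0"
  by (simp add: lin_ext_def)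

lemma lin_ext_diff: "lin_ext g (f - h) = lin_ext g f - lin_ext g h"
  using module_hom.diff[OF Vector_Spaces.linear.axioms(3)[OF linear_lin_ext]] .

lemma lin_ext_sum: "lin_ext g (sum h S) = (\<Sum>x\<in>S. lin_ext g (h x))"
  using module_hom.sum[OF Vector_Spaces.linear.axioms(3)[OF linear_lin_ext]] .

lemma lin_ext_single: "lin_ext g (single x c) = fscale c (g x)"
  by (simp add: lin_ext_superset[of "{x}"])

lemma fscale_single [simp]: "fscale c (single x d) = single x (c * d)"
  by (simp add: fscale_def)

lemma lin_ext_cong: "(\<And>x. x \<in> keys f \<Longrightarrow> g x = h x) \<Longrightarrow> lin_ext g f = lin_ext h f"
  by (simp add: lin_ext_def)

lemma lin_ext_singles: "lin_ext (\<lambda>x. single x 1) f = f"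
  by (rule poly_mapping_eqI)
     (simp add: lin_ext_def lookup_sum lookup_single when_def in_keys_iff)

lemma lin_ext_comp: "lin_ext g (lin_ext h f) = lin_ext (\<lambda>x. lin_ext g (h x)) f"
  by (simp add: lin_ext_def[of h] lin_ext_sum lin_ext_fscale lin_ext_def[of "\<lambda>x. lin_ext g (h x)"])

lemma lin_ext_add_fun: "lin_ext (\<lambda>x. g x + h x) f = lin_ext g f + lin_ext h f"
  by (simp add: lin_ext_def free_vs.scale_right_distrib sum.distrib)

lemma lin_ext_diff_fun: "lin_ext (\<lambda>x. g x - h x) f = lin_ext g f - lin_ext h f"
  by (simp add: lin_ext_def free_vs.scale_right_diff_distrib sum_subtractf)

lemma lin_ext_fscale_fun: "lin_ext (\<lambda>x. fscale c (g x)) f = fscale c (lin_ext g f)"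
  by (simp add: lin_ext_def free_vs.scale_sum_right mult.commute)

lemma lin_ext_zero_fun [simp]: "lin_ext (\<lambda>x. 0) f = 0"
  by (simp add: lin_ext_def)

lemma lin_ext_commute:
  "lin_ext (\<lambda>x. lin_ext (\<lambda>y. g x y) h) f = lin_ext (\<lambda>y. lin_ext (\<lambda>x. g x y) f) h"
  unfolding lin_ext_def free_vs.scale_sum_right
  by (subst sum.swap) (simp add: mult.commute)

lemma lookup_lin_ext: "lookup (lin_ext g f) y = (\<Sum>x\<in>keys f. lookup f x * lookup (g x) y)"
  by (simp add: lin_ext_def lookup_sum)

lemma keys_lin_ext: "keys (lin_ext g f) \<subseteq> (\<Union>x\<in>keys f. keys (g x))"
proof
  fix y assume "y \<in> keys (lin_ext g f)"
  then have "(\<Sum>x\<in>keys f. lookup f x * lookup (g x) y) \<noteq> 0"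
    by (simp add: in_keys_iff lookup_lin_ext)
  then obtain x where "x \<in> keys f" "lookup f x * lookup (g x) y \<noteq> 0"
    by (meson sum.neutral)
  then show "y \<in> (\<Union>x\<in>keys f. keys (g x))" by (auto simp: in_keys_iff)
qed

definition supported :: "'a set \<Rightarrow> ('a \<Rightarrow>\<^sub>0 complex) set" where
  "supported S = {f. keys f \<subseteq> S}"

lemma supported_iff: "f \<in> supported S \<longleftrightarrow> (\<forall>x. x \<notin> S \<longrightarrow> lookup f x = 0)"
  by (auto simp: supported_def in_keys_iff)

lemma subspace_supported: "free_vs.subspace (supported S)"
  by (rule free_vs.subspaceI) (auto simp: supported_iff lookup_add)

lemmas supported_add = free_vs.subspace_add[OF subspace_supported]
  and supported_diff = free_vs.subspace_diff[OF subspace_supported]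
  and supported_fscale = free_vs.subspace_scale[OF subspace_supported]
  and supported_zero = free_vs.subspace_0[OF subspace_supported]
  and supported_sum = free_vs.subspace_sum[OF subspace_supported]

lemma supported_single: "x \<in> S \<Longrightarrow> single x c \<in> supported S"
  by (simp add: supported_def)

lemma lin_ext_in_subspace:
  assumes "free_vs.subspace V" "\<And>x. x \<in> keys f \<Longrightarrow> g x \<in> V"
  shows "lin_ext g f \<in> V"
  unfolding lin_ext_def using assms
  by (intro free_vs.subspace_sum free_vs.subspace_scale) auto

lemma lin_ext_supported:
  "f \<in> supported S \<Longrightarrow> (\<And>x. x \<in> S \<Longrightarrow> g x \<in> supported U) \<Longrightarrow> lin_ext g f \<in> supported U"
  by (intro lin_ext_in_subspace subspace_supported) (auto simp: supported_def)

lemma lin_ext_eq_0: "f \<in> supported S \<Longrightarrow> (\<And>x. x \<in> S \<Longrightarrow> g x = 0) \<Longrightarrow> lin_ext g f = 0"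
  by (auto simp: lin_ext_def supported_def intro!: sum.neutral)

lemma lin_ext_cong_supported:
  "f \<in> supported S \<Longrightarrow> (\<And>x. x \<in> S \<Longrightarrow> g x = h x) \<Longrightarrow> lin_ext g f = lin_ext h f"
  by (rule lin_ext_cong) (auto simp: supported_def)

section \<open>Acyclic matchings\<close>

text \<open>Between the partners of \<open>S\<close> and \<open>S\<close> itself, the matrix of
  \<open>D\<close> is triangular with nonzero diagonal: apart from \<open>a\<close>, the boundary of
  \<open>M a\<close> meets \<open>S\<close> only in elements of smaller rank. Well-foundedness
  stands in for finiteness, as \<open>S\<close> may be infinite.\<close>

locale acyclic_matching =
  fixes D :: "'a \<Rightarrow> ('b \<Rightarrow>\<^sub>0 complex)" and S :: "'b set" and M :: "'b \<Rightarrow> 'a"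
    and rank :: "'b \<Rightarrow> 'r" and R :: "('r \<times> 'r) set"
  assumes wf_R: "wf R"
    and diag: "a \<in> S \<Longrightarrow> lookup (D (M a)) a \<noteq> 0"
    and decr: "a \<in> S \<Longrightarrow> a' \<in> S \<Longrightarrow> a' \<noteq> a \<Longrightarrow> lookup (D (M a)) a' \<noteq> 0
                 \<Longrightarrow> (rank a', rank a) \<in> R"
begin

definition reducible :: "('b \<Rightarrow>\<^sub>0 complex) \<Rightarrow> bool" where
  "reducible z \<longleftrightarrow> (\<exists>y\<in>supported (M ` S). z - lin_ext D y \<in> supported (- S))"

lemma reducible_add: "reducible z \<Longrightarrow> reducible w \<Longrightarrow> reducible (z + w)"
proof -
  assume "reducible z" "reducible w"
  then obtain y v where "y \<in> supported (M ` S)" "v \<in> supported (M ` S)"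
    "z - lin_ext D y \<in> supported (- S)" "w - lin_ext D v \<in> supported (- S)"
    by (auto simp: reducible_def)
  then show "reducible (z + w)" unfolding reducible_def
    by (intro bexI[of _ "y + v"]) (auto simp: lin_ext_add add_diff_add intro: supported_add)
qed

lemma reducible_fscale: "reducible z \<Longrightarrow> reducible (fscale c z)"
  unfolding reducible_def
  by (metis lin_ext_fscale free_vs.scale_right_diff_distrib supported_fscale)

lemma reducible_lin_ext:
  assumes "\<And>x. x \<in> keys f \<Longrightarrow> reducible (g x)"
  shows "reducible (lin_ext g f)"
proof -
  have 0: "reducible 0"
    by (auto simp: reducible_def intro!: bexI[of _ 0] supported_zero)
  have "reducible (\<Sum>x\<in>X. fscale (lookup f x) (g x))" if "finite X" "X \<subseteq> keys f" for X
    using that by (induction X) (auto intro: 0 assms reducible_add reducible_fscale)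
  then show ?thesis by (simp add: lin_ext_def)
qed

text \<open>Gaussian elimination along the well-founded order: subtracting the right multiple of
  \<open>D (M a)\<close> removes \<open>a\<close> and leaves in \<open>S\<close> only elements of
  smaller rank, which the induction hypothesis clears.\<close>

lemma reducible_single: "reducible (single a 1)"
proof (induction "rank a" arbitrary: a rule: wf_induct_rule[OF wf_R])
  case (1 a)
  show ?case
  proof (cases "a \<in> S")
    case False
    then show ?thesis by (auto simp: reducible_def intro!: bexI[of _ 0] supported_zero supported_single)
  next
    case True
    define y where "y = single (M a) (inverse (lookup (D (M a)) a))"
    have y: "y \<in> supported (M ` S)" using True by (auto simp: y_def intro: supported_single)
    have D: "lin_ext D y = fscale (inverse (lookup (D (M a)) a)) (D (M a))"
      by (simp add: y_def lin_ext_single)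
    have "reducible (single x 1)" if "x \<in> keys (single a 1 - lin_ext D y)" for x
    proof (cases "x \<in> S")
      case True
      have "x \<noteq> a" using that diag[OF \<open>a \<in> S\<close>]
        by (auto simp: in_keys_iff D lookup_minus)
      moreover from this have "lookup (D (M a)) x \<noteq> 0" using that
        by (auto simp: in_keys_iff D lookup_minus lookup_single)
      ultimately show ?thesis using 1 decr \<open>a \<in> S\<close> True by blast
    next
      case False
      then show ?thesis
        by (auto simp: reducible_def intro!: bexI[of _ 0] supported_zero supported_single)
    qed
    then have "reducible (single a 1 - lin_ext D y)"
      by (subst lin_ext_singles[symmetric]) (rule reducible_lin_ext)
    then obtain v where v: "v \<in> supported (M ` S)"
      "single a 1 - lin_ext D y - lin_ext D v \<in> supported (- S)"
      by (auto simp: reducible_def)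
    show ?thesis unfolding reducible_def
      using v y by (intro bexI[of _ "y + v"]) (auto simp: lin_ext_add diff_diff_eq intro: supported_add)
  qed
qed

theorem reduce: "\<exists>y\<in>supported (M ` S). z - lin_ext D y \<in> supported (- S)"
  using reducible_lin_ext[of z "\<lambda>x. single x 1"] reducible_single
  by (simp add: lin_ext_singles reducible_def)

text \<open>In the finite support of \<open>z\<close>, some partner belongs to an element
  \<open>a\<close> that is maximal in the order. No other partner in the support reaches
  \<open>a\<close>, so the coefficient of \<open>a\<close> in \<open>lin_ext D z\<close> cannot
  cancel.\<close>

theorem target_cycle_zero:
  assumes z: "z \<in> supported (M ` S)" and Dz: "lin_ext D z \<in> supported (- S)"
  shows "z = 0"
proof (rule ccontr)
  assume "z \<noteq> 0"
  then have "keys z \<noteq> {}" by (metis poly_mapping_eqI in_keys_iff lookup_zero empty_iff)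
  define F where "F = {a \<in> S. M a \<in> keys z}"
  define G where "G = (SOME f. \<forall>k\<in>keys z. f k \<in> S \<and> M (f k) = k)"
  have "\<exists>f. \<forall>k\<in>keys z. f k \<in> S \<and> M (f k) = k"
    using z by (intro bchoice) (auto simp: supported_def)
  then have G: "\<And>k. k \<in> keys z \<Longrightarrow> G k \<in> S \<and> M (G k) = k"
    unfolding G_def by (rule someI2_ex) auto
  \<comment> \<open>Maximality comes from reversing the order on the finitely many sources involved:
    the converse of a finite acyclic relation is well-founded.\<close>
  let ?E = "(inv_image R rank \<inter> (G ` keys z \<times> G ` keys z))"
  have wfE: "wf ?E" by (rule wf_subset[OF wf_inv_image[OF wf_R]]) auto
  have "finite ?E" by (rule finite_subset[of _ "G ` keys z \<times> G ` keys z"]) auto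
  then have wfc: "wf (?E\<inverse>)" by (rule finite_acyclic_wf_converse[OF _ wf_acyclic[OF wfE]])
  obtain k0 where k0: "G k0 \<in> G ` keys z" using \<open>keys z \<noteq> {}\<close> by blast
  obtain a where a: "a \<in> G ` keys z" "\<And>b. (b, a) \<in> ?E\<inverse> \<Longrightarrow> b \<notin> G ` keys z"
    using wfE_min[OF wfc k0] by (metis (no_types, lifting))
  from a(1) obtain k where k: "k \<in> keys z" "a = G k" by auto
  have aS: "a \<in> S" "M a = k" using G k by auto
  have "lookup z x * lookup (D x) a = 0" if "x \<in> keys z" "x \<noteq> k" for x
  proof (rule ccontr)
    assume "lookup z x * lookup (D x) a \<noteq> 0"
    then have "lookup (D (M (G x))) a \<noteq> 0" using G[of x] that by auto
    moreover have "a \<noteq> G x" using G[of x] G[of k] that k by auto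
    ultimately have "(rank a, rank (G x)) \<in> R" using decr[of "G x" a] G[of x] that aS by auto
    then show False using a(2)[of "G x"] a(1) that by auto
  qed
  then have "lookup (lin_ext D z) a = lookup z k * lookup (D k) a"
    unfolding lookup_lin_ext using k by (subst sum.remove[of _ k]) (simp_all add: sum.neutral)
  also have "\<dots> \<noteq> 0" using diag[OF aS(1)] aS k by (auto simp: in_keys_iff)
  finally show False using Dz aS by (auto simp: supported_def in_keys_iff)
qed

end

section \<open>The Hochschild complex of a twisted monoid algebra\<close>

definition cons_chain :: "'a \<Rightarrow> ('a list \<Rightarrow>\<^sub>0 complex) \<Rightarrow> ('a list \<Rightarrow>\<^sub>0 complex)" where
  "cons_chain x = lin_ext (\<lambda>l. single (x # l) 1)"

definition snoc_chain :: "'a \<Rightarrow> ('a list \<Rightarrow>\<^sub>0 complex) \<Rightarrow> ('a list \<Rightarrow>\<^sub>0 complex)" where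
  "snoc_chain x = lin_ext (\<lambda>l. single (l @ [x]) 1)"

lemma cons_chain_single [simp]: "cons_chain x (single l a) = single (x # l) a"
  by (simp add: cons_chain_def lin_ext_single)

lemma snoc_chain_single [simp]: "snoc_chain x (single l a) = single (l @ [x]) a"
  by (simp add: snoc_chain_def lin_ext_single)

lemma cons_chain_diff: "cons_chain x (f - g) = cons_chain x f - cons_chain x g"
  by (simp add: cons_chain_def lin_ext_diff)

lemma cons_chain_add: "cons_chain x (f + g) = cons_chain x f + cons_chain x g"
  by (simp add: cons_chain_def lin_ext_add)

lemma cons_chain_sum: "cons_chain x (sum f S) = (\<Sum>i\<in>S. cons_chain x (f i))"
  by (simp add: cons_chain_def lin_ext_sum)

lemma cons_chain_zero [simp]: "cons_chain x 0 = 0"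
  by (simp add: cons_chain_def)

lemma cons_chain_fscale: "cons_chain x (fscale c f) = fscale c (cons_chain x f)"
  by (simp add: cons_chain_def lin_ext_fscale)

lemma cons_chain_lin_ext: "cons_chain x (lin_ext g f) = lin_ext (\<lambda>y. cons_chain x (g y)) f"
  by (simp add: cons_chain_def lin_ext_comp)

lemma snoc_chain_diff: "snoc_chain x (f - g) = snoc_chain x f - snoc_chain x g"
  by (simp add: snoc_chain_def lin_ext_diff)

lemma snoc_chain_lin_ext: "snoc_chain x (lin_ext g f) = lin_ext (\<lambda>y. snoc_chain x (g y)) f"
  by (simp add: snoc_chain_def lin_ext_comp)

lemma cons_chain_snc: "cons_chain x (snoc_chain y f) = snoc_chain y (cons_chain x f)"
  by (simp add: cons_chain_def snoc_chain_def lin_ext_comp lin_ext_single)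

lemma lin_ext_cns: "lin_ext g (cons_chain x f) = lin_ext (\<lambda>l. g (x # l)) f"
  by (simp add: cons_chain_def lin_ext_comp lin_ext_single)

lemma lin_ext_snc: "lin_ext g (snoc_chain x f) = lin_ext (\<lambda>l. g (l @ [x])) f"
  by (simp add: snoc_chain_def lin_ext_comp lin_ext_single)

lemma fscale_add_right: "fscale c (f + g) = fscale c f + fscale c g"
  and fscale_diff_right: "fscale c (f - g) = fscale c f - fscale c g"
  and fscale_fscale: "fscale c (fscale d f) = fscale (c * d) f"
  by (simp_all add: free_vs.scale_right_distrib free_vs.scale_right_diff_distrib)

text \<open>The monoid algebra has the basis \<open>x\<^sup>\<alpha>\<close> with \<open>x\<^sup>\<alpha> x\<^sup>\<beta> = c \<alpha> \<beta> x\<^bsup>\<alpha>+\<beta>\<^esup>\<close>, and the automorphism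
  scales \<open>x\<^sup>\<alpha>\<close> by \<open>\<chi> \<alpha>\<close>. A list of exponents stands for the tensor of the basis vectors.\<close>

locale twisted_monoid =
  fixes c :: "'a::monoid_add \<Rightarrow> 'a \<Rightarrow> complex" and \<chi> :: "'a \<Rightarrow> complex"
  assumes cocycle: "c x y * c (x + y) z = c y z * c x (y + z)"
    and c_zero_left [simp]: "c 0 x = 1" and c_zero_right [simp]: "c x 0 = 1"
    and chi_zero [simp]: "\<chi> 0 = 1" and chi_add: "\<chi> (x + y) = \<chi> x * \<chi> y"
begin

text \<open>All faces except the cyclic one. Recursion on the list instead of an alternating sum
  makes the square of the differential accessible to induction.\<close>

fun bar :: "'a list \<Rightarrow> ('a list \<Rightarrow>\<^sub>0 complex)" where
  "bar (x # y # l) = single ((x + y) # l) (c x y) - cons_chain x (bar (y # l))"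
| "bar _ = 0"

text \<open>The cyclic face: the last entry, twisted by \<chi>, multiplies slot 0 from the left. It
  is 0 in degree 0, where the Hochschild boundary vanishes.\<close>

definition wrap :: "'a list \<Rightarrow> ('a list \<Rightarrow>\<^sub>0 complex)" where
  "wrap l = (if length l < 2 then 0 else
     single ((last l + hd l) # tl (butlast l))
       ((-1) ^ (length l - 1) * \<chi> (last l) * c (last l) (hd l)))"

definition bdry :: "'a list \<Rightarrow> ('a list \<Rightarrow>\<^sub>0 complex)" where
  "bdry l = bar l + wrap l"

text \<open>Left multiplication in slot 0. Up to sign and twist the cyclic face is this action
  (\<open>wrap_snoc\<close>), which reduces its interplay with \<open>bar\<close> to
  associativity.\<close>

definition left_act :: "'a \<Rightarrow> ('a list \<Rightarrow>\<^sub>0 complex) \<Rightarrow> ('a list \<Rightarrow>\<^sub>0 complex)" where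
  "left_act u = lin_ext (\<lambda>l. if l = [] then 0 else single ((u + hd l) # tl l) (c u (hd l)))"

lemma left_act_cns: "left_act u (cons_chain x f) = fscale (c u x) (cons_chain (u + x) f)"
  unfolding left_act_def lin_ext_cns
  by (simp add: cons_chain_def lin_ext_fscale_fun[symmetric])

lemma left_act_single: "left_act u (single (x # l) a) = single ((u + x) # l) (a * c u x)"
  by (simp add: left_act_def lin_ext_single)

lemma left_act_diff: "left_act u (f - g) = left_act u f - left_act u g"
  by (simp add: left_act_def lin_ext_diff)

lemma bar_cns_cns:
  "lin_ext bar (cons_chain x (cons_chain y f)) = fscale (c x y) (cons_chain (x + y) f) - cons_chain x (lin_ext bar (cons_chain y f))"
  by (simp add: lin_ext_cns lin_ext_diff_fun cons_chain_lin_ext lin_ext_fscale_fun[symmetric])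
     (simp add: cons_chain_def lin_ext_fscale_fun[symmetric])

text \<open>Only the three leading entries produce new terms. The two ways of merging all three
  agree by associativity, which is \<open>cocycle\<close>, and the rest cancels by the induction
  hypothesis.\<close>

lemma bar_bar: "lin_ext bar (bar l) = 0"
proof (induction l rule: bar.induct)
  case (1 x y l)
  show ?case
  proof (cases l)
    case Nil
    then show ?thesis by (simp add: lin_ext_single)
  next
    case (Cons z l')
    let ?yz = "single ((y + z) # l') (c y z)"
    have "cons_chain x (lin_ext bar (bar (y # l))) = 0" using 1 by simp
    then have IH: "cons_chain x (lin_ext bar ?yz) = cons_chain x (lin_ext bar (cons_chain y (bar l)))"
      by (simp add: Cons lin_ext_diff cons_chain_diff)
    have "lin_ext bar (bar (x # y # l)) =
        fscale (c x y) (bar ((x + y) # z # l')) - lin_ext bar (cons_chain x ?yz) + lin_ext bar (cons_chain x (cons_chain y (bar l)))"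
      by (simp add: Cons lin_ext_diff cons_chain_diff lin_ext_single)
    also have "fscale (c x y) (bar ((x + y) # z # l')) =
        single ((x + y + z) # l') (c x y * c (x + y) z) - fscale (c x y) (cons_chain (x + y) (bar l))"
      by (simp add: Cons fscale_diff_right)
    also have "lin_ext bar (cons_chain x ?yz) =
        single ((x + (y + z)) # l') (c x y * c (x + y) z) - cons_chain x (lin_ext bar ?yz)"
      unfolding cocycle
      by (simp add: lin_ext_single fscale_diff_right cons_chain_fscale del: bar.simps) (simp add: fscale_diff_right)
    also note bar_cns_cns
    finally show ?thesis by (simp add: IH add.assoc)
  qed
qed simp_all

lemma bar_lact: "l \<noteq> [] \<Longrightarrow> lin_ext bar (left_act u (single (x # l) a)) = left_act u (fscale a (bar (x # l)))"
  by (cases l)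
     (auto simp: left_act_single lin_ext_single left_act_diff fscale_diff_right cocycle[symmetric] left_act_cns
       fscale_fscale cons_chain_fscale[symmetric] add.assoc mult.assoc mult.left_commute mult.commute)

text \<open>The recursion seen from the last entry, where the cyclic face acts.\<close>

lemma bar_snoc: "bar (m @ [x, y]) = snoc_chain y (bar (m @ [x])) + single (m @ [x + y]) ((-1) ^ length m * c x y)"
proof (induction m rule: bar.induct)
  case (1 u v l)
  then show ?case by (simp add: snoc_chain_diff cons_chain_add cons_chain_diff cons_chain_snc single_uminus)
next
  case ("2_2" v)
  then show ?case by (simp add: snoc_chain_diff cons_chain_add cons_chain_snc single_uminus)
qed (auto simp: snoc_chain_def)

lemma keys_bar: "keys (bar l) \<subseteq> {l'. Suc (length l') = length l}"
proof (induction l rule: bar.induct)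
  case (1 x y l)
  have "keys (cons_chain x (bar (y # l))) \<subseteq> {l'. length l' = Suc (length l)}"
    unfolding cons_chain_def by (rule order_trans[OF keys_lin_ext]) (use 1 in auto)
  then show ?case using keys_diff by (fastforce split: if_splits)
qed auto

lemma wrap_snoc: "l \<noteq> [] \<Longrightarrow> wrap (l @ [y]) = fscale ((-1) ^ length l * \<chi> y) (left_act y (single l 1))"
  by (cases l) (auto simp: wrap_def left_act_single)

lemma wrap_snc:
  assumes "f \<in> supported {l. length l = n}" "n > 0"
  shows "lin_ext wrap (snoc_chain y f) = fscale ((-1) ^ n * \<chi> y) (left_act y f)"
proof -
  have "lin_ext wrap (snoc_chain y f) = lin_ext (\<lambda>l. fscale ((-1) ^ n * \<chi> y) (left_act y (single l 1))) f"
    unfolding lin_ext_snc using assms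
    by (intro lin_ext_cong_supported[OF assms(1)]) (auto simp: wrap_snoc)
  also have "\<dots> = fscale ((-1) ^ n * \<chi> y) (left_act y (lin_ext (\<lambda>l. single l 1) f))"
    unfolding left_act_def lin_ext_fscale_fun lin_ext_comp ..
  finally show ?thesis by (simp add: lin_ext_singles)
qed

text \<open>There are four compositions. \<open>bar\<close> after \<open>bar\<close> vanishes;
  \<open>bar\<close> after \<open>wrap\<close> cancels the part of \<open>wrap\<close> after
  \<open>bar\<close> in which the last entry stays unmerged; the remaining term, with the last two
  entries merged, cancels \<open>wrap\<close> after \<open>wrap\<close> because \<chi> is
  multiplicative.\<close>

lemma bdry_bdry: "lin_ext bdry (bdry l) = 0"
proof -
  have eq: "lin_ext bdry f = lin_ext bar f + lin_ext wrap f" for f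
    unfolding bdry_def by (rule lin_ext_add_fun)
  consider "length l < 2" | x y where "l = [x, y]" | x m w y where "l = x # m @ [w, y]"
  proof (cases "length l < 3")
    case True
    then show ?thesis using that(1,2) by (auto simp: less_Suc_eq numeral_eq_Suc length_Suc_conv)
  next
    case False
    then obtain x l' where l': "l = x # l'" "length l' \<ge> 2" by (cases l) auto
    then obtain l'' y where l'': "l' = l'' @ [y]" "length l'' \<ge> 1" by (cases l' rule: rev_cases) auto
    then obtain m w where "l'' = m @ [w]" by (cases l'' rule: rev_cases) auto
    then show ?thesis using l' l'' that(3) by auto
  qed
  then show ?thesis
  proof cases
    case 1
    then have "bar l = 0" "wrap l = 0" by (auto simp: wrap_def less_Suc_eq numeral_eq_Suc length_Suc_conv)
    then show ?thesis by (simp add: bdry_def)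
  next
    case 2
    then show ?thesis
      by (simp add: eq bdry_def wrap_def lin_ext_add lin_ext_single)
  next
    case (3 x m w y)
    let ?n = "Suc (length m)"
    have sq: "(-1) ^ k * a * ((-1) ^ k * b * d) = a * (b * d)" for k and a b d :: complex
      by (cases "even k") auto
    have bb: "lin_ext bar (bar l) = 0" by (rule bar_bar)
    have wr: "wrap l = fscale ((-1) ^ Suc ?n * \<chi> y) (left_act y (single (x # m @ [w]) 1))"
      using wrap_snoc[of "x # m @ [w]" y] by (simp add: 3)
    have bw: "lin_ext bar (wrap l) = fscale ((-1) ^ Suc ?n * \<chi> y) (left_act y (bar (x # m @ [w])))"
      unfolding wr lin_ext_fscale by (subst bar_lact) auto
    have "bar l = snoc_chain y (bar (x # m @ [w])) + single (x # m @ [w + y]) ((-1) ^ ?n * c w y)"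
      using bar_snoc[of "x # m" w y] by (simp add: 3)
    moreover have "lin_ext wrap (snoc_chain y (bar (x # m @ [w]))) = fscale ((-1) ^ ?n * \<chi> y) (left_act y (bar (x # m @ [w])))"
      using keys_bar[of "x # m @ [w]"] by (intro wrap_snc) (auto simp: supported_def)
    moreover have "wrap (x # m @ [w + y]) = single ((w + y + x) # m) ((-1) ^ ?n * \<chi> (w + y) * c (w + y) x)"
      by (simp add: wrap_def)
    ultimately have wb: "lin_ext wrap (bar l) = fscale ((-1) ^ ?n * \<chi> y) (left_act y (bar (x # m @ [w])))
        + single ((w + y + x) # m) (c w y * (\<chi> (w + y) * c (w + y) x))"
      by (simp add: lin_ext_add lin_ext_single) (simp only: sq)
    have ww: "lin_ext wrap (wrap l) = single ((w + y + x) # m) (- (c w y * (\<chi> (w + y) * c (w + y) x)))"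
      unfolding wr left_act_single lin_ext_fscale lin_ext_single
      by (simp add: wrap_def add.assoc chi_add cocycle[of w y x, symmetric] mult_ac flip: power_mult_distrib)
    show ?thesis
      unfolding eq bdry_def[of l] lin_ext_add bb bw wb ww
      by (simp add: single_uminus free_vs.scale_minus_left add.assoc)
  qed
qed

end

section \<open>Multiindices\<close>

lemma zero_fun_eq: "(0 :: nat \<Rightarrow> nat) = (\<lambda>_. 0)"
  by (simp add: fun_eq_iff)

lemma add_fun_eq_0_iff: "\<alpha> + \<beta> = 0 \<longleftrightarrow> \<alpha> = 0 \<and> \<beta> = (0 :: nat \<Rightarrow> nat)"
  by (auto simp: fun_eq_iff)

lemma unit_index_apply: "unit_index j i = (if i = j then 1 else 0)"
  by (simp add: unit_index_def)

lemma unit_index_neq_0 [simp]: "unit_index j \<noteq> 0"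
  by (auto simp: fun_eq_iff unit_index_apply)

lemma unit_index_inject [simp]: "unit_index i = unit_index j \<longleftrightarrow> i = j"
  by (metis unit_index_apply zero_neq_one)

lemma zero_in_multiindices [simp]: "0 \<in> multiindices N"
  and add_in_multiindices: "\<alpha> \<in> multiindices N \<Longrightarrow> \<beta> \<in> multiindices N \<Longrightarrow> \<alpha> + \<beta> \<in> multiindices N"
  and diff_in_multiindices: "\<alpha> \<in> multiindices N \<Longrightarrow> \<alpha> - \<beta> \<in> multiindices N"
  and unit_in_multiindices: "i \<in> {1..N} \<Longrightarrow> unit_index i \<in> multiindices N"
  by (auto simp: multiindices_def unit_index_apply)

definition nword :: "nat \<Rightarrow> (nat \<Rightarrow> nat) \<Rightarrow> nat list" where
  "nword N \<alpha> = concat (map (\<lambda>i. replicate (\<alpha> i) i) [1..<N + 1])"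

lemma set_nword: "set (nword N \<alpha>) = {i \<in> {1..N}. \<alpha> i > 0}"
  by (auto simp: nword_def)

lemma count_list_replicate: "count_list (replicate n x) y = (if x = y then n else 0)"
  by (induction n) auto

lemma count_list_concat_replicate:
  "distinct xs \<Longrightarrow> count_list (concat (map (\<lambda>i. replicate (\<alpha> i) i) xs)) j = (if j \<in> set xs then \<alpha> j else 0)"
  by (induction xs) (auto simp: count_list_replicate)

lemma count_nword: "count_list (nword N \<alpha>) j = (if j \<in> {1..N} then \<alpha> j else 0)"
  unfolding nword_def by (subst count_list_concat_replicate) auto

lemma sorted_concat_replicate:
  "sorted xs \<Longrightarrow> sorted (concat (map (\<lambda>i. replicate (\<alpha> i) i) xs))" for xs :: "nat list"
  by (induction xs) (auto simp: sorted_append)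

lemma sorted_nword: "sorted (nword N \<alpha>)"
  unfolding nword_def by (rule sorted_concat_replicate) (simp del: upt_Suc)

lemma nword_eqI:
  assumes "sorted w" "set w \<subseteq> {1..N}" "\<And>j. j \<in> {1..N} \<Longrightarrow> count_list w j = \<alpha> j"
  shows "nword N \<alpha> = w"
proof -
  have "count_list w j = 0" if "j \<notin> {1..N}" for j
    using assms(2) that by (subst count_list_0_iff) auto
  then have "mset (nword N \<alpha>) = mset w"
    by (intro multiset_eqI) (simp add: count_mset count_nword assms(3))
  then show ?thesis by (metis properties_for_sort sorted_nword assms(1))
qed

lemma length_nword: "length (nword N \<alpha>) = (\<Sum>i=1..N. \<alpha> i)"
  by (simp add: nword_def length_concat o_def interv_sum_list_conv_sum_set_nat atLeastLessThanSuc_atLeastAtMost del: upt_Suc)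

lemma length_nword_add: "length (nword N (\<alpha> + \<beta>)) = length (nword N \<alpha>) + length (nword N \<beta>)"
  by (simp add: length_nword sum.distrib)

lemma nword_eq_Nil: "\<alpha> \<in> multiindices N \<Longrightarrow> nword N \<alpha> = [] \<longleftrightarrow> \<alpha> = 0"
proof
  assume "\<alpha> \<in> multiindices N" "nword N \<alpha> = []"
  then have "\<alpha> i = 0" for i
    using set_nword[of N \<alpha>] by (cases "i \<in> {1..N}") (auto simp: multiindices_def)
  then show "\<alpha> = 0" by auto
qed (simp add: nword_def)

text \<open>The smallest index in the support, that is, the first letter of the sorted monomial. For
  exponent 0 it is the head of an empty list, so the facts below concern nonzero exponents.\<close>

definition lead :: "nat \<Rightarrow> (nat \<Rightarrow> nat) \<Rightarrow> nat" where
  "lead N \<alpha> = hd (nword N \<alpha>)"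

lemma lead_props:
  assumes "\<alpha> \<in> multiindices N" "\<alpha> \<noteq> 0"
  shows lead_range: "lead N \<alpha> \<in> {1..N}" and lead_pos: "\<alpha> (lead N \<alpha>) > 0"
    and lead_least: "\<alpha> i > 0 \<Longrightarrow> lead N \<alpha> \<le> i"
    and nword_lead: "nword N \<alpha> = lead N \<alpha> # nword N (\<alpha> - unit_index (lead N \<alpha>))"
proof -
  obtain w where w: "nword N \<alpha> = lead N \<alpha> # w"
    using nword_eq_Nil[OF assms(1)] assms(2) unfolding lead_def by (cases "nword N \<alpha>") auto
  then have s: "lead N \<alpha> \<in> set (nword N \<alpha>)" by simp
  then show *: "lead N \<alpha> \<in> {1..N}" "\<alpha> (lead N \<alpha>) > 0" by (auto simp: set_nword)
  show "lead N \<alpha> \<le> i" if "\<alpha> i > 0" for i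
  proof -
    have "i \<in> {1..N}" using that assms(1) by (auto simp: multiindices_def)
    then have "i \<in> set (nword N \<alpha>)" using that by (auto simp: set_nword)
    then show ?thesis using sorted_nword[of N \<alpha>] unfolding w by auto
  qed
  have "nword N (\<alpha> - unit_index (lead N \<alpha>)) = w"
  proof (rule nword_eqI)
    show "sorted w" using sorted_nword[of N \<alpha>] by (simp add: w)
    show "set w \<subseteq> {1..N}" using set_nword[of N \<alpha>] by (auto simp: w)
    show "count_list w j = (\<alpha> - unit_index (lead N \<alpha>)) j" if "j \<in> {1..N}" for j
      using count_nword[of N \<alpha> j] that unfolding w by (auto simp: unit_index_apply)
  qed
  then show "nword N \<alpha> = lead N \<alpha> # nword N (\<alpha> - unit_index (lead N \<alpha>))" using w by simp
qed

lemma lead_eqI: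
  assumes "\<alpha> \<in> multiindices N" "\<alpha> j > 0" "\<And>i. \<alpha> i > 0 \<Longrightarrow> j \<le> i"
  shows "lead N \<alpha> = j"
proof -
  have "\<alpha> \<noteq> 0" using assms(2) by auto
  then show ?thesis using lead_pos lead_least assms by (metis le_antisym)
qed

lemma lead_unit [simp]: "i \<in> {1..N} \<Longrightarrow> lead N (unit_index i) = i"
  by (intro lead_eqI unit_in_multiindices) (auto simp: unit_index_apply split: if_splits)

lemma diff_unit_add: "\<alpha> i > 0 \<Longrightarrow> unit_index i + (\<alpha> - unit_index i) = \<alpha>"
  by (auto simp: fun_eq_iff unit_index_apply)

lemma add_diff_unit: "unit_index i + \<alpha> - unit_index i = \<alpha>"
  by (auto simp: fun_eq_iff)

lemma lead_add:
  assumes "\<alpha> \<in> multiindices N" "\<alpha> \<noteq> 0" "\<beta> \<in> multiindices N" "\<beta> \<noteq> 0"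
  shows "lead N (\<alpha> + \<beta>) = min (lead N \<alpha>) (lead N \<beta>)"
proof (rule lead_eqI)
  show "\<alpha> + \<beta> \<in> multiindices N" using assms by (intro add_in_multiindices)
  show "(\<alpha> + \<beta>) (min (lead N \<alpha>) (lead N \<beta>)) > 0"
    using lead_pos[OF assms(1,2)] lead_pos[OF assms(3,4)] by (auto simp: min_def)
  show "min (lead N \<alpha>) (lead N \<beta>) \<le> i" if "(\<alpha> + \<beta>) i > 0" for i
    using that lead_least[OF assms(1,2), of i] lead_least[OF assms(3,4), of i] by auto
qed

section \<open>Faces of a list\<close>

definition merge_at :: "nat \<Rightarrow> 'a::plus list \<Rightarrow> 'a list" where
  "merge_at i l = take i l @ (l ! i + l ! Suc i) # drop (i + 2) l"

lemma merge_at_0 [simp]: "merge_at 0 (x # y # l) = (x + y) # l"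
  and fc_Suc [simp]: "merge_at (Suc i) (x # l) = x # merge_at i l"
  by (simp_all add: merge_at_def)

lemma merge_at_append1: "Suc i < length us \<Longrightarrow> merge_at i (us @ vs) = merge_at i us @ vs"
  by (simp add: merge_at_def nth_append)

lemma merge_at_append2: "length us \<le> i \<Longrightarrow> merge_at i (us @ vs) = us @ merge_at (i - length us) vs"
  by (simp add: merge_at_def nth_append Suc_diff_le)

lemma length_merge_at: "Suc i < length l \<Longrightarrow> length (merge_at i l) = length l - 1"
  by (simp add: merge_at_def min_def)

lemma set_merge_at: "Suc i < length l \<Longrightarrow> set (merge_at i l) \<subseteq> set l \<union> {x + y | x y. x \<in> set l \<and> y \<in> set l}"
  using set_take_subset set_drop_subset by (fastforce simp: merge_at_def)

context twisted_monoid
begin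

text \<open>The matchings compare individual faces, so the recursion is unfolded into an indexed
  sum.\<close>

lemma bar_sum:
  "bar l = (\<Sum>i<length l - 1. single (merge_at i l) ((-1) ^ i * c (l ! i) (l ! Suc i)))"
proof (induction l rule: bar.induct)
  case (1 x y l)
  have "cons_chain x (bar (y # l)) = (\<Sum>i<length l. single (x # merge_at i (y # l)) ((-1) ^ i * c ((y # l) ! i) (l ! i)))"
    using 1 by (simp add: cons_chain_sum)
  then show ?case
    by (simp add: sum.lessThan_Suc_shift sum_negf single_uminus del: sum.lessThan_Suc)
qed auto

end


text \<open>The factor c in x^\<alpha> x^\<beta> = c x^(\<alpha>+\<beta>): each letter i of the left
  monomial passes every smaller letter j of the right one, and x_i x_j = q_ij x_j x_i.\<close>

definition reorder_coeff :: "nat \<Rightarrow> (nat \<Rightarrow> nat \<Rightarrow> complex) \<Rightarrow> (nat \<Rightarrow> nat) \<Rightarrow> (nat \<Rightarrow> nat) \<Rightarrow> complex" where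
  "reorder_coeff N q \<alpha> \<beta> = (\<Prod>i=1..N. \<Prod>j\<in>{1..<i}. q i j ^ (\<alpha> i * \<beta> j))"

definition weight :: "nat \<Rightarrow> (nat \<Rightarrow> complex) \<Rightarrow> (nat \<Rightarrow> nat) \<Rightarrow> complex" where
  "weight N p \<alpha> = (\<Prod>i=1..N. p i ^ \<alpha> i)"

text \<open>Being a bicharacter is the source of associativity: both sides of the cocycle identity
  expand to the same product of three values.\<close>

lemma reorder_coeff_add_left: "reorder_coeff N q (\<alpha> + \<beta>) \<gamma> = reorder_coeff N q \<alpha> \<gamma> * reorder_coeff N q \<beta> \<gamma>"
  and reorder_coeff_add_right: "reorder_coeff N q \<alpha> (\<beta> + \<gamma>) = reorder_coeff N q \<alpha> \<beta> * reorder_coeff N q \<alpha> \<gamma>"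
  by (simp_all add: reorder_coeff_def prod.distrib[symmetric] power_add[symmetric] algebra_simps)

lemma reorder_coeff_unit_left: "i \<in> {1..N} \<Longrightarrow> reorder_coeff N q (unit_index i) \<beta> = (\<Prod>j\<in>{1..<i}. q i j ^ \<beta> j)"
  unfolding reorder_coeff_def by (subst prod.remove[of _ i]) (auto simp: unit_index_apply intro!: prod.neutral)

locale hyperplane_complex =
  fixes N :: nat and q :: "nat \<Rightarrow> nat \<Rightarrow> complex" and p :: "nat \<Rightarrow> complex"

sublocale hyperplane_complex \<subseteq> twisted_monoid "reorder_coeff N q" "weight N p"
  by unfold_locales
     (simp_all add: reorder_coeff_add_left reorder_coeff_add_right, simp_all add: reorder_coeff_def weight_def power_add prod.distrib)

context hyperplane_complex
begin

abbreviation "M \<equiv> multiindices N"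
abbreviation "ld \<equiv> lead N"

definition wcat :: "(nat \<Rightarrow> nat) list \<Rightarrow> nat list" where
  "wcat l = concat (map (nword N) l)"

lemma wcat_simps [simp]:
  "wcat [] = []" "wcat (x # l) = nword N x @ wcat l" "wcat (l @ l') = wcat l @ wcat l'"
  by (simp_all add: wcat_def)

text \<open>Meant for tails: slot 0 of a cell may well be the exponent 0.\<close>

definition nondeg :: "(nat \<Rightarrow> nat) list \<Rightarrow> bool" where
  "nondeg l \<longleftrightarrow> set l \<subseteq> M \<and> 0 \<notin> set l"

lemma nondeg_simps [simp]:
  "nondeg []" "nondeg (x # l) \<longleftrightarrow> x \<in> M \<and> x \<noteq> 0 \<and> nondeg l"
  "nondeg (l @ l') \<longleftrightarrow> nondeg l \<and> nondeg l'"
  by (auto simp: nondeg_def)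

lemma nondeg_merge_at: "nondeg l \<Longrightarrow> Suc i < length l \<Longrightarrow> nondeg (merge_at i l)"
  using set_merge_at[of i l] unfolding nondeg_def
  by (fastforce simp: add_in_multiindices add_fun_eq_0_iff subset_iff)

section \<open>The matching on nondegenerate cells\<close>

text \<open>\<open>src B l\<close> says that in the list \<open>l\<close> a maximal run of generators with decreasing indices below
  \<open>B\<close> is followed by a monomial that is not a generator and whose first letter would continue
  the run; \<open>split\<close> splits off that letter.\<close>

fun src :: "nat \<Rightarrow> (nat \<Rightarrow> nat) list \<Rightarrow> bool" where
  "src B [] = False"
| "src B (m # l) = (ld m < B \<and> (m = unit_index (ld m) \<longrightarrow> src (ld m) l))"

fun split :: "(nat \<Rightarrow> nat) list \<Rightarrow> (nat \<Rightarrow> nat) list" where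
  "split [] = []"
| "split (m # l) = (if m = unit_index (ld m) then m # split l
     else unit_index (ld m) # (m - unit_index (ld m)) # l)"

text \<open>Strictly decreasing runs of generators, which is what \<open>nondeg_cover\<close> leaves
  over besides sources and splits.\<close>

fun critical :: "nat \<Rightarrow> (nat \<Rightarrow> nat) list \<Rightarrow> bool" where
  "critical B [] = True"
| "critical B (m # l) = (ld m < B \<and> m = unit_index (ld m) \<and> critical (ld m) l)"

lemma rest_neq_0: "m \<in> M \<Longrightarrow> m \<noteq> 0 \<Longrightarrow> m \<noteq> unit_index (ld m) \<Longrightarrow> m - unit_index (ld m) \<noteq> 0"
  using diff_unit_add[of m "ld m"] lead_pos[of m N] by (metis add.right_neutral)

lemma split_src:
  assumes "src B l" "nondeg l"
  shows nondeg_split: "nondeg (split l)" and length_split: "length (split l) = Suc (length l)"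
    and hd_split: "hd (split l) = unit_index (ld (hd l))" and ld_hd: "ld (hd l) < B" "ld (hd l) \<in> {1..N}"
    and length_wcat_split: "length (wcat (split l)) = length (wcat l)"
proof -
  have *: "nondeg (split l) \<and> length (split l) = Suc (length l) \<and> hd (split l) = unit_index (ld (hd l)) \<and>
     ld (hd l) < B \<and> ld (hd l) \<in> {1..N} \<and> length (wcat (split l)) = length (wcat l)"
    using assms
  proof (induction B l rule: src.induct)
    case (2 B m l)
    have m: "m \<in> M" "m \<noteq> 0" using 2 by auto
    show ?case
    proof (cases "m = unit_index (ld m)")
      case True
      then show ?thesis using 2 lead_range[OF m] by auto
    next
      case False
      have "length (nword N m) = length (nword N (unit_index (ld m))) + length (nword N (m - unit_index (ld m)))"
        by (metis diff_unit_add length_nword_add lead_pos m)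
      then show ?thesis
        using 2 False lead_range[OF m] rest_neq_0[OF m]
        by (auto simp: unit_in_multiindices diff_in_multiindices)
    qed
  qed simp
  then show "nondeg (split l)" "length (split l) = Suc (length l)" "hd (split l) = unit_index (ld (hd l))"
    "ld (hd l) < B" "ld (hd l) \<in> {1..N}" "length (wcat (split l)) = length (wcat l)" by auto
qed

text \<open>Length comes first because faces involving slot 0 take letters away from the tail, and
  because the lexicographic order alone is not well-founded on words.\<close>

abbreviation less_cell :: "(nat \<Rightarrow> nat) list \<Rightarrow> (nat \<Rightarrow> nat) list \<Rightarrow> bool" where
  "less_cell l l' \<equiv> (wcat l, wcat l') \<in> lenlex less_than"

lemma length_wcat_merge_at: "Suc i < length l \<Longrightarrow> length (wcat (merge_at i l)) = length (wcat l)"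
proof (induction i arbitrary: l)
  case 0
  then obtain x y l' where "l = x # y # l'" by (cases l; cases "tl l") auto
  then show ?case by (simp add: length_nword_add)
next
  case (Suc i)
  then show ?case by (cases l) auto
qed

lemma less_cell_ConsI: "less_cell l l' \<Longrightarrow> less_cell (x # l) (x # l')"
proof -
  have "(w @ a, w @ b) \<in> lenlex less_than" if "(a, b) \<in> lenlex less_than" for w a b :: "nat list"
    using that by (induction w) (auto simp: Cons_lenlex_iff)
  then show "less_cell l l' \<Longrightarrow> less_cell (x # l) (x # l')" by simp
qed

lemma less_cell_leadI:
  assumes "length (wcat (x # l)) = length (wcat (y # l'))" "x \<in> M" "x \<noteq> 0" "y \<in> M" "y \<noteq> 0" "ld x < ld y"
  shows "less_cell (x # l) (y # l')"
  using assms nword_lead[OF assms(2,3)] nword_lead[OF assms(4,5)] by (simp add: Cons_lenlex_iff)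

text \<open>One face undoes the split. Any other inner face that is again a source has a smaller
  word: merging inside the run moves a smaller letter forward, and merging behind the split-off
  letter gives a source only if it brings a letter below that one to the next place.\<close>

lemma split_face:
  assumes "src B l" "nondeg l"
  shows "\<exists>k. Suc k < length (split l) \<and> merge_at k (split l) = l \<and> reorder_coeff N q (split l ! k) (split l ! Suc k) = 1 \<and>
    (\<forall>i. Suc i < length (split l) \<and> i \<noteq> k \<and> src B (merge_at i (split l)) \<longrightarrow> less_cell (merge_at i (split l)) l)"
  using assms
proof (induction B l rule: src.induct)
  case (2 B m l)
  have m: "m \<in> M" "m \<noteq> 0" and l: "nondeg l" using 2 by auto
  let ?j = "ld m"
  have j: "?j \<in> {1..N}" by (rule lead_range[OF m])
  show ?case
  proof (cases "m = unit_index ?j")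
    case True
    have s: "src ?j l" using 2 True by auto
    obtain k where k: "Suc k < length (split l)" "merge_at k (split l) = l"
       "reorder_coeff N q (split l ! k) (split l ! Suc k) = 1"
       "\<And>i. Suc i < length (split l) \<Longrightarrow> i \<noteq> k \<Longrightarrow> src ?j (merge_at i (split l)) \<Longrightarrow> less_cell (merge_at i (split l)) l"
      using 2 True s l by blast
    have spl: "split (m # l) = m # split l" using True by simp
    have "less_cell (merge_at i (m # split l)) (m # l)"
      if i: "Suc i < length (m # split l)" "i \<noteq> Suc k" "src B (merge_at i (m # split l))" for i
    proof (cases i)
      \<comment> \<open>The leads decrease along the run, so the product of its first two entries
        starts with the smaller letter of the second.\<close>
      case 0
      obtain y ys where y: "split l = y # ys" using k(1) by (cases "split l") auto
      have y': "y = unit_index (ld (hd l))" using hd_split[OF s l] by (simp add: y)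
      have yM: "y \<in> M" "y \<noteq> 0" using nondeg_split[OF s l] by (auto simp: y)
      have ldy: "ld y < ?j" using ld_hd[OF s l] by (simp add: y' del: One_nat_def)
      have "ld (m + y) < ?j" using ldy by (simp add: lead_add m yM)
      moreover have "length (wcat (merge_at 0 (m # y # ys))) = length (wcat (m # l))"
        using length_wcat_split[OF s l] by (simp add: y length_nword_add)
      ultimately show ?thesis
        unfolding 0 y using m yM
        by (auto intro!: less_cell_leadI simp: add_in_multiindices add_fun_eq_0_iff simp del: wcat_simps)
    next
      case (Suc i')
      then have "src ?j (merge_at i' (split l))" using i True by simp
      then show ?thesis using k(4)[of i'] i Suc by (auto intro: less_cell_ConsI simp del: wcat_simps)
    qed
    then show ?thesis unfolding spl using k(1-3)
      by (intro exI[of _ "Suc k"]) auto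
  next
    case False
    let ?r = "m - unit_index ?j"
    have r: "?r \<in> M" "?r \<noteq> 0" using rest_neq_0 False m by (auto simp: diff_in_multiindices)
    have spl: "split (m # l) = unit_index ?j # ?r # l" using False by simp
    have ldr: "?j \<le> ld ?r" using lead_pos[OF r] by (intro lead_least[OF m]) auto
    have u: "unit_index ?j \<in> M" "unit_index ?j \<noteq> 0" "ld (unit_index ?j) = ?j"
      using j by (simp_all add: unit_in_multiindices del: One_nat_def)
    have "less_cell (merge_at i (unit_index ?j # ?r # l)) (m # l)"
      if i: "Suc i < length (unit_index ?j # ?r # l)" "i \<noteq> 0" "src B (merge_at i (unit_index ?j # ?r # l))" for i
    proof -
      obtain i' where i': "i = Suc i'" using i by (cases i) auto
      have s: "src ?j (merge_at i' (?r # l))" using i(3) u by (simp add: i')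
      show ?thesis
      \<comment> \<open>Behind \<open>unit_index ?j\<close> a source needs an entry with lead below
        \<open>?j\<close>. The rest \<open>?r\<close> has no such letter, so the face must merge
        \<open>?r\<close> with an entry that supplies one.\<close>
      proof (cases i')
        case 0
        obtain z zs where l: "l = z # zs" using i i' 0 by (cases l) auto
        have z: "z \<in> M" "z \<noteq> 0" using 2 l by auto
        have "ld (?r + z) < ?j" using s by (simp add: 0 l)
        moreover have "length (wcat ((?r + z) # zs)) = length (wcat (?r # l))"
          by (simp add: l length_nword_add)
        ultimately have "less_cell ((?r + z) # zs) (?r # l)"
          using r z ldr by (intro less_cell_leadI) (auto simp: add_in_multiindices add_fun_eq_0_iff)
        then have "less_cell (unit_index ?j # (?r + z) # zs) (unit_index ?j # ?r # l)"
          by (rule less_cell_ConsI)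
        moreover have "wcat (unit_index ?j # ?r # l) = wcat (m # l)"
          using nword_lead[OF u(1,2)] nword_lead[OF m] by (simp add: u zero_fun_eq nword_def)
        ultimately have "less_cell (unit_index ?j # (?r + z) # zs) (m # l)" by (simp only:)
        then show ?thesis by (simp only: i' 0 l fc_Suc merge_at_0)
      next
        case (Suc i'')
        then show ?thesis using s ldr by auto
      qed
    qed
    moreover have "unit_index ?j + ?r = m" using lead_pos[OF m] by (rule diff_unit_add)
    \<comment> \<open>\<open>?j\<close> is the smallest letter of \<open>m\<close>, so in front of
      \<open>?r\<close> it is already in sorted position.\<close>
    moreover have "reorder_coeff N q (unit_index ?j) ?r = 1"
    proof -
      have "?r i = 0" if "i < ?j" for i
        using lead_least[OF m, of i] that by (cases "m i = 0") auto
      then show ?thesis using j by (auto simp: reorder_coeff_unit_left intro!: prod.neutral)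
    qed
    ultimately show ?thesis unfolding spl
      by (intro exI[of _ 0] conjI) (simp_all only: nth_Cons_0 nth_Cons_Suc merge_at_0, auto)
  qed
qed simp

text \<open>Follow the decreasing generators up to the first entry that does not continue the
  descent. Merging it into the generator before it gives the list that was split.\<close>

lemma nondeg_cover:
  assumes "nondeg l" "\<not> src B l" "\<not> critical B l" "\<And>m. m = hd l \<Longrightarrow> ld m < B"
  shows "\<exists>l'. src B l' \<and> nondeg l' \<and> split l' = l"
  using assms
proof (induction l arbitrary: B)
  case (Cons m l)
  have m: "m \<in> M" "m \<noteq> 0" and l: "nondeg l" using Cons by auto
  let ?j = "ld m"
  have mj: "m = unit_index ?j" and ns: "\<not> src ?j l" and lt: "?j < B" using Cons by auto
  have nc: "\<not> critical ?j l" using Cons.prems mj by auto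
  then have "l \<noteq> []" by auto
  then obtain y ys where ly: "l = y # ys" by (cases l) auto
  have y: "y \<in> M" "y \<noteq> 0" using l ly by auto
  show ?case
  proof (cases "ld y < ?j")
    case True
    then obtain l' where "src ?j l'" "nondeg l'" "split l' = l"
      using Cons.IH[of ?j] l ns nc ly by auto
    then show ?thesis using mj lt m by (intro exI[of _ "m # l'"]) auto
  next
    case False
    have ld: "ld (m + y) = ?j" using False by (simp add: lead_add m y)
    have "m + y \<noteq> unit_index ?j" using mj y by (metis add.right_neutral add_left_cancel)
    moreover have "m + y - unit_index ?j = y" using mj add_diff_unit by metis
    ultimately show ?thesis using lt m y l ly ld mj
      by (intro exI[of _ "(m + y) # ys"]) (auto simp: add_in_multiindices add_fun_eq_0_iff)
  qed
qed auto

text \<open>The two faces that involve slot 0 remove at least one letter from the tail, so they are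
  smaller by length; the inner faces are those of \<open>split_face\<close>.\<close>

lemma bdry_split:
  assumes "src B l" "nondeg l" "x \<in> M"
  shows "\<exists>\<epsilon> f. bdry (x # split l) = single (x # l) \<epsilon> + f \<and> \<epsilon> \<noteq> 0 \<and>
    (\<forall>z\<in>keys f. nondeg (tl z) \<and> (src B (tl z) \<longrightarrow> less_cell (tl z) l))"
proof -
  obtain k where k: "Suc k < length (split l)" "merge_at k (split l) = l"
       "reorder_coeff N q (split l ! k) (split l ! Suc k) = 1"
       "\<And>i. Suc i < length (split l) \<Longrightarrow> i \<noteq> k \<Longrightarrow> src B (merge_at i (split l)) \<Longrightarrow> less_cell (merge_at i (split l)) l"
    using split_face[OF assms(1,2)] by blast
  let ?s = "split l"
  let ?g = "\<lambda>i. single (merge_at i (x # ?s)) ((-1) ^ i * reorder_coeff N q ((x # ?s) ! i) ((x # ?s) ! Suc i))"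
  let ?P = "\<lambda>z. nondeg (tl z) \<and> (src B (tl z) \<longrightarrow> less_cell (tl z) l)"
  define f where "f = (\<Sum>i\<in>{..<length ?s} - {Suc k}. ?g i) + wrap (x # ?s)"
  have nd: "nondeg ?s" by (rule nondeg_split[OF assms(1,2)])
  have shorter: "less_cell l' l" if "length (wcat l') < length (wcat ?s)" for l'
    using that length_wcat_split[OF assms(1,2)] by (auto simp: lenlex_conv)
  have pos: "length (nword N y) > 0" if "y \<in> M" "y \<noteq> 0" for y
    using nword_eq_Nil[OF that(1)] that by auto
  obtain y ys where s: "?s = y # ys" using k(1) by (cases ?s) auto
  obtain zs z where s': "?s = zs @ [z]" using k(1) by (cases ?s rule: rev_cases) auto
  have y: "y \<in> M" "y \<noteq> 0" and z: "z \<in> M" "z \<noteq> 0" using nd by (simp add: s, simp add: s, (simp add: s')+)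
  have "bdry (x # ?s) = (\<Sum>i<length ?s. ?g i) + wrap (x # ?s)"
    by (simp add: bdry_def bar_sum)
  also have "(\<Sum>i<length ?s. ?g i) = ?g (Suc k) + (\<Sum>i\<in>{..<length ?s} - {Suc k}. ?g i)"
    using k(1) by (intro sum.remove) auto
  finally have "bdry (x # ?s) = single (x # l) ((-1) ^ Suc k) + f"
    using k by (simp add: f_def add.assoc)
  moreover have "?g i \<in> supported (Collect ?P)" if i: "i \<in> {..<length ?s} - {Suc k}" for i
  proof (cases i)
    case 0
    then show ?thesis using nd pos[OF y]
      by (auto intro!: supported_single shorter simp: s)
  next
    case (Suc i')
    then show ?thesis using i k(4)[of i'] nondeg_merge_at[OF nd, of i']
      by (auto intro!: supported_single)
  qed
  then have "(\<Sum>i\<in>{..<length ?s} - {Suc k}. ?g i) \<in> supported (Collect ?P)"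
    by (rule supported_sum)
  moreover have "wrap (x # ?s) \<in> supported (Collect ?P)"
  proof -
    have "wrap (x # ?s) \<in> supported {(z + x) # zs}"
      by (auto simp: wrap_def s' intro!: supported_single)
    moreover have "?P ((z + x) # zs)" using nd pos[OF z] by (auto intro!: shorter simp: s')
    ultimately show ?thesis by (auto simp: supported_def)
  qed
  ultimately have "bdry (x # ?s) = single (x # l) ((-1) ^ Suc k) + f" "f \<in> supported (Collect ?P)"
    by (auto simp: f_def intro: supported_add)
  then show ?thesis
    by (intro exI[of _ "(-1) ^ Suc k"] exI[of _ f]) (auto simp: supported_def)
qed

end

section \<open>The matching on degenerate cells\<close>

context hyperplane_complex
begin

text \<open>A run of \<open>r\<close> zeros contributes \<open>r + 1\<close> equal faces with alternating signs, so that
  inserting a further zero into the first run gives a matching if \<open>r\<close> is odd.\<close>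

definition zrun :: "(nat \<Rightarrow> nat) list \<Rightarrow> nat" where
  "zrun l = length (takeWhile (\<lambda>m. m = 0) (dropWhile (\<lambda>m. m \<noteq> 0) l))"

definition zsplit :: "(nat \<Rightarrow> nat) list \<Rightarrow> (nat \<Rightarrow> nat) list" where
  "zsplit l = takeWhile (\<lambda>m. m \<noteq> 0) l @ 0 # dropWhile (\<lambda>m. m \<noteq> 0) l"

lemma zrun_append:
  assumes "0 \<notin> set us" "vs = [] \<or> hd vs \<noteq> 0" "r > 0"
  shows "zrun (us @ replicate r 0 @ vs) = r"
    and "zsplit (us @ replicate r 0 @ vs) = us @ replicate (Suc r) 0 @ vs"
proof -
  obtain r' where r: "r = Suc r'" using assms(3) by (cases r) auto
  have 1: "dropWhile (\<lambda>m. m \<noteq> 0) (us @ replicate r 0 @ vs) = replicate r 0 @ vs"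
    and 2: "takeWhile (\<lambda>m. m \<noteq> 0) (us @ replicate r 0 @ vs) = us"
    using assms(1) unfolding r
    by (subst dropWhile_append2, auto, subst takeWhile_append2, auto)
  have "takeWhile (\<lambda>m. m = 0) (replicate r 0 @ vs) = replicate r 0"
    using assms(2) by (subst takeWhile_append2) (auto, cases vs, auto)
  then show "zrun (us @ replicate r 0 @ vs) = r"
    and "zsplit (us @ replicate r 0 @ vs) = us @ replicate (Suc r) 0 @ vs"
    unfolding zrun_def zsplit_def 1 2 by simp_all
qed

lemma zrun_decomp:
  assumes "0 \<in> set l"
  obtains us r vs where "l = us @ replicate r 0 @ vs" "0 \<notin> set us" "vs = [] \<or> hd vs \<noteq> 0" "r > 0"
proof -
  let ?d = "dropWhile (\<lambda>m. m \<noteq> 0) l"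
  define us where "us = takeWhile (\<lambda>m. m \<noteq> 0) l"
  define z where "z = takeWhile (\<lambda>m. m = 0) ?d"
  define vs where "vs = dropWhile (\<lambda>m. m = 0) ?d"
  have d: "?d \<noteq> []" using assms by simp
  then have "hd ?d = 0" using hd_dropWhile[of "\<lambda>m. m \<noteq> 0" l] by simp
  then have "z \<noteq> []" using d unfolding z_def by (metis list.collapse takeWhile_eq_Nil_iff)
  moreover have z: "replicate (length z) 0 = z"
    using set_takeWhileD[of _ "\<lambda>m. m = 0" ?d] unfolding z_def by (metis replicate_eqI)
  moreover have "l = us @ z @ vs" by (simp add: us_def z_def vs_def)
  moreover have "0 \<notin> set us" using set_takeWhileD[of 0 "\<lambda>m. m \<noteq> 0" l] by (auto simp: us_def)
  moreover have "vs = [] \<or> hd vs \<noteq> 0"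
    using hd_dropWhile[of "\<lambda>m. m = 0" ?d] by (auto simp: vs_def)
  ultimately show ?thesis using that[of us "length z" vs] by auto
qed

text \<open>An index without right neighbour denotes the cyclic face, so that one range indexes all
  faces.\<close>

definition face :: "nat \<Rightarrow> (nat \<Rightarrow> nat) list \<Rightarrow> (nat \<Rightarrow> nat) list \<Rightarrow>\<^sub>0 complex" where
  "face i l = (if Suc i < length l then single (merge_at i l) ((-1) ^ i * reorder_coeff N q (l ! i) (l ! Suc i)) else wrap l)"

lemma bdry_faces: "bdry l = (\<Sum>i<length l. face i l)"
proof (cases l)
  case (Cons x l')
  then have "(\<Sum>i<length l'. face i l) = bar l"
    unfolding bar_sum by (intro sum.cong) (auto simp: face_def)
  then show ?thesis by (simp add: Cons bdry_def face_def)
qed (simp add: bdry_def wrap_def)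

text \<open>A run of \<open>r + 1\<close> zeros has \<open>r + 2\<close> faces that delete a zero:
  the merge with the left neighbour, the merges of adjacent zeros, and the merge with the right
  neighbour, which becomes the cyclic face when the run ends the list.\<close>

lemma run_face:
  fixes us vs x r
  defines "b \<equiv> x # us @ replicate (Suc r) 0 @ vs"
  assumes "i \<le> Suc r"
  shows "face (length us + i) b = single (x # us @ replicate r 0 @ vs) ((-1) ^ (length us + i))"
proof -
  \<comment> \<open>Slot 0 is present, so the run always has a left neighbour.\<close>
  obtain ws y where wy: "x # us = ws @ [y]" by (cases "x # us" rule: rev_cases) auto
  then have len: "length us = length ws" by (metis length_Cons length_append_singleton nat.inject)
  have b: "b = ws @ y # replicate (Suc r) 0 @ vs" using wy by (simp add: b_def)
  have t: "x # us @ replicate r 0 @ vs = ws @ y # replicate r 0 @ vs" using wy by simp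
  consider "i = 0" | i' where "i = Suc i'" "i' < r" | "i = Suc r" "vs \<noteq> []" | "i = Suc r" "vs = []"
    using assms by (cases i) (auto simp: le_less)
  then show ?thesis
  proof cases
    case 1
    then show ?thesis unfolding t len b by (simp add: face_def merge_at_append2 nth_append)
  next
    case (2 i')
    then obtain k where r: "r = i' + Suc k" using less_imp_Suc_add by auto
    have "y # replicate (Suc r) 0 @ vs = (y # replicate i' 0) @ 0 # 0 # replicate k 0 @ vs"
      unfolding r replicate_add replicate_Suc
      by (metis append_Cons append_assoc replicate_Suc replicate_app_Cons_same)
    then have b': "b = (ws @ y # replicate i' 0) @ 0 # 0 # replicate k 0 @ vs" by (simp add: b)
    have t': "ws @ y # replicate r 0 @ vs = (ws @ y # replicate i' 0) @ 0 # replicate k 0 @ vs"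
      by (simp add: r replicate_add replicate_append_same)
    have "length ws + i = length (ws @ y # replicate i' 0)" by (simp add: 2)
    then show ?thesis unfolding t len t' b'
      by (simp add: face_def merge_at_append2 nth_append)
  next
    case 3
    then obtain v vs' where vs: "vs = v # vs'" by (cases vs) auto
    have b': "b = (ws @ y # replicate r 0) @ 0 # v # vs'"
      by (simp add: b vs replicate_app_Cons_same)
    have "length ws + i = length (ws @ y # replicate r 0)" by (simp add: 3)
    then show ?thesis unfolding vs t[unfolded vs] len b'
      by (simp add: face_def merge_at_append2 nth_append)
  next
    \<comment> \<open>The cyclic face multiplies \<open>x\<close> by the last zero exponent, whose
      weight is 1.\<close>
    case 4
    have b': "b = (x # us @ replicate r 0) @ [0]"
      by (simp add: b_def 4 replicate_append_same)
    show ?thesis unfolding b' by (simp add: face_def wrap_def 4 butlast_append)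
  qed
qed

lemma sum_alternating: "even r \<Longrightarrow> (\<Sum>i\<le>r. (-1::complex) ^ (n + i)) = (-1) ^ n"
proof (induction r rule: less_induct)
  case (less r)
  show ?case
  proof (cases r)
    case (Suc r')
    then obtain k where "r = Suc (Suc k)" "even k" using less(2) by (cases r') auto
    then show ?thesis using less(1)[of k] by simp
  qed simp
qed

text \<open>For odd \<open>r\<close> the \<open>r + 2\<close> faces at the enlarged run add up to a
  single sign. All other faces keep a first run of even length \<open>r + 1\<close>, because a sum
  of exponents vanishes only if both do. They are not sources, so the order does not enter for
  degenerate cells.\<close>

lemma bdry_zsplit:
  assumes "0 \<in> set l" "odd (zrun l)"
  shows "\<exists>\<epsilon> f. bdry (x # zsplit l) = single (x # l) \<epsilon> + f \<and> \<epsilon> \<noteq> 0 \<and>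
    (\<forall>z\<in>keys f. 0 \<in> set (tl z) \<and> even (zrun (tl z)))"
proof -
  obtain us r vs where l: "l = us @ replicate r 0 @ vs" "0 \<notin> set us" "vs = [] \<or> hd vs \<noteq> 0" "r > 0"
    by (rule zrun_decomp[OF assms(1)])
  have r: "odd r" using assms(2) zrun_append(1)[OF l(2-4)] by (simp add: l(1))
  let ?b = "x # us @ replicate (Suc r) 0 @ vs"
  let ?W = "{..<length ?b} \<inter> {i. length us \<le> i \<and> i \<le> length us + Suc r}"
  let ?V = "{..<length ?b} \<inter> {i. \<not> (length us \<le> i \<and> i \<le> length us + Suc r)}"
  let ?P = "\<lambda>z. 0 \<in> set (tl z) \<and> even (zrun (tl z))"
  have zs: "zsplit l = us @ replicate (Suc r) 0 @ vs"
    using zrun_append(2)[OF l(2-4)] by (simp add: l(1))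
  have P: "?P (y # us' @ replicate (Suc r) 0 @ vs')" if "0 \<notin> set us'" "vs' = [] \<or> hd vs' \<noteq> 0" for y us' vs'
    using zrun_append(1)[OF that, of "Suc r"] r by (simp del: replicate_Suc add: set_replicate_conv_if)
  have UV: "?W \<union> ?V = {..<length ?b}" by blast
  have "bdry ?b = (\<Sum>i\<in>?W. face i ?b) + (\<Sum>i\<in>?V. face i ?b)"
    unfolding bdry_faces by (rule sum.union_disjoint[of ?W ?V "\<lambda>i. face i ?b", unfolded UV]) auto
  also have "(\<Sum>i\<in>?W. face i ?b) = (\<Sum>i\<le>Suc r. face (length us + i) ?b)"
    by (rule sum.reindex_bij_witness[of _ "\<lambda>i. length us + i" "\<lambda>i. i - length us"]) auto
  also have "\<dots> = (\<Sum>i\<le>Suc r. single (x # l) ((-1) ^ (length us + i)))"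
    using run_face[of _ r us x vs] by (intro sum.cong) (auto simp: l(1))
  also have "\<dots> = single (x # l) (\<Sum>i\<le>Suc r. (-1) ^ (length us + i))"
    by (rule poly_mapping_eqI) (simp add: lookup_sum lookup_single when_def del: sum.atMost_Suc)
  also have "(\<Sum>i\<le>Suc r. (-1::complex) ^ (length us + i)) = (-1) ^ length us"
    using r by (intro sum_alternating) auto
  finally have "bdry ?b = single (x # l) ((-1) ^ length us) + (\<Sum>i\<in>?V. face i ?b)" .
  then have bd: "bdry ?b = single (x # l) ((-1) ^ length us) + (\<Sum>i\<in>?V. face i ?b)" .
  have "face i ?b \<in> supported (Collect ?P)" if i: "i \<in> ?V" for i
  proof -
    consider "i < length us" | "i > length us + Suc r" "i < length ?b" using i by auto
    then show ?thesis
    proof cases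
      case 1
      then obtain u us' where us: "us = u # us'" by (cases us) auto
      show ?thesis
      proof (cases i)
        case 0
        then show ?thesis using P[of us' vs "x + u"] l
          by (auto simp: face_def us simp del: replicate_Suc intro!: supported_single)
      next
        case (Suc i')
        then have i': "Suc i' < length us" using 1 by simp
        have "0 \<notin> set (merge_at i' us)" using set_merge_at[OF i'] l(2) by (auto simp: add_fun_eq_0_iff)
        then show ?thesis using P[of "merge_at i' us" vs x] l i' Suc
          by (auto simp: face_def merge_at_append1 simp del: replicate_Suc intro!: supported_single)
      qed
    next
      case 2
      then have vs: "vs \<noteq> []" by auto
      show ?thesis
      proof (cases "Suc i < length ?b")
        case True
        define k where "k = i - (length us + Suc r) - 1"
        have i: "i = Suc (length (us @ replicate (Suc r) 0) + k)" using 2 by (simp add: k_def)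
        have k: "Suc k < length vs" using True by (simp add: i)
        have "merge_at i ?b = x # us @ replicate (Suc r) 0 @ merge_at k vs"
          unfolding i fc_Suc append_assoc[symmetric] by (subst merge_at_append2) auto
        moreover have "hd (merge_at k vs) \<noteq> 0"
          using k l(3) vs by (cases vs; cases "tl vs"; cases k) (auto simp: add_fun_eq_0_iff)
        ultimately show ?thesis using P[of us "merge_at k vs" x] l(2) True
          by (auto simp: face_def simp del: replicate_Suc intro!: supported_single)
      next
        case False
        have h: "butlast vs = [] \<or> hd (butlast vs) \<noteq> 0"
          using l(3) vs by (cases vs) auto
        have "wrap ?b \<in> supported {(last vs + x) # us @ replicate (Suc r) 0 @ butlast vs}"
          using vs by (auto simp: wrap_def butlast_append simp del: replicate_Suc intro!: supported_single)
        then have "wrap ?b \<in> supported (Collect ?P)"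
          using P[of us "butlast vs" "last vs + x"] h l(2) by (auto simp: supported_def simp del: replicate_Suc)
        then show ?thesis using False by (simp add: face_def del: replicate_Suc)
      qed
    qed
  qed
  then have V: "(\<Sum>i\<in>?V. face i ?b) \<in> supported (Collect ?P)" by (rule supported_sum)
  show ?thesis unfolding zs
  proof (intro exI conjI)
    show "bdry ?b = single (x # l) ((-1) ^ length us) + (\<Sum>i\<in>?V. face i ?b)" by (rule bd)
    show "\<forall>z\<in>keys (\<Sum>i\<in>?V. face i ?b). ?P z" using V[unfolded supported_def, THEN CollectD]
      by (intro ballI) (drule (1) subsetD, drule CollectD, assumption)
  qed simp
qed

lemma zcover:
  assumes "0 \<in> set l" "even (zrun l)"
  shows "\<exists>l'. 0 \<in> set l' \<and> odd (zrun l') \<and> zsplit l' = l"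
proof -
  obtain us r vs where l: "l = us @ replicate r 0 @ vs" "0 \<notin> set us" "vs = [] \<or> hd vs \<noteq> 0" "r > 0"
    by (rule zrun_decomp[OF assms(1)])
  have "even r" using assms(2) zrun_append(1)[OF l(2-4)] by (simp add: l(1))
  then obtain r' where r: "r = Suc r'" "r' > 0" "odd r'" using l(4) by (cases r) (auto intro: Nat.gr0I)
  show ?thesis using zrun_append[OF l(2,3) r(2)] r l(1)
    by (intro exI[of _ "us @ replicate r' 0 @ vs"]) auto
qed

lemma zsplit_props: "length (zsplit l) = Suc (length l)" "set (zsplit l) = insert 0 (set l)"
proof -
  show "length (zsplit l) = Suc (length l)"
    unfolding zsplit_def by (metis length_append length_Cons add_Suc_right takeWhile_dropWhile_id)
  have "set l = set (takeWhile (\<lambda>m. m \<noteq> 0) l @ dropWhile (\<lambda>m. m \<noteq> 0) l)"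
    by (simp only: takeWhile_dropWhile_id)
  then show "set (zsplit l) = insert 0 (set l)" unfolding zsplit_def set_append list.set by blast
qed

section \<open>Homology of the complex of monomials\<close>

definition cells :: "nat \<Rightarrow> (nat \<Rightarrow> nat) list set" where
  "cells n = {l. length l = Suc n \<and> set l \<subseteq> M}"

text \<open>Only the tail decides; slot 0 carries the coefficient and may be any monomial. The bound
  \<open>N + 1\<close> leaves the first generator unrestricted.\<close>

definition sources :: "nat \<Rightarrow> (nat \<Rightarrow> nat) list set" where
  "sources n = {x # l | x l. length l = n \<and> x \<in> M \<and> set l \<subseteq> M \<and>
     (if 0 \<in> set l then odd (zrun l) else src (N + 1) l)}"

definition match :: "(nat \<Rightarrow> nat) list \<Rightarrow> (nat \<Rightarrow> nat) list" where
  "match l = hd l # (if 0 \<in> set (tl l) then zsplit (tl l) else split (tl l))"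

definition crit_cells :: "nat \<Rightarrow> (nat \<Rightarrow> nat) list set" where
  "crit_cells n = {x # l | x l. length l = n \<and> x \<in> M \<and> nondeg l \<and> critical (N + 1) l}"

lemma match_cells: "match ` sources n \<subseteq> cells (Suc n)"
proof
  fix b assume "b \<in> match ` sources n"
  then obtain x l where b: "b = match (x # l)" "length l = n" "x \<in> M" "set l \<subseteq> M"
    "if 0 \<in> set l then odd (zrun l) else src (N + 1) l" by (auto simp: sources_def)
  show "b \<in> cells (Suc n)"
  proof (cases "0 \<in> set l")
    case True
    then show ?thesis using b by (auto simp: cells_def match_def zsplit_props)
  next
    case False
    then have "nondeg l" using b by (auto simp: nondeg_def)
    then show ?thesis using b False nondeg_split[of "N + 1" l] length_split[of "N + 1" l]
      by (auto simp: cells_def match_def nondeg_def)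
  qed
qed

lemma bdry_match:
  assumes "a \<in> sources n"
  shows "\<exists>\<epsilon> f. bdry (match a) = single a \<epsilon> + f \<and> \<epsilon> \<noteq> 0 \<and>
    (\<forall>z\<in>keys f. z \<in> sources n \<longrightarrow> less_cell (tl z) (tl a))"
proof -
  obtain x l where a: "a = x # l" "length l = n" "x \<in> M" "set l \<subseteq> M"
    "if 0 \<in> set l then odd (zrun l) else src (N + 1) l" using assms by (auto simp: sources_def)
  show ?thesis
  proof (cases "0 \<in> set l")
    case True
    then obtain \<epsilon> f where f: "bdry (x # zsplit l) = single (x # l) \<epsilon> + f" "\<epsilon> \<noteq> 0"
      "\<forall>z\<in>keys f. 0 \<in> set (tl z) \<and> even (zrun (tl z))" using a bdry_zsplit[of l x] by auto
    have "z \<notin> sources n" if "z \<in> keys f" for z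
      using bspec[OF f(3) that] by (auto simp: sources_def)
    then show ?thesis using f True by (intro exI[of _ \<epsilon>] exI[of _ f]) (auto simp: match_def a(1))
  next
    case False
    then have "src (N + 1) l" "nondeg l" using a by (auto simp: nondeg_def)
    then obtain \<epsilon> f where f: "bdry (x # split l) = single (x # l) \<epsilon> + f" "\<epsilon> \<noteq> 0"
      "\<forall>z\<in>keys f. nondeg (tl z) \<and> (src (N + 1) (tl z) \<longrightarrow> less_cell (tl z) l)"
      using bdry_split[of "N + 1" l x] a(3) by blast
    have "less_cell (tl z) l" if "z \<in> keys f" "z \<in> sources n" for z
      using bspec[OF f(3) that(1)] that(2) by (auto simp: sources_def nondeg_def split: if_splits)
    then show ?thesis using f False by (intro exI[of _ \<epsilon>] exI[of _ f]) (auto simp: match_def a(1))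
  qed
qed

text \<open>Both coverings, \<open>zcover\<close> and \<open>nondeg_cover\<close>, are combined
  here. The conditional excludes degree 0, where truncated subtraction would take partners from
  degree 0 again although there are none.\<close>

lemma cells_cover: "cells n \<subseteq> sources n \<union> crit_cells n \<union> match ` (if n = 0 then {} else sources (n - 1))"
proof
  fix b assume "b \<in> cells n"
  then obtain x l where b: "b = x # l" "length l = n" "x \<in> M" "set l \<subseteq> M"
    by (cases b) (auto simp: cells_def)
  show "b \<in> sources n \<union> crit_cells n \<union> match ` (if n = 0 then {} else sources (n - 1))"
  proof (cases "0 \<in> set l")
    case True
    then have n: "n > 0" using b by auto
    show ?thesis
    proof (cases "odd (zrun l)")
      case False
      then obtain l' where l': "0 \<in> set l'" "odd (zrun l')" "zsplit l' = l" using zcover True by blast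
      then have "match (x # l') = b" by (simp add: match_def b)
      moreover have "x # l' \<in> sources (n - 1)"
        using l' b zsplit_props[of l'] by (auto simp: sources_def)
      ultimately show ?thesis using n by auto
    qed (use True b in \<open>auto simp: sources_def\<close>)
  next
    case False
    then have nd: "nondeg l" using b by (auto simp: nondeg_def)
    show ?thesis
    proof (cases "src (N + 1) l \<or> critical (N + 1) l")
      case True
      then show ?thesis using b False nd by (auto simp: sources_def crit_cells_def)
    next
      case nsc: False
      then have "l \<noteq> []" by auto
      then have "ld (hd l) < N + 1" using nd lead_range[of "hd l" N] by (cases l) auto
      then obtain l' where l': "src (N + 1) l'" "nondeg l'" "split l' = l"
        using nondeg_cover[of l "N + 1"] nd nsc by auto
      then have "match (x # l') = b" by (simp add: match_def b nondeg_def)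
      moreover have "x # l' \<in> sources (n - 1)"
        using l' b length_split[of "N + 1" l'] by (auto simp: sources_def nondeg_def)
      ultimately have "b \<in> match ` sources (n - 1)" by (metis imageI)
      moreover have "n \<noteq> 0" using \<open>l \<noteq> []\<close> b by auto
      ultimately show ?thesis by simp
    qed
  qed
qed

lemma matching: "acyclic_matching bdry (sources n) match (\<lambda>l. wcat (tl l)) (lenlex less_than)"
proof
  show "wf (lenlex less_than)" by (intro wf_lenlex wf_less_than)
  have irr: "\<not> less_cell l l" for l by (simp add: lenlex_irreflexive irrefl_less_than)
  fix a assume a: "a \<in> sources n"
  obtain \<epsilon> f where f: "bdry (match a) = single a \<epsilon> + f" "\<epsilon> \<noteq> 0"
    "\<forall>z\<in>keys f. z \<in> sources n \<longrightarrow> less_cell (tl z) (tl a)" using bdry_match[OF a] by blast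
  have "lookup f a = 0" using f(3) a irr by (metis in_keys_iff)
  then show "lookup (bdry (match a)) a \<noteq> 0" by (simp add: f lookup_add)
  show "less_cell (tl a') (tl a)" if "a' \<in> sources n" "a' \<noteq> a" "lookup (bdry (match a)) a' \<noteq> 0" for a'
    using that f(3) by (simp add: f(1) lookup_add lookup_single in_keys_iff)
qed

lemma bdry_cells: "b \<in> cells (Suc n) \<Longrightarrow> bdry b \<in> supported (cells n)"
proof -
  assume b: "b \<in> cells (Suc n)"
  then obtain x y l where l: "b = x # y # l" "length l = n" "x \<in> M" "y \<in> M" "set l \<subseteq> M"
    by (cases b; cases "tl b") (auto simp: cells_def)
  have "merge_at i b \<in> cells n" if "Suc i < length b" for i
    using set_merge_at[OF that] length_merge_at[OF that] b
    by (fastforce simp: cells_def add_in_multiindices subset_iff)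
  moreover have "(last b + hd b) # tl (butlast b) \<in> cells n"
    using l last_in_set[of "y # l"] in_set_butlastD[of _ "y # l"]
    by (auto simp: cells_def intro!: add_in_multiindices split: if_splits)
  ultimately show ?thesis
    unfolding bdry_faces face_def wrap_def by (auto intro!: supported_sum supported_single supported_zero)
qed

lemma chain_reduce:
  assumes "z \<in> supported (cells n)"
  shows "\<exists>y\<in>supported (cells (Suc n)). z - lin_ext bdry y
           \<in> supported (crit_cells n \<union> match ` (if n = 0 then {} else sources (n - 1)))"
proof -
  interpret acyclic_matching bdry "sources n" match "\<lambda>l. wcat (tl l)" "lenlex less_than"
    by (rule matching)
  obtain y where y: "y \<in> supported (match ` sources n)" "z - lin_ext bdry y \<in> supported (- sources n)"
    using reduce by blast
  have y': "y \<in> supported (cells (Suc n))" using y(1) match_cells[of n] by (auto simp: supported_def)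
  then have "z - lin_ext bdry y \<in> supported (cells n)"
    using assms bdry_cells by (intro supported_diff lin_ext_supported) auto
  then have "z - lin_ext bdry y \<in> supported (crit_cells n \<union> match ` (if n = 0 then {} else sources (n - 1)))"
    using y(2) cells_cover[of n] by (fastforce simp: supported_def)
  then show ?thesis using y' by blast
qed

text \<open>Without critical cells only partners remain, and by triangularity a chain of partners is
  determined by the source part of its boundary.\<close>

lemma chain_eq_0:
  assumes "w \<in> supported (crit_cells n \<union> match ` (if n = 0 then {} else sources (n - 1)))"
    "\<And>b. b \<in> crit_cells n \<Longrightarrow> lookup w b = 0"
    "lin_ext bdry w \<in> supported (- sources (n - 1))"
  shows "w = 0"
proof (cases "n = 0")
  case True
  then show ?thesis using assms(1,2) by (intro poly_mapping_eqI) (auto simp: supported_iff)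
next
  case False
  interpret acyclic_matching bdry "sources (n - 1)" match "\<lambda>l. wcat (tl l)" "lenlex less_than"
    by (rule matching)
  show ?thesis
    using assms False by (intro target_cycle_zero) (auto simp: supported_iff)
qed

text \<open>Strictly decreasing positive indices below \<open>B\<close> leave room for at most
  \<open>B - 1\<close> entries.\<close>

lemma critical_length: "critical B l \<Longrightarrow> nondeg l \<Longrightarrow> B > 0 \<Longrightarrow> length l < B"
proof (induction B l rule: critical.induct)
  case (2 B m l)
  then have "ld m \<in> {1..N}" by (intro lead_range) auto
  then show ?case using 2 by auto
qed auto

text \<open>Equality in the length bound forces every index, so the run descends through all of
  them.\<close>

lemma critical_eq: "critical (Suc (length l)) l \<Longrightarrow> nondeg l \<Longrightarrow> l = map unit_index (rev [1..<Suc (length l)])"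
proof (induction l)
  case (Cons m l)
  have j: "ld m \<in> {1..N}" using Cons by (intro lead_range) auto
  have "length l < ld m" using Cons j by (intro critical_length) auto
  then have "ld m = Suc (length l)" using Cons by auto
  then show ?case using Cons by auto
qed simp

lemma crit_cells_empty: "n > N \<Longrightarrow> crit_cells n = {}"
  using critical_length[of "N + 1"] by (fastforce simp: crit_cells_def)

lemma crit_cells_top: "crit_cells N \<subseteq> (\<lambda>x. x # map unit_index (rev [1..<N + 1])) ` M"
  using critical_eq by (force simp: crit_cells_def simp del: upt_Suc)

text \<open>Above the top degree a reduced cycle lives on partners alone, and its vanishing boundary
  forces it to be 0.\<close>

theorem exact_above_top:
  assumes "n > N" "z \<in> supported (cells n)" "lin_ext bdry z = 0"
  shows "\<exists>y\<in>supported (cells (Suc n)). z = lin_ext bdry y"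
proof -
  obtain y where y: "y \<in> supported (cells (Suc n))" "z - lin_ext bdry y
           \<in> supported (crit_cells n \<union> match ` (if n = 0 then {} else sources (n - 1)))"
    using chain_reduce[OF assms(2)] by blast
  have "lin_ext bdry (z - lin_ext bdry y) = 0"
    by (simp add: lin_ext_diff assms lin_ext_comp bdry_bdry)
  then have "lin_ext bdry (z - lin_ext bdry y) \<in> supported (- sources (n - 1))"
    by (simp add: supported_zero)
  then have "z - lin_ext bdry y = 0"
    using crit_cells_empty[OF assms(1)] by (intro chain_eq_0[OF y(2)]) auto
  then show ?thesis using y(1) by auto
qed

end

section \<open>Transfer to the Hochschild complex of an algebra with a monomial basis\<close>

text \<open>What the computation uses about the algebra: linear coordinates in which product and
  automorphism take monomial form. Cosets of the tensor algebra stay out of sight.\<close>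

locale monomial_basis = hyperplane_complex N q p
  for N :: nat and q :: "nat \<Rightarrow> nat \<Rightarrow> complex" and p :: "nat \<Rightarrow> complex" +
  fixes A :: "(complex, 'b, 'm) module_scheme" and \<sigma> :: "'b \<Rightarrow> 'b"
    and coords :: "'b \<Rightarrow> ((nat \<Rightarrow> nat) \<Rightarrow>\<^sub>0 complex)"
  assumes coords_bij: "bij_betw coords (carrier A) (supported (multiindices N))"
    and add_closed: "a \<in> carrier A \<Longrightarrow> b \<in> carrier A \<Longrightarrow> a \<oplus>\<^bsub>A\<^esub> b \<in> carrier A"
    and coords_add: "a \<in> carrier A \<Longrightarrow> b \<in> carrier A \<Longrightarrow> coords (a \<oplus>\<^bsub>A\<^esub> b) = coords a + coords b"
    and smult_closed: "a \<in> carrier A \<Longrightarrow> c \<odot>\<^bsub>A\<^esub> a \<in> carrier A"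
    and coords_smult: "a \<in> carrier A \<Longrightarrow> coords (c \<odot>\<^bsub>A\<^esub> a) = fscale c (coords a)"
    and mult_closed: "a \<in> carrier A \<Longrightarrow> b \<in> carrier A \<Longrightarrow> a \<otimes>\<^bsub>A\<^esub> b \<in> carrier A"
    and coords_mult: "a \<in> carrier A \<Longrightarrow> b \<in> carrier A \<Longrightarrow> coords (a \<otimes>\<^bsub>A\<^esub> b) =
      lin_ext (\<lambda>\<alpha>. lin_ext (\<lambda>\<beta>. single (\<alpha> + \<beta>) (reorder_coeff N q \<alpha> \<beta>)) (coords b)) (coords a)"
    and sigma_closed: "a \<in> carrier A \<Longrightarrow> \<sigma> a \<in> carrier A"
    and coords_sigma: "a \<in> carrier A \<Longrightarrow> coords (\<sigma> a) = lin_ext (\<lambda>\<alpha>. single \<alpha> (weight N p \<alpha>)) (coords a)"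
begin

section \<open>Multilinear expansion of pure tensors as a chain map\<close>

definition cons_tensor :: "((nat \<Rightarrow> nat) \<Rightarrow>\<^sub>0 complex) \<Rightarrow> ((nat \<Rightarrow> nat) list \<Rightarrow>\<^sub>0 complex)
    \<Rightarrow> ((nat \<Rightarrow> nat) list \<Rightarrow>\<^sub>0 complex)" where
  "cons_tensor f t = lin_ext (\<lambda>\<alpha>. cons_chain \<alpha> t) f"

fun tens :: "'b list \<Rightarrow> ((nat \<Rightarrow> nat) list \<Rightarrow>\<^sub>0 complex)" where
  "tens [] = single [] 1"
| "tens (x # xs) = cons_tensor (coords x) (tens xs)"

lemma cons_tensor_lin_ext: "cons_tensor f (lin_ext g h) = lin_ext (\<lambda>y. cons_tensor f (g y)) h"
  unfolding cons_tensor_def cons_chain_lin_ext by (rule lin_ext_commute)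

lemma cons_tensor_add: "cons_tensor f (t + u) = cons_tensor f t + cons_tensor f u"
  by (simp add: cons_tensor_def cons_chain_add lin_ext_add_fun)

lemma cons_tensor_add_left: "cons_tensor (f + g) t = cons_tensor f t + cons_tensor g t"
  by (simp add: cons_tensor_def lin_ext_add)

lemma cons_tensor_fscale: "cons_tensor f (fscale c t) = fscale c (cons_tensor f t)"
  by (simp add: cons_tensor_def cons_chain_fscale lin_ext_fscale_fun)

lemma cons_tensor_fscale_left: "cons_tensor (fscale c f) t = fscale c (cons_tensor f t)"
  by (simp add: cons_tensor_def lin_ext_fscale)

lemma coords_supported: "a \<in> carrier A \<Longrightarrow> coords a \<in> supported M"
  using coords_bij by (auto simp: bij_betw_def)

lemma tens_supported: "set xs \<subseteq> carrier A \<Longrightarrow> tens xs \<in> supported {l. length l = length xs \<and> set l \<subseteq> M}"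
proof (induction xs)
  case (Cons x xs)
  then show ?case
    unfolding tens.simps cons_tensor_def cons_chain_def
    by (intro lin_ext_supported[OF coords_supported] lin_ext_supported[OF Cons.IH] supported_single) auto
qed (auto intro: supported_single)

text \<open>Expansion from the right end, as required by the cyclic face.\<close>

lemma tens_snoc: "tens (xs @ [y]) = lin_ext (\<lambda>\<beta>. snoc_chain \<beta> (tens xs)) (coords y)"
proof (induction xs)
  case (Cons x xs)
  then have "tens ((x # xs) @ [y]) = lin_ext (\<lambda>\<beta>. cons_tensor (coords x) (snoc_chain \<beta> (tens xs))) (coords y)"
    by (simp add: cons_tensor_lin_ext)
  then show ?case by (simp add: cons_tensor_def cons_chain_snc snoc_chain_lin_ext)
qed (simp add: cons_tensor_def)

lemma cons_tensor_mult: "a \<in> carrier A \<Longrightarrow> b \<in> carrier A \<Longrightarrow> cons_tensor (coords (a \<otimes>\<^bsub>A\<^esub> b)) t =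
    lin_ext (\<lambda>\<alpha>. lin_ext (\<lambda>\<beta>. fscale (reorder_coeff N q \<alpha> \<beta>) (cons_chain (\<alpha> + \<beta>) t)) (coords b)) (coords a)"
  by (simp add: cons_tensor_def coords_mult lin_ext_comp lin_ext_single)

lemma bar_consp_consp:
  assumes "a \<in> carrier A" "b \<in> carrier A"
  shows "lin_ext bar (cons_tensor (coords a) (cons_tensor (coords b) t)) =
    cons_tensor (coords (a \<otimes>\<^bsub>A\<^esub> b)) t - cons_tensor (coords a) (lin_ext bar (cons_tensor (coords b) t))"
proof -
  have "lin_ext bar (cons_tensor (coords a) (cons_tensor (coords b) t)) =
      lin_ext (\<lambda>\<alpha>. lin_ext (\<lambda>\<beta>. lin_ext bar (cons_chain \<alpha> (cons_chain \<beta> t))) (coords b)) (coords a)"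
    by (simp add: cons_tensor_def cons_chain_lin_ext lin_ext_comp)
  also have "\<dots> = cons_tensor (coords (a \<otimes>\<^bsub>A\<^esub> b)) t - lin_ext (\<lambda>\<alpha>. lin_ext (\<lambda>\<beta>. cons_chain \<alpha> (lin_ext bar (cons_chain \<beta> t))) (coords b)) (coords a)"
    by (simp add: bar_cns_cns lin_ext_diff_fun cons_tensor_mult assms)
  also have "lin_ext (\<lambda>\<alpha>. lin_ext (\<lambda>\<beta>. cons_chain \<alpha> (lin_ext bar (cons_chain \<beta> t))) (coords b)) (coords a)
      = cons_tensor (coords a) (lin_ext bar (cons_tensor (coords b) t))"
    by (simp add: cons_tensor_def cons_chain_lin_ext lin_ext_comp)
  finally show ?thesis .
qed

lemma tens_bar:
  assumes "set xs \<subseteq> carrier A"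
  shows "lin_ext tens (\<Sum>i<length xs - 1. single (take i xs @ (xs ! i \<otimes>\<^bsub>A\<^esub> xs ! (i + 1)) # drop (i + 2) xs) ((-1) ^ i))
    = lin_ext bar (tens xs)"
  using assms
proof (induction xs rule: induct_list012)
  case (2 x)
  then show ?case by (simp add: cons_tensor_def lin_ext_comp lin_ext_single)
next
  case (3 x y l)
  let ?h = "\<lambda>xs. \<Sum>i<length xs - 1. single (take i xs @ (xs ! i \<otimes>\<^bsub>A\<^esub> xs ! (i + 1)) # drop (i + 2) xs) ((-1::complex) ^ i)"
  have "?h (x # y # l) = single ((x \<otimes>\<^bsub>A\<^esub> y) # l) 1 - cons_chain x (?h (y # l))"
    by (simp add: sum.lessThan_Suc_shift sum_negf single_uminus cons_chain_sum del: sum.lessThan_Suc)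
  then have "lin_ext tens (?h (x # y # l)) = tens ((x \<otimes>\<^bsub>A\<^esub> y) # l) - cons_tensor (coords x) (lin_ext tens (?h (y # l)))"
    by (simp add: lin_ext_diff lin_ext_single lin_ext_cns cons_tensor_lin_ext del: sum.lessThan_Suc)
  also have "lin_ext tens (?h (y # l)) = lin_ext bar (tens (y # l))"
    using 3 by simp
  also have "tens ((x \<otimes>\<^bsub>A\<^esub> y) # l) - cons_tensor (coords x) (lin_ext bar (tens (y # l))) = lin_ext bar (tens (x # y # l))"
    using 3 bar_consp_consp[of x y] by simp
  finally show ?case .
qed (simp add: lin_ext_single)

lemma tens_wrap:
  assumes "set xs \<subseteq> carrier A" "length xs \<ge> 2"
  shows "lin_ext tens (single ((\<sigma> (last xs) \<otimes>\<^bsub>A\<^esub> hd xs) # tl (butlast xs)) ((-1) ^ (length xs - 1)))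
    = lin_ext wrap (tens xs)"
proof -
  obtain x xs' where "xs = x # xs'" "xs' \<noteq> []" using assms(2) by (cases xs; cases "tl xs") auto
  then obtain m y where xs: "xs = x # m @ [y]" by (cases xs' rule: rev_cases) auto
  have xy: "x \<in> carrier A" "y \<in> carrier A" using assms(1) by (auto simp: xs)
  let ?n = "Suc (length m)"
  have "lin_ext wrap (tens xs) = lin_ext (\<lambda>\<beta>. lin_ext wrap (snoc_chain \<beta> (tens (x # m)))) (coords y)"
    using tens_snoc[of "x # m" y] by (simp add: xs lin_ext_comp)
  also have "\<dots> = lin_ext (\<lambda>\<beta>. fscale ((-1) ^ ?n * weight N p \<beta>) (left_act \<beta> (tens (x # m)))) (coords y)"
    using tens_supported[of "x # m"] assms(1)
    by (subst wrap_snc[of _ "length (x # m)"]) (auto simp: xs supported_def)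
  also have "\<dots> = fscale ((-1) ^ ?n) (lin_ext (\<lambda>\<beta>. fscale (weight N p \<beta>) (left_act \<beta> (tens (x # m)))) (coords y))"
    by (simp only: fscale_fscale[symmetric] lin_ext_fscale_fun)
  also have "\<dots> = fscale ((-1) ^ ?n) (lin_ext (\<lambda>\<beta>. fscale (weight N p \<beta>)
       (lin_ext (\<lambda>\<alpha>. fscale (reorder_coeff N q \<beta> \<alpha>) (cons_chain (\<beta> + \<alpha>) (tens m))) (coords x))) (coords y))"
    unfolding left_act_cns[symmetric] by (simp add: cons_tensor_def left_act_def lin_ext_comp)
  also have "\<dots> = fscale ((-1) ^ ?n) (cons_tensor (coords (\<sigma> y \<otimes>\<^bsub>A\<^esub> x)) (tens m))"
    using xy by (simp add: cons_tensor_mult sigma_closed coords_sigma lin_ext_comp lin_ext_single)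
  finally show ?thesis by (simp add: xs butlast_append lin_ext_single)
qed

definition tlists :: "nat \<Rightarrow> 'b list set" where
  "tlists n = {xs. length xs = n + 1 \<and> set xs \<subseteq> carrier A}"

lemma free_tensors_eq: "free_tensors A n = supported (tlists n)"
  by (auto simp: free_tensors_def supported_def tlists_def)

lemma tens_hochschild_b_pure:
  assumes "set xs \<subseteq> carrier A"
  shows "lin_ext tens (hochschild_b_pure A \<sigma> xs) = lin_ext bdry (tens xs)"
proof (cases "length xs \<ge> 2")
  case True
  have "lin_ext bdry (tens xs) = lin_ext bar (tens xs) + lin_ext wrap (tens xs)"
    unfolding bdry_def by (rule lin_ext_add_fun)
  then show ?thesis using True
    by (simp add: hochschild_b_pure_def Let_def lin_ext_add tens_bar[OF assms, symmetric] tens_wrap[OF assms True, symmetric])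
next
  case False
  then have "bdry l = 0" if "length l = length xs" for l
    using that by (cases l; cases "tl l") (auto simp: bdry_def wrap_def)
  then have "lin_ext bdry (tens xs) = 0"
    using tens_supported[OF assms] by (intro lin_ext_eq_0) auto
  then show ?thesis using False by (simp add: hochschild_b_pure_def)
qed

lemma tens_hochschild_b:
  "z \<in> free_tensors A n \<Longrightarrow> lin_ext tens (hochschild_b A \<sigma> z) = lin_ext bdry (lin_ext tens z)"
  unfolding hochschild_b_def lin_ext_comp free_tensors_eq
  by (erule lin_ext_cong_supported) (simp add: tlists_def tens_hochschild_b_pure)

lemma tens_chain: "z \<in> free_tensors A n \<Longrightarrow> lin_ext tens z \<in> supported (cells n)"
  unfolding free_tensors_eq
proof (erule lin_ext_supported)
  fix xs assume "xs \<in> tlists n"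
  then show "tens xs \<in> supported (cells n)"
    using tens_supported[of xs] by (auto simp: tlists_def cells_def supported_def)
qed

lemma hochschild_b_0: "z \<in> free_tensors A 0 \<Longrightarrow> hochschild_b A \<sigma> z = 0"
  unfolding hochschild_b_def free_tensors_eq
  by (erule lin_ext_eq_0) (auto simp: tlists_def hochschild_b_pure_def)

lemma hochschild_b_closed:
  assumes "z \<in> free_tensors A (Suc n)"
  shows "hochschild_b A \<sigma> z \<in> free_tensors A n"
  unfolding hochschild_b_def free_tensors_eq
proof (rule lin_ext_supported[OF assms[unfolded free_tensors_eq]])
  fix xs assume "xs \<in> tlists (Suc n)"
  then have xs: "length xs = Suc (Suc n)" "set xs \<subseteq> carrier A" by (auto simp: tlists_def)
  have 1: "take i xs @ (xs ! i \<otimes>\<^bsub>A\<^esub> xs ! (i + 1)) # drop (i + 2) xs \<in> tlists n" if "i < Suc n" for i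
  proof -
    have "xs ! i \<in> carrier A" "xs ! (i + 1) \<in> carrier A" using that xs by (auto intro!: subsetD[OF xs(2)])
    then show ?thesis using that xs set_take_subset[of i xs] set_drop_subset[of "i + 2" xs]
      by (auto simp: tlists_def intro: mult_closed)
  qed
  obtain x m y where l: "xs = x # m @ [y]" "length m = n"
    using xs(1) by (cases xs; cases "tl xs" rule: rev_cases) auto
  have "(\<sigma> (last xs) \<otimes>\<^bsub>A\<^esub> hd xs) # tl (butlast xs) \<in> tlists n"
    using l xs by (auto simp: tlists_def butlast_append intro!: mult_closed sigma_closed)
  then show "hochschild_b_pure A \<sigma> xs \<in> supported (tlists n)"
    using 1 xs by (auto simp: hochschild_b_pure_def Let_def simp del: sum.lessThan_Suc
        intro!: supported_add supported_sum supported_single)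
qed

lemma tens_update_add:
  assumes "set xs \<subseteq> carrier A" "i < length xs" "a \<in> carrier A" "b \<in> carrier A"
  shows "tens (xs[i := a \<oplus>\<^bsub>A\<^esub> b]) = tens (xs[i := a]) + tens (xs[i := b])"
  using assms(1,2)
proof (induction xs arbitrary: i)
  case (Cons x xs)
  then show ?case by (cases i) (auto simp: cons_tensor_add cons_tensor_add_left coords_add assms)
qed simp

lemma tens_update_smult:
  assumes "set xs \<subseteq> carrier A" "i < length xs" "a \<in> carrier A"
  shows "tens (xs[i := c \<odot>\<^bsub>A\<^esub> a]) = fscale c (tens (xs[i := a]))"
  using assms(1,2)
proof (induction xs arbitrary: i)
  case (Cons x xs)
  then show ?case by (cases i) (auto simp: cons_tensor_fscale cons_tensor_fscale_left coords_smult assms)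
qed simp

lemma tens_relations: "r \<in> tensor_relations A n \<Longrightarrow> lin_ext tens r = 0"
proof -
  have sub: "free_vs.subspace {r. lin_ext tens r = 0}"
    by (rule free_vs.subspaceI) (auto simp: lin_ext_add lin_ext_fscale)
  have "tensor_relations A n \<subseteq> {r. lin_ext tens r = 0}"
    unfolding tensor_relations_def
    by (rule free_vs.span_minimal[OF _ sub])
       (auto simp: lin_ext_diff lin_ext_single tens_update_add tens_update_smult)
  then show "r \<in> tensor_relations A n \<Longrightarrow> lin_ext tens r = 0" by blast
qed

lemma relations_free: "tensor_relations A n \<subseteq> free_tensors A n"
  unfolding tensor_relations_def free_tensors_eq
proof (rule free_vs.span_minimal[OF _ subspace_supported], safe)
  have upd: "xs[i := a] \<in> tlists n" if "length xs = n + 1" "set xs \<subseteq> carrier A" "a \<in> carrier A" for xs i a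
    using that set_update_subset_insert[of xs i a] by (auto simp: tlists_def)
  show "single (xs[i := a \<oplus>\<^bsub>A\<^esub> b]) 1 - single (xs[i := a]) 1 - single (xs[i := b]) 1 \<in> supported (tlists n)"
    if "length xs = n + 1" "set xs \<subseteq> carrier A" "i \<le> n" "a \<in> carrier A" "b \<in> carrier A" for xs i a b
    using that by (intro supported_diff supported_single upd add_closed)
  show "single (xs[i := c \<odot>\<^bsub>A\<^esub> a]) 1 - single (xs[i := a]) c \<in> supported (tlists n)"
    if "length xs = n + 1" "set xs \<subseteq> carrier A" "i \<le> n" "a \<in> carrier A" for xs i a c
    using that by (intro supported_diff supported_single upd smult_closed)
qed

lemma subspace_relations: "free_vs.subspace (tensor_relations A n)"
  unfolding tensor_relations_def by (rule free_vs.subspace_span)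

section \<open>The inverse of the expansion, modulo multilinearity\<close>

definition elt :: "((nat \<Rightarrow> nat) \<Rightarrow>\<^sub>0 complex) \<Rightarrow> 'b" where
  "elt = inv_into (carrier A) coords"

lemma elt_carrier: "f \<in> supported M \<Longrightarrow> elt f \<in> carrier A"
  and coords_elt: "f \<in> supported M \<Longrightarrow> coords (elt f) = f"
  and elt_crd: "a \<in> carrier A \<Longrightarrow> elt (coords a) = a"
  using coords_bij unfolding elt_def bij_betw_def
  by (auto simp: inv_into_into f_inv_into_f)

lemma elt_eqI: "a \<in> carrier A \<Longrightarrow> coords a = f \<Longrightarrow> elt f = a"
  using elt_crd by auto

lemma elt_add: "f \<in> supported M \<Longrightarrow> g \<in> supported M \<Longrightarrow> elt (f + g) = elt f \<oplus>\<^bsub>A\<^esub> elt g"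
  by (intro elt_eqI) (auto simp: coords_add coords_elt elt_carrier add_closed)

lemma elt_fscale: "f \<in> supported M \<Longrightarrow> elt (fscale c f) = c \<odot>\<^bsub>A\<^esub> elt f"
  by (intro elt_eqI) (auto simp: coords_smult coords_elt elt_carrier smult_closed)

definition mon :: "(nat \<Rightarrow> nat) \<Rightarrow> 'b" where
  "mon \<alpha> = elt (single \<alpha> 1)"

lemma mon_carrier: "\<alpha> \<in> M \<Longrightarrow> mon \<alpha> \<in> carrier A"
  and coords_mon: "\<alpha> \<in> M \<Longrightarrow> coords (mon \<alpha>) = single \<alpha> 1"
  by (simp_all add: mon_def elt_carrier coords_elt supported_single)

text \<open>Additivity and homogeneity in one slot, iterated over the finite support of
  \<open>f\<close>, replace the slot by its monomial expansion.\<close>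

lemma expand_slot:
  assumes "length us + length vs = n" "set us \<subseteq> carrier A" "set vs \<subseteq> carrier A" "f \<in> supported M"
  shows "single (us @ elt f # vs) 1 - lin_ext (\<lambda>\<alpha>. single (us @ mon \<alpha> # vs) 1) f \<in> tensor_relations A n"
proof -
  let ?R = "tensor_relations A n"
  let ?s = "\<lambda>a. single (us @ a # vs) (1::complex)"
  let ?d = "\<lambda>f. ?s (elt f) - lin_ext (\<lambda>\<alpha>. ?s (mon \<alpha>)) f"
  have upd: "(us @ a # vs)[length us := b] = us @ b # vs" for a b by simp
  have add: "?s (a \<oplus>\<^bsub>A\<^esub> b) - ?s a - ?s b \<in> ?R" if "a \<in> carrier A" "b \<in> carrier A" for a b
    unfolding tensor_relations_def using that assms
    by (intro free_vs.span_base UnI1 CollectI exI[of _ "us @ a # vs"] exI[of _ "length us"] exI[of _ a] exI[of _ b]) auto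
  have sm: "?s (c \<odot>\<^bsub>A\<^esub> a) - fscale c (?s a) \<in> ?R" if "a \<in> carrier A" for c a
    unfolding tensor_relations_def using that assms
    by (intro free_vs.span_base UnI2 CollectI exI[of _ "us @ a # vs"] exI[of _ "length us"] exI[of _ c] exI[of _ a]) auto
  have "?d (\<Sum>\<alpha>\<in>K. single \<alpha> (c \<alpha>)) \<in> ?R" if "finite K" "K \<subseteq> M" for K c
    using that
  proof (induction K)
    case empty
    \<comment> \<open>No relation mentions the zero vector; it is reached as 0 times a
      vector.\<close>
    have "0 = fscale 0 (0 :: (nat \<Rightarrow> nat) \<Rightarrow>\<^sub>0 complex)" by simp
    then have "elt 0 = 0 \<odot>\<^bsub>A\<^esub> elt 0" using elt_fscale[of 0 0] by (simp add: supported_zero)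
    then show ?case using sm[of "elt 0" 0] by (simp add: elt_carrier supported_zero)
  next
    case (insert \<alpha> K)
    let ?g = "\<Sum>\<alpha>\<in>K. single \<alpha> (c \<alpha>)"
    have g: "?g \<in> supported M" using insert by (intro supported_sum supported_single) auto
    have m: "mon \<alpha> \<in> carrier A" using insert by (auto intro: mon_carrier)
    have e: "elt (single \<alpha> (c \<alpha>) + ?g) = (c \<alpha> \<odot>\<^bsub>A\<^esub> mon \<alpha>) \<oplus>\<^bsub>A\<^esub> elt ?g"
      using insert g elt_fscale[of "single \<alpha> 1" "c \<alpha>"] by (simp add: elt_add supported_single mon_def)
    have "?d (single \<alpha> (c \<alpha>) + ?g) = (?s ((c \<alpha> \<odot>\<^bsub>A\<^esub> mon \<alpha>) \<oplus>\<^bsub>A\<^esub> elt ?g) - ?s (c \<alpha> \<odot>\<^bsub>A\<^esub> mon \<alpha>) - ?s (elt ?g))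
       + (?s (c \<alpha> \<odot>\<^bsub>A\<^esub> mon \<alpha>) - fscale (c \<alpha>) (?s (mon \<alpha>))) + ?d ?g"
      by (simp add: e lin_ext_add lin_ext_single del: fscale_single)
    also have "\<dots> \<in> ?R"
      using insert g m
      by (intro free_vs.subspace_add[OF subspace_relations] add sm) (auto simp: smult_closed elt_carrier)
    finally show ?case using insert by simp
  qed
  from this[of "keys f" "lookup f"] assms(4) show ?thesis
    using lin_ext_singles[of f] unfolding lin_ext_def[of "\<lambda>x. single x 1"] by (simp add: supported_def)
qed

text \<open>\<open>us\<close> holds the slots that are already expanded, so the induction moves from
  left to right.\<close>

lemma expand_tensor:
  assumes "length us + length xs = n + 1" "set us \<subseteq> carrier A" "set xs \<subseteq> carrier A"
  shows "single (us @ xs) 1 - lin_ext (\<lambda>l. single (us @ map mon l) 1) (tens xs) \<in> tensor_relations A n"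
  using assms
proof (induction xs arbitrary: us)
  case Nil
  then show ?case by (simp add: lin_ext_single free_vs.subspace_0[OF subspace_relations])
next
  case (Cons x xs)
  let ?R = "tensor_relations A n"
  have x: "x \<in> carrier A" using Cons by auto
  have e1: "single (us @ x # xs) 1 - lin_ext (\<lambda>\<alpha>. single (us @ mon \<alpha> # xs) 1) (coords x) \<in> ?R"
    using expand_slot[of us xs n "coords x"] Cons x by (simp add: elt_crd coords_supported)
  have e2: "lin_ext (\<lambda>\<alpha>. single (us @ mon \<alpha> # xs) 1 -
      lin_ext (\<lambda>l. single (us @ mon \<alpha> # map mon l) 1) (tens xs)) (coords x) \<in> ?R"
  proof (rule lin_ext_in_subspace[OF subspace_relations])
    fix \<alpha> assume "\<alpha> \<in> keys (coords x)"
    then have "\<alpha> \<in> M" using coords_supported[OF x] by (auto simp: supported_def)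
    then show "single (us @ mon \<alpha> # xs) 1 - lin_ext (\<lambda>l. single (us @ mon \<alpha> # map mon l) 1) (tens xs) \<in> ?R"
      using Cons.IH[of "us @ [mon \<alpha>]"] Cons.prems mon_carrier by auto
  qed
  have "single (us @ x # xs) 1 -
      lin_ext (\<lambda>\<alpha>. lin_ext (\<lambda>l. single (us @ mon \<alpha> # map mon l) 1) (tens xs)) (coords x) \<in> ?R"
    using free_vs.subspace_add[OF subspace_relations e1 e2[unfolded lin_ext_diff_fun]] by simp
  then show ?case by (simp add: cons_tensor_def lin_ext_comp lin_ext_cns)
qed

definition mons :: "((nat \<Rightarrow> nat) list \<Rightarrow>\<^sub>0 complex) \<Rightarrow> ('b list \<Rightarrow>\<^sub>0 complex)" where
  "mons = lin_ext (\<lambda>l. single (map mon l) 1)"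

lemma mons_free: "f \<in> supported (cells n) \<Longrightarrow> mons f \<in> free_tensors A n"
  unfolding mons_def free_tensors_eq
  by (erule lin_ext_supported, rule supported_single) (auto simp: cells_def tlists_def mon_carrier subset_iff)

lemma tens_map_mon: "set l \<subseteq> M \<Longrightarrow> tens (map mon l) = single l 1"
  by (induction l) (auto simp: cons_tensor_def coords_mon lin_ext_single)

lemma tens_mons: "f \<in> supported (cells n) \<Longrightarrow> lin_ext tens (mons f) = f"
  unfolding mons_def lin_ext_comp
  by (subst (2) lin_ext_singles[of f, symmetric], erule lin_ext_cong_supported)
     (auto simp: lin_ext_single tens_map_mon cells_def)

lemma expand_chain: "z \<in> free_tensors A n \<Longrightarrow> z - mons (lin_ext tens z) \<in> tensor_relations A n"
proof -
  assume z: "z \<in> free_tensors A n"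
  have "lin_ext (\<lambda>xs. single xs 1 - lin_ext (\<lambda>l. single (map mon l) 1) (tens xs)) z \<in> tensor_relations A n"
    using z expand_tensor[of "[]" _ n]
    by (intro lin_ext_in_subspace[OF subspace_relations]) (auto simp: free_tensors_def)
  then show ?thesis by (simp add: lin_ext_diff_fun lin_ext_singles mons_def lin_ext_comp)
qed

text \<open>A chain agrees with its own expansion modulo the relations, so these are the whole
  kernel of the expansion. From here on homology is computed on monomial chains.\<close>

lemma relations_iff: "z \<in> free_tensors A n \<Longrightarrow> z \<in> tensor_relations A n \<longleftrightarrow> lin_ext tens z = 0"
  using expand_chain[of z n] tens_relations[of z n] by (auto simp: mons_def)

lemma cycles_iff:
  assumes "z \<in> free_tensors A n"
  shows "z \<in> hochschild_cycles A \<sigma> n \<longleftrightarrow> lin_ext bdry (lin_ext tens z) = 0"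
proof -
  have "hochschild_b A \<sigma> z \<in> free_tensors A (n - 1)"
    using assms hochschild_b_closed[of z "n - 1"] hochschild_b_0[of z]
    by (cases n) (auto simp: free_tensors_eq supported_zero)
  then show ?thesis
    using assms by (simp add: hochschild_cycles_def relations_iff tens_hochschild_b)
qed

lemma boundaries_iff:
  "z \<in> hochschild_boundaries A \<sigma> n \<longleftrightarrow>
     z \<in> free_tensors A n \<and> (\<exists>y\<in>supported (cells (Suc n)). lin_ext tens z = lin_ext bdry y)"
proof
  assume "z \<in> hochschild_boundaries A \<sigma> n"
  then obtain r y where z: "z = r + hochschild_b A \<sigma> y" "r \<in> tensor_relations A n" "y \<in> free_tensors A (Suc n)"
    by (auto simp: hochschild_boundaries_def)
  have "z \<in> free_tensors A n"
    using z relations_free[of n] hochschild_b_closed[OF z(3)] by (auto simp: free_tensors_eq intro: supported_add)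
  moreover have "lin_ext tens z = lin_ext bdry (lin_ext tens y)"
    using z by (simp add: lin_ext_add tens_relations tens_hochschild_b)
  ultimately show "z \<in> free_tensors A n \<and> (\<exists>y\<in>supported (cells (Suc n)). lin_ext tens z = lin_ext bdry y)"
    using tens_chain[OF z(3)] by blast
next
  assume "z \<in> free_tensors A n \<and> (\<exists>y\<in>supported (cells (Suc n)). lin_ext tens z = lin_ext bdry y)"
  then obtain y where z: "z \<in> free_tensors A n" and y: "y \<in> supported (cells (Suc n))" "lin_ext tens z = lin_ext bdry y"
    by blast
  let ?y = "mons y"
  have y': "?y \<in> free_tensors A (Suc n)" by (rule mons_free[OF y(1)])
  have "z - hochschild_b A \<sigma> ?y \<in> free_tensors A n"
    using z hochschild_b_closed[OF y'] by (auto simp: free_tensors_eq intro: supported_diff)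
  \<comment> \<open>Both terms have the same expansion because \<open>mons\<close> is a section of
    it.\<close>
  then have "z - hochschild_b A \<sigma> ?y \<in> tensor_relations A n"
    using y by (simp add: relations_iff lin_ext_diff tens_hochschild_b[OF y'] tens_mons)
  then show "z \<in> hochschild_boundaries A \<sigma> n"
    unfolding hochschild_boundaries_def using y'
    by (intro CollectI exI[of _ "z - hochschild_b A \<sigma> ?y"] exI[of _ ?y]) auto
qed

lemma subspace_boundaries: "free_vs.subspace (hochschild_boundaries A \<sigma> n)"
proof (rule free_vs.subspaceI)
  note sub = subspace_supported[of "tlists n", folded free_tensors_eq]
  show "0 \<in> hochschild_boundaries A \<sigma> n"
    using free_vs.subspace_0[OF sub] by (auto simp: boundaries_iff intro!: bexI[of _ 0] supported_zero)
  show "x + y \<in> hochschild_boundaries A \<sigma> n"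
    if "x \<in> hochschild_boundaries A \<sigma> n" "y \<in> hochschild_boundaries A \<sigma> n" for x y
    using that free_vs.subspace_add[OF sub]
    by (auto simp: boundaries_iff lin_ext_add intro!: bexI[of _ "_ + _"] supported_add)
  show "fscale c x \<in> hochschild_boundaries A \<sigma> n" if "x \<in> hochschild_boundaries A \<sigma> n" for c x
    using that free_vs.subspace_scale[OF sub]
    by (auto simp: boundaries_iff lin_ext_fscale intro!: bexI[of _ "fscale _ _"] supported_fscale)
qed

lemma HH_class_eq_iff: "HH_class A \<sigma> n z = HH_class A \<sigma> n w \<longleftrightarrow> z - w \<in> hochschild_boundaries A \<sigma> n"
proof
  note sub = subspace_boundaries[of n]
  assume "HH_class A \<sigma> n z = HH_class A \<sigma> n w"
  moreover have "z \<in> HH_class A \<sigma> n z"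
    using free_vs.subspace_0[OF sub] by (auto simp: HH_class_def intro!: exI[of _ 0])
  ultimately show "z - w \<in> hochschild_boundaries A \<sigma> n" by (auto simp: HH_class_def)
next
  note sub = subspace_boundaries[of n]
  assume *: "z - w \<in> hochschild_boundaries A \<sigma> n"
  have "\<exists>v. z + y = w + v \<and> v \<in> hochschild_boundaries A \<sigma> n" if "y \<in> hochschild_boundaries A \<sigma> n" for y
    using free_vs.subspace_add[OF sub * that] by (intro exI[of _ "z - w + y"]) simp
  moreover have "\<exists>v. w + y = z + v \<and> v \<in> hochschild_boundaries A \<sigma> n" if "y \<in> hochschild_boundaries A \<sigma> n" for y
    using free_vs.subspace_diff[OF sub that *] by (intro exI[of _ "y - (z - w)"]) simp
  ultimately show "HH_class A \<sigma> n z = HH_class A \<sigma> n w"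
    unfolding HH_class_def by blast
qed

end

section \<open>The monomial basis of the quantum hyperplane\<close>

lemma supported_induct [consumes 1, case_names zero single_add]:
  assumes "f \<in> supported S" "P 0"
    "\<And>x c g. x \<in> S \<Longrightarrow> g \<in> supported S \<Longrightarrow> P g \<Longrightarrow> P (single x c + g)"
  shows "P f"
proof -
  have "P (\<Sum>x\<in>K. single x (lookup f x))" if "finite K" "K \<subseteq> S" for K
    using that by (induction K) (auto intro!: assms supported_sum supported_single)
  from this[of "keys f"] show ?thesis
    using assms(1) lin_ext_singles[of f] unfolding lin_ext_def by (simp add: supported_def)
qed

lemma count_list_plus: "count_list (u @ v) = count_list u + count_list v"
  and count_list_Cons: "count_list (i # w) = unit_index i + count_list w"
  by (auto simp: fun_eq_iff unit_index_apply)

locale quantum_hyperplane = hyperplane_complex N q p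
  for N :: nat and q :: "nat \<Rightarrow> nat \<Rightarrow> complex" and p :: "nat \<Rightarrow> complex" +
  assumes params: "hyperplane_parameters N q"
begin

abbreviation "T \<equiv> tensor_algebra N"
abbreviation "I \<equiv> hyperplane_ideal N q"
abbreviation "A \<equiv> hyperplane N q"

definition words :: "nat list set" where
  "words = {w. set w \<subseteq> {1..N}}"

text \<open>The product of the tensor algebra as a double \<open>lin_ext\<close>, which makes
  bilinearity and associativity formal.\<close>

definition tmul :: "(nat list \<Rightarrow>\<^sub>0 complex) \<Rightarrow> (nat list \<Rightarrow>\<^sub>0 complex) \<Rightarrow> (nat list \<Rightarrow>\<^sub>0 complex)" where
  "tmul f g = lin_ext (\<lambda>u. lin_ext (\<lambda>v. single (u @ v) 1) g) f"

definition pmul :: "((nat \<Rightarrow> nat) \<Rightarrow>\<^sub>0 complex) \<Rightarrow> ((nat \<Rightarrow> nat) \<Rightarrow>\<^sub>0 complex) \<Rightarrow> ((nat \<Rightarrow> nat) \<Rightarrow>\<^sub>0 complex)" where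
  "pmul f g = lin_ext (\<lambda>\<alpha>. lin_ext (\<lambda>\<beta>. single (\<alpha> + \<beta>) (reorder_coeff N q \<alpha> \<beta>)) g) f"

lemma T_simps: "carrier T = supported words" "mult T = tmul" "one T = single [] 1" "zero T = 0"
  "add T = (+)" "smult T = fscale"
  by (auto simp: tensor_algebra_def supported_def words_def tmul_def lin_ext_def free_vs.scale_sum_right
      intro!: ext)

lemma tmul_assoc: "tmul (tmul f g) h = tmul f (tmul g h)"
  by (simp add: tmul_def lin_ext_comp lin_ext_single)

lemma tmul_linear:
  "tmul (f + g) h = tmul f h + tmul g h" "tmul h (f + g) = tmul h f + tmul h g"
  "tmul (f - g) h = tmul f h - tmul g h" "tmul h (f - g) = tmul h f - tmul h g"
  "tmul (fscale c f) h = fscale c (tmul f h)" "tmul h (fscale c f) = fscale c (tmul h f)"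
  by (simp_all add: tmul_def lin_ext_add lin_ext_add_fun lin_ext_diff lin_ext_diff_fun
      lin_ext_fscale lin_ext_fscale_fun)

lemma tmul_single [simp]: "tmul (single u a) (single v b) = single (u @ v) (a * b)"
  by (simp add: tmul_def lin_ext_single)

lemma tmul_unit: "tmul (single [] a) f = fscale a f" "tmul f (single [] a) = fscale a f"
  using lin_ext_fscale_fun[of a "\<lambda>u. single u 1" f]
  by (simp_all add: tmul_def lin_ext_single lin_ext_singles)

lemma tmul_closed: "f \<in> supported words \<Longrightarrow> g \<in> supported words \<Longrightarrow> tmul f g \<in> supported words"
  unfolding tmul_def
  by (erule lin_ext_supported, erule lin_ext_supported, rule supported_single) (simp add: words_def)

lemma one_words: "single [] c \<in> supported words"
  by (auto simp: words_def intro!: supported_single)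

lemma ring_T: "ring T"
proof (rule ringI)
  show "abelian_group T"
  proof (rule abelian_groupI)
    show "\<exists>y\<in>carrier T. y \<oplus>\<^bsub>T\<^esub> x = \<zero>\<^bsub>T\<^esub>" if "x \<in> carrier T" for x
      using that supported_diff[OF supported_zero, of x words]
      by (intro bexI[of _ "- x"]) (auto simp: T_simps)
  qed (auto simp: T_simps supported_add supported_zero add_ac)
  show "monoid T"
    by (rule monoidI) (auto simp: T_simps tmul_closed tmul_assoc tmul_unit one_words)
qed (auto simp: T_simps tmul_linear)

definition rels :: "(nat list \<Rightarrow>\<^sub>0 complex) set" where
  "rels = {single [i, j] 1 - single [j, i] (q i j) | i j. 1 \<le> i \<and> i < j \<and> j \<le> N}"

lemma rels_T: "rels \<subseteq> carrier T"
  by (auto simp: rels_def T_simps words_def intro!: supported_diff supported_single)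

lemma I_eq: "I = Idl\<^bsub>T\<^esub> rels"
  by (simp add: hyperplane_ideal_def rels_def)

lemma ideal_I: "ideal I T"
  unfolding I_eq by (rule ring.genideal_ideal[OF ring_T rels_T])

lemma I_sub: "I \<subseteq> supported words"
  using additive_subgroup.a_subset[OF ideal.axioms(1)[OF ideal_I]] by (simp add: T_simps)

lemma I_add: "f \<in> I \<Longrightarrow> g \<in> I \<Longrightarrow> f + g \<in> I"
  using additive_subgroup.a_closed[OF ideal.axioms(1)[OF ideal_I]] by (simp add: T_simps)

lemma I_mult: "f \<in> I \<Longrightarrow> g \<in> supported words \<Longrightarrow> tmul f g \<in> I"
  "f \<in> I \<Longrightarrow> g \<in> supported words \<Longrightarrow> tmul g f \<in> I"
  using ideal.I_l_closed[OF ideal_I] ideal.I_r_closed[OF ideal_I] by (simp_all add: T_simps)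

lemma I_zero: "0 \<in> I"
  using additive_subgroup.zero_closed[OF ideal.axioms(1)[OF ideal_I]] by (simp add: T_simps)

lemma subspace_I: "free_vs.subspace I"
proof (rule free_vs.subspaceI)
  show "fscale c f \<in> I" if "f \<in> I" for c f
    using I_mult(2)[OF that one_words[of c]] by (simp add: tmul_unit)
qed (auto intro: I_zero I_add)

lemmas I_diff = free_vs.subspace_diff[OF subspace_I] and I_fscale = free_vs.subspace_scale[OF subspace_I]

lemma q_inverse: "i \<in> {1..N} \<Longrightarrow> j \<in> {1..N} \<Longrightarrow> q i j * q j i = 1"
  and q_nonzero: "i \<in> {1..N} \<Longrightarrow> j \<in> {1..N} \<Longrightarrow> q i j \<noteq> 0"
  and q_diag: "i \<in> {1..N} \<Longrightarrow> q i i = 1"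
proof -
  show "i \<in> {1..N} \<Longrightarrow> j \<in> {1..N} \<Longrightarrow> q i j * q j i = 1"
    using params by (cases i j rule: linorder_cases) (auto simp: hyperplane_parameters_def)
qed (use params in \<open>auto simp: hyperplane_parameters_def\<close>)

text \<open>The coefficient of the sorted monomial to which a word is equivalent.\<close>

fun word_coeff :: "nat list \<Rightarrow> complex" where
  "word_coeff [] = 1"
| "word_coeff (i # w) = reorder_coeff N q (unit_index i) (count_list w) * word_coeff w"

lemma word_coeff_append: "word_coeff (u @ v) = word_coeff u * word_coeff v * reorder_coeff N q (count_list u) (count_list v)"
proof (induction u)
  case Nil
  have "count_list [] = (0 :: nat \<Rightarrow> nat)" by (auto simp: fun_eq_iff)
  then show ?case by (simp only: append_Nil word_coeff.simps(1) c_zero_left mult_1 mult_1_right)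
next
  case (Cons i u)
  then show ?case
    by (simp only: append_Cons word_coeff.simps count_list_Cons count_list_plus reorder_coeff_add_left reorder_coeff_add_right mult_ac)
qed

lemma reorder_coeff_unit_eq_1: "i \<in> {1..N} \<Longrightarrow> (\<And>j. j < i \<Longrightarrow> \<alpha> j = 0) \<Longrightarrow> reorder_coeff N q (unit_index i) \<alpha> = 1"
  by (auto simp: reorder_coeff_unit_left intro!: prod.neutral)

lemma reorder_coeff_unit_unit:
  assumes "i \<in> {1..N}" "j \<in> {1..N}"
  shows "reorder_coeff N q (unit_index j) (unit_index i) = (if i < j then q j i else 1)"
proof (cases "i < j")
  case True
  have "reorder_coeff N q (unit_index j) (unit_index i) = (\<Prod>k\<in>{1..<j}. if k = i then q j i else 1)"
    unfolding reorder_coeff_unit_left[OF assms(2)] by (intro prod.cong) (auto simp: unit_index_apply)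
  then show ?thesis using True assms by (simp add: prod.delta)
next
  case False
  then show ?thesis using assms by (auto simp: unit_index_apply intro!: reorder_coeff_unit_eq_1)
qed

lemma word_coeff_sorted: "sorted w \<Longrightarrow> w \<in> words \<Longrightarrow> word_coeff w = 1"
proof (induction w)
  case (Cons i w)
  have "count_list w j = 0" if "j < i" for j
    using Cons that by (subst count_list_0_iff) auto
  then show ?case using Cons by (auto simp: words_def intro!: reorder_coeff_unit_eq_1)
qed simp

text \<open>A multiplicative linear map onto the twisted monoid algebra. Since it kills the defining
  relations, it shows that sorted monomials stay independent in the quotient, without a confluence
  argument for rewriting.\<close>

definition normal_form :: "(nat list \<Rightarrow>\<^sub>0 complex) \<Rightarrow> ((nat \<Rightarrow> nat) \<Rightarrow>\<^sub>0 complex)" where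
  "normal_form = lin_ext (\<lambda>w. single (count_list w) (word_coeff w))"

lemma normal_form_single: "normal_form (single w c) = single (count_list w) (c * word_coeff w)"
  by (simp add: normal_form_def lin_ext_single)

lemma normal_form_tmul: "normal_form (tmul f g) = pmul (normal_form f) (normal_form g)"
proof -
  have "normal_form (tmul f g) = lin_ext (\<lambda>u. fscale (word_coeff u) (lin_ext (\<lambda>v. fscale (word_coeff v)
      (single (count_list u + count_list v) (reorder_coeff N q (count_list u) (count_list v)))) g)) f"
    by (simp add: normal_form_def tmul_def lin_ext_comp lin_ext_single word_coeff_append count_list_plus
        lin_ext_fscale_fun[symmetric] mult.assoc)
  also have "\<dots> = pmul (normal_form f) (normal_form g)"
    unfolding pmul_def normal_form_def lin_ext_comp lin_ext_single ..
  finally show ?thesis .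
qed

lemma count_list_words: "w \<in> words \<Longrightarrow> count_list w \<in> M"
  using count_list_0_iff by (fastforce simp: words_def multiindices_def)

lemma normal_form_supported: "f \<in> supported words \<Longrightarrow> normal_form f \<in> supported M"
  unfolding normal_form_def by (erule lin_ext_supported, rule supported_single) (rule count_list_words)

lemma normal_form_linear: "normal_form (f + g) = normal_form f + normal_form g" "normal_form (f - g) = normal_form f - normal_form g" "normal_form (fscale c f) = fscale c (normal_form f)"
  "normal_form 0 = 0"
  by (simp_all add: normal_form_def lin_ext_add lin_ext_diff lin_ext_fscale)

lemma pmul_zero [simp]: "pmul 0 f = 0" "pmul f 0 = 0"
  by (simp_all add: pmul_def)

lemma normal_form_rels: "r \<in> rels \<Longrightarrow> normal_form r = 0"
proof -
  assume "r \<in> rels"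
  then obtain i j where r: "r = single [i, j] 1 - single [j, i] (q i j)" and ij: "i \<in> {1..N}" "j \<in> {1..N}" "i < j"
    by (auto simp: rels_def)
  have cl: "count_list [k] = unit_index k" "count_list [] = (0 :: nat \<Rightarrow> nat)" for k
    by (auto simp: fun_eq_iff unit_index_apply)
  have "word_coeff [i, j] = 1" "word_coeff [j, i] = q j i"
    using ij by (simp_all add: cl reorder_coeff_unit_unit del: count_list.simps)
  moreover have "count_list [i, j] = count_list [j, i]" by auto
  ultimately show ?thesis using q_inverse[OF ij(1,2)] by (simp add: r normal_form_linear normal_form_single del: count_list.simps word_coeff.simps)
qed

text \<open>The kernel of a multiplicative linear map is an ideal, and it contains the generating
  relations.\<close>

lemma nf_I: "f \<in> I \<Longrightarrow> normal_form f = 0"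
proof -
  let ?K = "{f \<in> supported words. normal_form f = 0}"
  have "ideal ?K T"
  proof (rule idealI[OF ring_T])
    have inv: "inv\<^bsub>add_monoid T\<^esub> f = - f" if "f \<in> supported words" for f
      using that abelian_group.minus_equality[OF ring.is_abelian_group[OF ring_T], of "- f" f]
        supported_diff[OF supported_zero, of f words]
      by (simp add: T_simps a_inv_def)
    show "subgroup ?K (add_monoid T)"
    proof
      show "inv\<^bsub>add_monoid T\<^esub> f \<in> ?K" if "f \<in> ?K" for f
        using that supported_diff[OF supported_zero, of f words] normal_form_linear(2)[of 0 f] by (simp add: inv normal_form_linear)
    qed (auto simp: T_simps normal_form_linear supported_add supported_zero)
  qed (auto simp: T_simps tmul_closed normal_form_tmul)
  then have "I \<subseteq> ?K"
    unfolding I_eq using rels_T normal_form_rels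
    by (intro ring.genideal_minimal[OF ring_T]) (auto simp: T_simps)
  then show "f \<in> I \<Longrightarrow> normal_form f = 0" by auto
qed

lemma swap_I:
  assumes "i \<in> {1..N}" "j \<in> {1..N}" "i \<noteq> j"
  shows "single [i, j] 1 - single [j, i] (q i j) \<in> I"
proof -
  have r: "rels \<subseteq> I" unfolding I_eq by (rule ring.genideal_self[OF ring_T rels_T])
  show ?thesis
  proof (cases "i < j")
    case True
    then show ?thesis using assms r by (auto simp: rels_def)
  next
    case False
    then have "single [j, i] 1 - single [i, j] (q j i) \<in> rels"
      unfolding rels_def using assms by (intro CollectI exI[of _ j] exI[of _ i]) auto
    then have "single [j, i] 1 - single [i, j] (q j i) \<in> I" using r by blast
    \<comment> \<open>Since q_ij q_ji = 1, the factor -q_ij turns the relation for (j, i) into the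
      one for (i, j).\<close>
    then have "fscale (- q i j) (single [j, i] 1 - single [i, j] (q j i)) \<in> I" by (rule I_fscale)
    moreover have "fscale (- q i j) (single [j, i] 1 - single [i, j] (q j i)) = single [i, j] 1 - single [j, i] (q i j)"
      using q_inverse[OF assms(1,2)] by (simp add: fscale_diff_right single_uminus)
    ultimately show ?thesis by simp
  qed
qed

lemma single_words: "w \<in> words \<Longrightarrow> single w c \<in> supported words"
  by (rule supported_single)

text \<open>One insertion step of insertion sort, read modulo the ideal. The coefficient is left
  open; it is recovered later.\<close>

lemma insort_I:
  "i \<in> {1..N} \<Longrightarrow> v \<in> words \<Longrightarrow> \<exists>c. single (i # v) 1 - single (insort i v) c \<in> I"
proof (induction v)
  case Nil
  then show ?case by (auto intro!: exI[of _ 1] I_zero)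
next
  case (Cons j v)
  have j: "j \<in> {1..N}" "v \<in> words" using Cons by (auto simp: words_def)
  show ?case
  proof (cases "i \<le> j")
    case True
    then show ?thesis by (auto intro!: exI[of _ 1] I_zero)
  next
    case False
    obtain c where c: "single (i # v) 1 - single (insort i v) c \<in> I" using Cons j by auto
    have "tmul (single [i, j] 1 - single [j, i] (q i j)) (single v 1) \<in> I"
      using j Cons False by (intro I_mult swap_I single_words) auto
    moreover have "fscale (q i j) (tmul (single [j] 1) (single (i # v) 1 - single (insort i v) c)) \<in> I"
      using j by (intro I_fscale I_mult c single_words) (auto simp: words_def)
    ultimately have "tmul (single [i, j] 1 - single [j, i] (q i j)) (single v 1) +
       fscale (q i j) (tmul (single [j] 1) (single (i # v) 1 - single (insort i v) c)) \<in> I" by (rule I_add)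
    then show ?thesis using False
      by (intro exI[of _ "q i j * c"]) (simp add: tmul_linear fscale_diff_right)
  qed
qed

lemma sort_I: "w \<in> words \<Longrightarrow> \<exists>c. single w 1 - single (sort w) c \<in> I"
proof (induction w)
  case Nil
  then show ?case by (auto intro!: exI[of _ 1] I_zero)
next
  case (Cons i w)
  have i: "i \<in> {1..N}" "w \<in> words" using Cons by (auto simp: words_def)
  obtain c where c: "single w 1 - single (sort w) c \<in> I" using Cons i by auto
  obtain d where d: "single (i # sort w) 1 - single (insort i (sort w)) d \<in> I"
    using insort_I[of i "sort w"] i by (auto simp: words_def)
  have "tmul (single [i] 1) (single w 1 - single (sort w) c) \<in> I"
    using i by (intro I_mult c single_words) (auto simp: words_def)
  from I_add[OF this I_fscale[OF d, of c]] show ?case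
    by (intro exI[of _ "c * d"]) (simp add: tmul_linear fscale_diff_right)
qed

lemma nword_words: "nword N \<alpha> \<in> words"
  by (auto simp: words_def set_nword)

lemma word_coeff_nword [simp]: "word_coeff (nword N \<alpha>) = 1"
  by (rule word_coeff_sorted[OF sorted_nword nword_words])

lemma count_list_nword: "\<alpha> \<in> M \<Longrightarrow> count_list (nword N \<alpha>) = \<alpha>"
  by (auto simp: fun_eq_iff count_nword multiindices_def)

text \<open>Sorting yields some coefficient, and applying \<open>normal_form\<close> to the
  congruence identifies it as \<open>word_coeff w\<close>.\<close>

lemma word_I:
  assumes "w \<in> words"
  shows "single w 1 - single (nword N (count_list w)) (word_coeff w) \<in> I"
proof -
  have "nword N (count_list w) = sort w"
    using assms by (intro nword_eqI) (auto simp: words_def simp flip: count_mset)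
  then obtain c where c: "single w 1 - single (nword N (count_list w)) c \<in> I"
    using sort_I[OF assms] by auto
  have "normal_form (single w 1 - single (nword N (count_list w)) c) = 0" by (rule nf_I[OF c])
  then have "single (count_list w) (word_coeff w) = single (count_list w) c"
    using count_list_words[OF assms] by (simp add: normal_form_linear normal_form_single count_list_nword)
  then have "c = word_coeff w" by (metis lookup_single_eq)
  then show ?thesis using c by simp
qed

definition lift :: "((nat \<Rightarrow> nat) \<Rightarrow>\<^sub>0 complex) \<Rightarrow> (nat list \<Rightarrow>\<^sub>0 complex)" where
  "lift = lin_ext (\<lambda>\<alpha>. single (nword N \<alpha>) 1)"

lemma lift_words: "lift f \<in> supported words"
  unfolding lift_def
  by (rule lin_ext_in_subspace[OF subspace_supported]) (simp add: supported_single nword_words)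

lemma normal_form_lift: "f \<in> supported M \<Longrightarrow> normal_form (lift f) = f"
  unfolding normal_form_def lift_def lin_ext_comp
  by (subst (2) lin_ext_singles[of f, symmetric], erule lin_ext_cong_supported)
     (simp add: lin_ext_single count_list_nword)

lemma lift_nf_I: "f \<in> supported words \<Longrightarrow> f - lift (normal_form f) \<in> I"
proof -
  assume f: "f \<in> supported words"
  have "lin_ext (\<lambda>w. single w 1 - single (nword N (count_list w)) (word_coeff w)) f \<in> I"
    using f by (intro lin_ext_in_subspace[OF subspace_I] word_I) (auto simp: supported_def)
  then show ?thesis by (simp add: lin_ext_diff_fun lin_ext_singles lift_def normal_form_def lin_ext_comp lin_ext_single)
qed

lemma I_iff: "f \<in> supported words \<Longrightarrow> f \<in> I \<longleftrightarrow> normal_form f = 0"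
  using lift_nf_I[of f] nf_I[of f] by (auto simp: lift_def)

section \<open>Cosets and their coordinates\<close>

definition cls :: "(nat list \<Rightarrow>\<^sub>0 complex) \<Rightarrow> (nat list \<Rightarrow>\<^sub>0 complex) set" where
  "cls f = I +>\<^bsub>T\<^esub> f"

lemma cls_eq: "cls f = {h + f | h. h \<in> I}"
  by (auto simp: cls_def a_r_coset_def' T_simps)

lemma cls_eq_iff:
  assumes "f \<in> supported words" "g \<in> supported words"
  shows "cls f = cls g \<longleftrightarrow> normal_form f = normal_form g"
proof
  assume "cls f = cls g"
  moreover have "f \<in> cls f" using I_zero by (auto simp: cls_eq)
  ultimately obtain h where "h \<in> I" "f = h + g" by (auto simp: cls_eq)
  then show "normal_form f = normal_form g" by (simp add: normal_form_linear nf_I)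
next
  assume "normal_form f = normal_form g"
  then have *: "f - g \<in> I" using assms by (simp add: I_iff supported_diff normal_form_linear)
  show "cls f = cls g"
  proof (intro equalityI subsetI)
    fix z assume "z \<in> cls f"
    then obtain h where "h \<in> I" "z = h + f" by (auto simp: cls_eq)
    then show "z \<in> cls g" using I_add[OF _ *, of h] by (auto simp: cls_eq intro!: exI[of _ "h + (f - g)"])
  next
    fix z assume "z \<in> cls g"
    then obtain h where "h \<in> I" "z = h + g" by (auto simp: cls_eq)
    then show "z \<in> cls f" using I_diff[OF _ *, of h] by (auto simp: cls_eq intro!: exI[of _ "h - (f - g)"])
  qed
qed

lemma A_carrier: "carrier A = cls ` supported words"
  by (auto simp: hyperplane_def quotient_algebra_def ring.defs FactRing_def A_RCOSETS_def' cls_def T_simps)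

lemma cls_carrier: "f \<in> supported words \<Longrightarrow> cls f \<in> carrier A"
  by (simp add: A_carrier)

lemma A_one: "one A = cls (single [] 1)"
  by (simp add: hyperplane_def quotient_algebra_def ring.defs FactRing_def cls_def T_simps)

lemma A_mult: "f \<in> supported words \<Longrightarrow> g \<in> supported words \<Longrightarrow> cls f \<otimes>\<^bsub>A\<^esub> cls g = cls (tmul f g)"
  using ideal.rcoset_mult_add[OF ideal_I, of f g]
  by (simp add: hyperplane_def quotient_algebra_def ring.defs FactRing_def cls_def T_simps)

lemma A_add: "f \<in> supported words \<Longrightarrow> g \<in> supported words \<Longrightarrow> cls f \<oplus>\<^bsub>A\<^esub> cls g = cls (f + g)"
  using abelian_subgroup.a_rcos_sum[OF abelian_subgroupI3[OF ideal.axioms(1)[OF ideal_I]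
      ring.is_abelian_group[OF ring_T]], of f g]
  by (simp add: hyperplane_def quotient_algebra_def ring.defs FactRing_def cls_def T_simps)

text \<open>The scalar multiple is defined as a union over all representatives; each of them yields
  the same coset because the ideal is a subspace.\<close>

lemma A_smult: "f \<in> supported words \<Longrightarrow> c \<odot>\<^bsub>A\<^esub> cls f = cls (fscale c f)"
proof -
  assume f: "f \<in> supported words"
  have "cls (fscale c g) = cls (fscale c f)" if g: "g \<in> cls f" for g
  proof -
    obtain h where h: "h \<in> I" "g = h + f" using g by (auto simp: cls_eq)
    then show ?thesis using f I_sub
      by (subst cls_eq_iff) (auto simp: normal_form_linear nf_I intro!: supported_fscale supported_add)
  qed
  then have "(\<Union>a\<in>cls f. cls (fscale c a)) = (\<Union>a\<in>cls f. cls (fscale c f))"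
    by (intro SUP_cong refl)
  moreover have "f \<in> cls f" using I_zero by (auto simp: cls_eq)
  then have "(\<Union>a\<in>cls f. cls (fscale c f)) = cls (fscale c f)" by blast
  moreover have "c \<odot>\<^bsub>A\<^esub> X = (\<Union>a\<in>X. cls (fscale c a))" for X
    by (simp add: hyperplane_def quotient_algebra_def ring.defs module.defs cls_def T_simps)
  ultimately show ?thesis by (simp only:)
qed

text \<open>Any representative serves, because \<open>normal_form\<close> vanishes on the
  ideal.\<close>

definition coords :: "(nat list \<Rightarrow>\<^sub>0 complex) set \<Rightarrow> ((nat \<Rightarrow> nat) \<Rightarrow>\<^sub>0 complex)" where
  "coords X = normal_form (SOME f. f \<in> X)"

lemma coords_cls: "f \<in> supported words \<Longrightarrow> coords (cls f) = normal_form f"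
proof -
  assume "f \<in> supported words"
  have "f \<in> cls f" using I_zero by (auto simp: cls_eq)
  then have "(SOME g. g \<in> cls f) \<in> cls f" by (rule someI)
  then obtain h where "h \<in> I" "(SOME g. g \<in> cls f) = h + f" by (auto simp: cls_eq)
  then show ?thesis by (simp add: coords_def normal_form_linear nf_I)
qed

lemma coords_bij: "bij_betw coords (carrier A) (supported M)"
proof (rule bij_betw_imageI)
  show "inj_on coords (carrier A)"
    by (auto simp: A_carrier inj_on_def coords_cls cls_eq_iff)
  have "f \<in> coords ` carrier A" if "f \<in> supported M" for f
    using that lift_words[of f] normal_form_lift[OF that]
    by (auto simp: A_carrier image_image image_iff coords_cls intro!: bexI[of _ "lift f"])
  then show "coords ` carrier A = supported M"
    by (auto simp: A_carrier coords_cls normal_form_supported)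
qed

lemma coords_inj: "a \<in> carrier A \<Longrightarrow> b \<in> carrier A \<Longrightarrow> coords a = coords b \<Longrightarrow> a = b"
  using coords_bij by (auto simp: bij_betw_def inj_on_def)

lemma A_closed:
  assumes "a \<in> carrier A" "b \<in> carrier A"
  shows A_add_closed: "a \<oplus>\<^bsub>A\<^esub> b \<in> carrier A" and coords_add: "coords (a \<oplus>\<^bsub>A\<^esub> b) = coords a + coords b"
    and A_mult_closed: "a \<otimes>\<^bsub>A\<^esub> b \<in> carrier A" and coords_mult: "coords (a \<otimes>\<^bsub>A\<^esub> b) = pmul (coords a) (coords b)"
    and A_smult_closed: "c \<odot>\<^bsub>A\<^esub> a \<in> carrier A" and coords_smult: "coords (c \<odot>\<^bsub>A\<^esub> a) = fscale c (coords a)"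
proof -
  obtain f g where fg: "a = cls f" "b = cls g" "f \<in> supported words" "g \<in> supported words"
    using assms by (auto simp: A_carrier)
  show "a \<oplus>\<^bsub>A\<^esub> b \<in> carrier A" "coords (a \<oplus>\<^bsub>A\<^esub> b) = coords a + coords b"
    "a \<otimes>\<^bsub>A\<^esub> b \<in> carrier A" "coords (a \<otimes>\<^bsub>A\<^esub> b) = pmul (coords a) (coords b)"
    "c \<odot>\<^bsub>A\<^esub> a \<in> carrier A" "coords (c \<odot>\<^bsub>A\<^esub> a) = fscale c (coords a)"
    unfolding fg(1,2) using fg(3,4)
    by (simp_all add: A_add A_mult A_smult cls_carrier coords_cls normal_form_linear normal_form_tmul supported_add supported_fscale tmul_closed)
qed

lemma word_class_eq: "word_class N q w = cls (single w 1)"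
  by (simp add: word_class_def cls_def)

lemma word_class_carrier: "w \<in> words \<Longrightarrow> word_class N q w \<in> carrier A"
  by (auto simp: word_class_eq A_carrier single_words)

lemma coords_word_class: "w \<in> words \<Longrightarrow> coords (word_class N q w) = single (count_list w) (word_coeff w)"
  by (simp add: word_class_eq coords_cls single_words normal_form_single)

lemma monomial_carrier: "hyperplane_monomial N q \<alpha> \<in> carrier A"
  unfolding hyperplane_monomial_def nword_def[symmetric] by (rule word_class_carrier[OF nword_words])

lemma coords_monomial: "\<alpha> \<in> M \<Longrightarrow> coords (hyperplane_monomial N q \<alpha>) = single \<alpha> 1"
  unfolding hyperplane_monomial_def nword_def[symmetric]
  by (simp add: coords_word_class[OF nword_words] count_list_nword)

lemma gen_carrier: "i \<in> {1..N} \<Longrightarrow> hyperplane_gen N q i \<in> carrier A"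
  unfolding hyperplane_gen_def by (rule word_class_carrier) (simp add: words_def)

lemma coords_gen: "i \<in> {1..N} \<Longrightarrow> coords (hyperplane_gen N q i) = single (unit_index i) 1"
proof -
  assume "i \<in> {1..N}"
  moreover have "count_list [] = (0 :: nat \<Rightarrow> nat)" "count_list [i] = unit_index i"
    by (auto simp: fun_eq_iff unit_index_apply)
  ultimately show ?thesis
    unfolding hyperplane_gen_def by (subst coords_word_class) (auto simp: words_def simp del: count_list.simps)
qed

section \<open>Scaling automorphisms\<close>

definition rescale :: "((nat \<Rightarrow> nat) \<Rightarrow>\<^sub>0 complex) \<Rightarrow> ((nat \<Rightarrow> nat) \<Rightarrow>\<^sub>0 complex)" where
  "rescale = lin_ext (\<lambda>\<alpha>. single \<alpha> (weight N p \<alpha>))"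

lemma rescale_linear: "rescale (f + g) = rescale f + rescale g" "rescale (fscale c f) = fscale c (rescale f)" "rescale 0 = 0"
  by (simp_all add: rescale_def lin_ext_add lin_ext_fscale)

lemma rescale_single: "rescale (single \<alpha> c) = single \<alpha> (c * weight N p \<alpha>)"
  by (simp add: rescale_def lin_ext_single)

lemma rescale_supported: "f \<in> supported M \<Longrightarrow> rescale f \<in> supported M"
  unfolding rescale_def by (erule lin_ext_supported) (rule supported_single)

lemma rescale_pmul: "rescale (pmul f g) = pmul (rescale f) (rescale g)"
  by (simp add: rescale_def pmul_def lin_ext_comp lin_ext_single chi_add lin_ext_fscale_fun[symmetric] mult_ac)

lemma lookup_scl: "lookup (rescale f) \<alpha> = weight N p \<alpha> * lookup f \<alpha>"
proof -
  have "lookup (rescale f) \<alpha> = (\<Sum>x\<in>keys f. if x = \<alpha> then lookup f \<alpha> * weight N p \<alpha> else 0)"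
    unfolding rescale_def lookup_lin_ext by (intro sum.cong) (auto simp: lookup_single)
  then show ?thesis by (auto simp: sum.delta in_keys_iff)
qed

lemma weight_unit: "i \<in> {1..N} \<Longrightarrow> weight N p (unit_index i) = p i"
  unfolding weight_def by (subst prod.remove[of _ i]) (auto simp: unit_index_apply intro!: prod.neutral)

lemma count_list_Nil: "count_list [] = (0 :: nat \<Rightarrow> nat)"
  by (auto simp: fun_eq_iff)

text \<open>The generators determine the automorphism: multiplicativity extends the formula to
  words, linearity to all elements.\<close>

lemma scaling_automorphism_crd:
  assumes \<sigma>: "scaling_automorphism N q p \<sigma>" and "a \<in> carrier A"
  shows "\<sigma> a \<in> carrier A" and "coords (\<sigma> a) = rescale (coords a)"
proof -
  have iso: "\<sigma> \<in> ring_hom A A" and lin: "\<And>c a. a \<in> carrier A \<Longrightarrow> \<sigma> (c \<odot>\<^bsub>A\<^esub> a) = c \<odot>\<^bsub>A\<^esub> \<sigma> a"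
    and gen: "\<And>i. i \<in> {1..N} \<Longrightarrow> \<sigma> (hyperplane_gen N q i) = p i \<odot>\<^bsub>A\<^esub> hyperplane_gen N q i"
    using \<sigma> by (auto simp: scaling_automorphism_def algebra_automorphism_def ring_iso_def)
  have cl: "\<sigma> a \<in> carrier A" if "a \<in> carrier A" for a using ring_hom_closed[OF iso that] .
  then show "\<sigma> a \<in> carrier A" using assms by blast
  have one_A: "one A = word_class N q []" by (simp add: A_one word_class_eq)
  have word: "coords (\<sigma> (word_class N q w)) = rescale (coords (word_class N q w))" if "w \<in> words" for w
    using that
  proof (induction w)
    case Nil
    have "\<sigma> (word_class N q []) = word_class N q []" using ring_hom_one[OF iso] by (simp add: one_A)
    moreover have "coords (word_class N q []) = single 0 1"
      using coords_word_class[OF Nil] by (simp add: count_list_Nil)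
    ultimately show ?case by (simp add: rescale_single del: single_one)
  next
    case (Cons i w)
    have i: "i \<in> {1..N}" "w \<in> words" using Cons by (auto simp: words_def)
    have iw: "word_class N q (i # w) = hyperplane_gen N q i \<otimes>\<^bsub>A\<^esub> word_class N q w"
      using i A_mult[OF single_words[of "[i]" 1] single_words[OF i(2), of 1]]
      by (simp add: hyperplane_gen_def word_class_eq) (simp add: words_def)
    have "coords (\<sigma> (word_class N q (i # w))) = pmul (coords (\<sigma> (hyperplane_gen N q i))) (coords (\<sigma> (word_class N q w)))"
      using i by (simp add: iw ring_hom_mult[OF iso] gen_carrier word_class_carrier coords_mult cl)
    also have "coords (\<sigma> (hyperplane_gen N q i)) = rescale (coords (hyperplane_gen N q i))"
      using gen_carrier[of i] i by (simp add: gen coords_smult coords_gen rescale_single weight_unit del: One_nat_def)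
    finally show ?case
      using i Cons.IH by (simp add: iw coords_mult gen_carrier word_class_carrier rescale_pmul)
  qed
  obtain f where f: "a = cls f" "f \<in> supported words" using assms(2) by (auto simp: A_carrier)
  have "coords (\<sigma> (cls f)) = rescale (coords (cls f))" using f(2)
  proof (induction rule: supported_induct)
    case zero
    have 0: "cls 0 \<in> carrier A" by (auto simp: A_carrier supported_zero)
    \<comment> \<open>That 0 goes to 0 is read off from compatibility with the scalar 0.\<close>
    have "cls 0 = 0 \<odot>\<^bsub>A\<^esub> cls 0" by (simp add: A_smult supported_zero)
    then have "\<sigma> (cls 0) = 0 \<odot>\<^bsub>A\<^esub> \<sigma> (cls 0)" using lin[OF 0, of 0] by simp
    then have "coords (\<sigma> (cls 0)) = 0" using coords_smult[OF cl[OF 0] cl[OF 0], of 0] by simp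
    then show ?case by (simp add: coords_cls supported_zero normal_form_linear rescale_linear)
  next
    case (single_add w c g)
    have g: "cls g \<in> carrier A" and w: "word_class N q w \<in> carrier A"
      using single_add by (auto simp: A_carrier word_class_eq single_words)
    have "single w c = fscale c (single w 1)" by simp
    then have "cls (single w c + g) = (c \<odot>\<^bsub>A\<^esub> word_class N q w) \<oplus>\<^bsub>A\<^esub> cls g"
      using single_add by (simp add: A_add A_smult word_class_eq single_words)
    then show ?case using g w single_add
      by (simp add: ring_hom_add[OF iso] lin coords_add coords_smult cl A_smult_closed word rescale_linear)
  qed
  then show "coords (\<sigma> a) = rescale (coords a)" using f by simp
qed

text \<open>Rescaling the coordinates is multiplicative because the weight is a character, and
  bijective because no weight is 0.\<close>

lemma scaling_automorphism_exists:
  assumes "\<And>i. i \<in> {1..N} \<Longrightarrow> p i \<noteq> 0"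
  shows "\<exists>\<sigma>. scaling_automorphism N q p \<sigma>"
proof -
  define \<sigma> where "\<sigma> a = inv_into (carrier A) coords (rescale (coords a))" for a
  have cs: "coords a \<in> supported M" if "a \<in> carrier A" for a using that coords_bij by (auto simp: bij_betw_def)
  have cl: "\<sigma> a \<in> carrier A" and cr: "coords (\<sigma> a) = rescale (coords a)" if "a \<in> carrier A" for a
  proof -
    have "rescale (coords a) \<in> coords ` carrier A" using rescale_supported[OF cs[OF that]] coords_bij by (auto simp: bij_betw_def)
    then show "\<sigma> a \<in> carrier A" "coords (\<sigma> a) = rescale (coords a)"
      unfolding \<sigma>_def by (auto simp: inv_into_into f_inv_into_f)
  qed
  have nz: "weight N p \<alpha> \<noteq> 0" for \<alpha> using assms by (auto simp: weight_def)
  have one: "one A \<in> carrier A" "coords (one A) = single 0 1"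
    using coords_word_class[of "[]"] word_class_carrier[of "[]"]
    by (simp_all add: A_one word_class_eq words_def count_list_Nil)
  have hom: "\<sigma> \<in> ring_hom A A"
  proof (rule ring_hom_memI)
    show "\<sigma> a \<in> carrier A" if "a \<in> carrier A" for a by (rule cl[OF that])
    show "\<sigma> (a \<otimes>\<^bsub>A\<^esub> b) = \<sigma> a \<otimes>\<^bsub>A\<^esub> \<sigma> b" if "a \<in> carrier A" "b \<in> carrier A" for a b
      using that by (intro coords_inj) (simp_all add: cl cr A_mult_closed coords_mult rescale_pmul)
    show "\<sigma> (a \<oplus>\<^bsub>A\<^esub> b) = \<sigma> a \<oplus>\<^bsub>A\<^esub> \<sigma> b" if "a \<in> carrier A" "b \<in> carrier A" for a b
      using that by (intro coords_inj) (simp_all add: cl cr A_add_closed coords_add rescale_linear)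
    show "\<sigma> \<one>\<^bsub>A\<^esub> = \<one>\<^bsub>A\<^esub>"
      by (intro coords_inj) (simp_all add: cl cr one rescale_single del: single_one)
  qed
  have inj: "inj_on \<sigma> (carrier A)"
  proof (rule inj_onI)
    fix a b assume ab: "a \<in> carrier A" "b \<in> carrier A" "\<sigma> a = \<sigma> b"
    then have "rescale (coords a) = rescale (coords b)" by (metis cr)
    then have "lookup (coords a) \<alpha> = lookup (coords b) \<alpha>" for \<alpha> using lookup_scl nz by (metis mult_left_cancel)
    then show "a = b" using ab by (intro coords_inj poly_mapping_eqI)
  qed
  have surj: "b \<in> \<sigma> ` carrier A" if b: "b \<in> carrier A" for b
  proof -
    let ?f = "lin_ext (\<lambda>\<alpha>. single \<alpha> (inverse (weight N p \<alpha>))) (coords b)"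
    have "?f \<in> supported M" by (rule lin_ext_supported[OF cs[OF b]]) (rule supported_single)
    then have "?f \<in> coords ` carrier A" by (simp only: bij_betw_imp_surj_on[OF coords_bij])
    then obtain a where a: "?f = coords a" "a \<in> carrier A" by (rule imageE)
    have "rescale ?f = coords b"
      unfolding rescale_def lin_ext_comp by (simp add: lin_ext_single nz lin_ext_singles)
    then have "rescale (coords a) = coords b" using a(1) by simp
    then have "\<sigma> a = b" using a(2) b by (intro coords_inj) (simp_all add: cl cr)
    then show ?thesis using a by auto
  qed
  have "\<sigma> \<in> ring_iso A A"
    using hom inj surj cl by (auto simp: ring_iso_def bij_betw_def)
  moreover have "\<sigma> (c \<odot>\<^bsub>A\<^esub> a) = c \<odot>\<^bsub>A\<^esub> \<sigma> a" if "a \<in> carrier A" for c a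
    using that by (intro coords_inj) (auto simp: cl cr A_smult_closed coords_smult rescale_linear)
  moreover have "\<sigma> (hyperplane_gen N q i) = p i \<odot>\<^bsub>A\<^esub> hyperplane_gen N q i" if "i \<in> {1..N}" for i
    using that gen_carrier[OF that]
    by (intro coords_inj) (auto simp: cl cr A_smult_closed coords_smult coords_gen rescale_single weight_unit simp del: One_nat_def)
  ultimately have "scaling_automorphism N q p \<sigma>"
    using assms by (auto simp: scaling_automorphism_def algebra_automorphism_def)
  then show ?thesis by blast
qed

lemma monomial_basis:
  assumes "scaling_automorphism N q p \<sigma>"
  shows "monomial_basis N q p A \<sigma> coords"
  by unfold_locales
     (auto simp: coords_bij A_closed pmul_def[symmetric] rescale_def[symmetric] scaling_automorphism_crd[OF assms])

end

section \<open>The top Koszul classes\<close>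

context quantum_hyperplane
begin

abbreviation "units w \<equiv> map unit_index w"
abbreviation "perms S \<equiv> permutations_of_set (S :: nat set)"

definition inv_factor :: "nat \<Rightarrow> nat \<Rightarrow> complex" where
  "inv_factor x y = (if y < x then - q y x else 1)"

fun inv_coeff :: "nat list \<Rightarrow> complex" where
  "inv_coeff [] = 1"
| "inv_coeff (x # w) = (\<Prod>y\<leftarrow>w. inv_factor x y) * inv_coeff w"

text \<open>Pairs of positions are separated into those that begin at position 0 and those inside
  the tail, which gives the recursion.\<close>

lemma arrangement_coeff_eq: "arrangement_coeff q w = inv_coeff w"
proof -
  define P where "P n = {(a, b). a < b \<and> b < (n :: nat)}" for n
  have fin: "finite (P n)" for n by (rule finite_subset[of _ "{..<n} \<times> {..<n}"]) (auto simp: P_def)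
  have "(\<Prod>(a, b)\<in>P (length w). inv_factor (w ! a) (w ! b)) = inv_coeff w"
  proof (induction w)
    case Nil
    then show ?case by (simp add: P_def)
  next
    case (Cons x w)
    let ?f = "\<lambda>(a, b). inv_factor ((x # w) ! a) ((x # w) ! b)"
    have P: "P (Suc (length w)) = (\<lambda>b. (0, Suc b)) ` {..<length w} \<union> map_prod Suc Suc ` P (length w)"
      (is "_ = ?U \<union> ?V")
    proof (intro equalityI subsetI)
      fix z assume "z \<in> P (Suc (length w))"
      then obtain a b where z: "z = (a, b)" "a < b" "b < Suc (length w)" by (auto simp: P_def)
      then obtain b' where b': "b = Suc b'" by (cases b) auto
      show "z \<in> ?U \<union> ?V" using z b' by (cases a) (auto simp: P_def image_iff)
    qed (auto simp: P_def)
    have "prod ?f (P (Suc (length w))) = prod ?f ?U * prod ?f ?V"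
      unfolding P using fin by (intro prod.union_disjoint) auto
    also have "prod ?f ?U = (\<Prod>b<length w. inv_factor x (w ! b))"
      by (subst prod.reindex) (auto intro: inj_onI)
    also have "\<dots> = (\<Prod>y\<leftarrow>w. inv_factor x y)"
      by (simp add: prod.list_conv_set_nth atLeast0LessThan)
    also have "prod ?f ?V = (\<Prod>(a, b)\<in>P (length w). inv_factor (w ! a) (w ! b))"
      by (subst prod.reindex) (auto intro!: inj_onI prod.cong)
    finally show ?case using Cons by simp
  qed
  moreover have "arrangement_coeff q w = (\<Prod>(a, b)\<in>P (length w). inv_factor (w ! a) (w ! b))"
    unfolding arrangement_coeff_def
    by (rule prod.mono_neutral_cong_left[OF fin]) (auto simp: P_def inv_factor_def split: if_splits)
  ultimately show ?thesis by simp
qed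

lemma inv_coeff_snoc: "inv_coeff (w @ [x]) = inv_coeff w * (\<Prod>y\<leftarrow>w. inv_factor y x)"
  by (induction w) (auto simp: mult_ac)

lemma inv_coeff_nonzero: "w \<in> words \<Longrightarrow> inv_coeff w \<noteq> 0"
proof (induction w)
  case (Cons x w)
  then have "inv_factor x y \<noteq> 0" if "y \<in> set w" for y
    using that q_nonzero[of y x] by (auto simp: inv_factor_def words_def)
  then show ?case using Cons by (auto simp: words_def prod_list_zero_iff)
qed simp

text \<open>Only the exchanged pair changes its contribution. Cross-multiplication covers both
  orders of \<open>x\<close> and \<open>y\<close> without division.\<close>

lemma inv_coeff_swap: "inv_coeff (us @ x # y # vs) * inv_factor y x = inv_coeff (us @ y # x # vs) * inv_factor x y"
  by (induction us) (auto simp: mult_ac)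

text \<open>The image of the Koszul chain with exterior part of full degree and coefficient
  x^\<alpha>, in monomial coordinates.\<close>

definition top_chain :: "(nat \<Rightarrow> nat) \<Rightarrow> ((nat \<Rightarrow> nat) list \<Rightarrow>\<^sub>0 complex)" where
  "top_chain \<alpha> = (\<Sum>w\<in>perms {1..N}. single (\<alpha> # units w) (inv_coeff w))"

text \<open>This is \<open>Omega\<close> for the full exterior index: the two values of
  \<open>reorder_coeff\<close> collect the letters above and below \<open>i\<close>, and q_ir q_ri =
  1 turns the negative powers into positive ones.\<close>

definition koszul_coeff :: "(nat \<Rightarrow> nat) \<Rightarrow> nat \<Rightarrow> complex" where
  "koszul_coeff \<alpha> i = (-1) ^ (i - 1) * ((\<Prod>s\<in>{1..<i}. q s i) * reorder_coeff N q \<alpha> (unit_index i)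
     - p i * (\<Prod>s\<in>{i<..N}. q i s) * reorder_coeff N q (unit_index i) \<alpha>)"

definition swap :: "nat \<Rightarrow> nat list \<Rightarrow> nat list" where
  "swap i w = take i w @ w ! Suc i # w ! i # drop (i + 2) w"

lemma decomp_at:
  assumes "Suc i < length w"
  obtains us x y vs where "w = us @ x # y # vs" "length us = i"
proof -
  have "w = take i w @ w ! i # w ! Suc i # drop (i + 2) w"
    using assms by (simp add: Cons_nth_drop_Suc)
  then show ?thesis using that[of "take i w"] assms by auto
qed

lemma swap_append: "swap (length us) (us @ x # y # vs) = us @ y # x # vs"
  by (simp add: swap_def nth_append)

lemma eq_uminus_imp_0: "f = 0" if "f = - f" for f :: "'z \<Rightarrow>\<^sub>0 complex"
proof (rule poly_mapping_eqI)
  fix z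
  have "lookup f z = - lookup f z" using arg_cong[OF that, of "\<lambda>f. lookup f z"] by simp
  then show "lookup f z = lookup 0 z" by simp
qed

text \<open>Exchanging the entries at \<open>i\<close> and \<open>Suc i\<close> is an involution on
  the arrangements. It keeps the merged cell and, since q_xy q_yx = 1, reverses the sign of its
  coefficient.\<close>

lemma inner_cancel:
  assumes "Suc i < N"
  shows "(\<Sum>w\<in>perms {1..N}. single (\<alpha> # merge_at i (units w))
     (inv_coeff w * reorder_coeff N q (unit_index (w ! i)) (unit_index (w ! Suc i)))) = 0"
proof -
  let ?f = "\<lambda>w. single (\<alpha> # merge_at i (units w)) (inv_coeff w * reorder_coeff N q (unit_index (w ! i)) (unit_index (w ! Suc i)))"
  have sw: "swap i w \<in> perms {1..N} \<and> swap i (swap i w) = w \<and> ?f (swap i w) = - ?f w"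
    if "w \<in> perms {1..N}" for w
  proof -
    have w: "set w = {1..N}" "distinct w" "length w = N"
      using permutations_of_setD[OF that] distinct_card[of w] by auto
    have "Suc i < length w" using assms w(3) by simp
    then obtain us x y vs where d: "w = us @ x # y # vs" "length us = i" by (rule decomp_at)
    have s: "swap i w = us @ y # x # vs" using swap_append[of us x y vs] d by simp
    have xy: "x \<in> {1..N}" "y \<in> {1..N}" "x \<noteq> y" using w d by auto
    have "merge_at i (units (us @ x # y # vs)) = merge_at i (units (us @ y # x # vs))"
      using d(2) merge_at_append2[of "units us" i] by (simp add: add.commute)
    then have "merge_at i (units w) = merge_at i (units (swap i w))" by (simp only: s d(1)[symmetric])
    moreover have "inv_coeff (us @ y # x # vs) * reorder_coeff N q (unit_index y) (unit_index x) =
      - (inv_coeff w * reorder_coeff N q (unit_index x) (unit_index y))"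
    proof (cases "x < y")
      case True
      then have "inv_coeff (us @ y # x # vs) = - (inv_coeff w * q x y)"
        using inv_coeff_swap[of us x y vs] by (simp add: inv_factor_def d)
      then have "inv_coeff (us @ y # x # vs) * q y x = - (inv_coeff w * (q x y * q y x))" by simp
      then show ?thesis using True xy by (simp add: reorder_coeff_unit_unit q_inverse del: One_nat_def)
    next
      case False
      then have "inv_coeff w = - (inv_coeff (us @ y # x # vs) * q y x)"
        using inv_coeff_swap[of us x y vs] xy by (simp add: inv_factor_def d)
      then have "inv_coeff w * q x y = - (inv_coeff (us @ y # x # vs) * (q y x * q x y))" by simp
      then show ?thesis using False xy by (simp add: reorder_coeff_unit_unit q_inverse del: One_nat_def)
    qed
    moreover have n: "(us @ a # b # vs) ! i = a" "(us @ a # b # vs) ! Suc i = b" for a b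
      using d(2) by (auto simp: nth_append)
    moreover have "w ! i = x" "w ! Suc i = y" unfolding d(1) by (rule n)+
    ultimately have "?f (swap i w) = - ?f w"
      by (simp add: single_uminus s)
    moreover have "swap i (swap i w) = w" using swap_append[of us y x vs] d s by simp
    moreover have "swap i w \<in> perms {1..N}"
    proof -
      have "set (us @ y # x # vs) = set w" unfolding d(1) by auto
      moreover have "distinct (us @ y # x # vs)" using w(2) unfolding d(1) by auto
      ultimately show ?thesis unfolding s w(1) by (rule permutations_of_setI)
    qed
    ultimately show ?thesis by blast
  qed
  have "sum ?f (perms {1..N}) = (\<Sum>w\<in>perms {1..N}. ?f (swap i w))"
    by (rule sum.reindex_bij_witness[of _ "swap i" "swap i"]) (use sw in auto)
  also have "\<dots> = (\<Sum>w\<in>perms {1..N}. - ?f w)"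
    by (rule sum.cong) (use sw in auto)
  also have "\<dots> = - sum ?f (perms {1..N})" by (rule sum_negf)
  finally show ?thesis by (rule eq_uminus_imp_0)
qed

lemma prod_list_perm: "v \<in> perms S \<Longrightarrow> prod_list (map f v) = prod f S"
  using prod.distinct_set_conv_list[of v f] by (simp add: permutations_of_set_def)

text \<open>In front of all other letters, \<open>i\<close> forms an inversion with exactly the
  \<open>i - 1\<close> smaller ones.\<close>

lemma inv_coeff_first:
  assumes "i \<in> {1..N}" "v \<in> perms ({1..N} - {i})"
  shows "inv_coeff (i # v) = inv_coeff v * (-1) ^ (i - 1) * (\<Prod>s\<in>{1..<i}. q s i)"
proof -
  have "prod (inv_factor i) ({1..N} - {i}) = (\<Prod>s\<in>{1..<i}. - 1 * q s i)"
    using assms(1) by (intro prod.mono_neutral_cong_right) (auto simp: inv_factor_def)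
  then show ?thesis using prod_list_perm[OF assms(2), of "inv_factor i"]
    unfolding prod.distrib by (simp add: mult_ac)
qed

text \<open>Behind all other letters, \<open>i\<close> forms an inversion with exactly the
  \<open>N - i\<close> larger ones.\<close>

lemma inv_coeff_last:
  assumes "i \<in> {1..N}" "v \<in> perms ({1..N} - {i})"
  shows "inv_coeff (v @ [i]) = inv_coeff v * (-1) ^ (N - i) * (\<Prod>s\<in>{i<..N}. q i s)"
proof -
  have "prod (\<lambda>s. inv_factor s i) ({1..N} - {i}) = (\<Prod>s\<in>{i<..N}. - 1 * q i s)"
    using assms(1) by (intro prod.mono_neutral_cong_right) (auto simp: inv_factor_def)
  then show ?thesis using prod_list_perm[OF assms(2), of "\<lambda>s. inv_factor s i"]
    unfolding prod.distrib by (simp add: mult_ac inv_coeff_snoc)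
qed

lemma sum_perms_first:
  "(\<Sum>w\<in>perms {1..N}. f (hd w) (tl w)) = (\<Sum>i\<in>{1..N}. \<Sum>v\<in>perms ({1..N} - {i}). f i v)" if "N > 0"
proof -
  have ne: "w \<noteq> []" if "w \<in> perms {1..N}" for w
    using permutations_of_setD(1)[OF that] \<open>N > 0\<close> by auto
  have *: "hd w \<in> {1..N} \<and> tl w \<in> perms ({1..N} - {hd w}) \<and> hd w # tl w = w" if "w \<in> perms {1..N}" for w
    using that ne[OF that] by (cases w) (auto simp: permutations_of_set_def)
  show ?thesis
    by (subst sum.Sigma, simp, simp, rule sum.reindex_bij_witness[of _ "\<lambda>(i, v). i # v" "\<lambda>w. (hd w, tl w)"])
       (use * in \<open>auto simp: permutations_of_set_def\<close>)
qed

lemma sum_perms_last: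
  "(\<Sum>w\<in>perms {1..N}. f (last w) (butlast w)) = (\<Sum>i\<in>{1..N}. \<Sum>v\<in>perms ({1..N} - {i}). f i v)" if "N > 0"
proof -
  have ne: "w \<noteq> []" if "w \<in> perms {1..N}" for w
    using permutations_of_setD(1)[OF that] \<open>N > 0\<close> by auto
  have *: "last w \<in> {1..N} \<and> butlast w \<in> perms ({1..N} - {last w}) \<and> butlast w @ [last w] = w" if "w \<in> perms {1..N}" for w
    using that ne[OF that] by (cases w rule: rev_cases) (auto simp: permutations_of_set_def)
  show ?thesis
    by (subst sum.Sigma, simp, simp, rule sum.reindex_bij_witness[of _ "\<lambda>(i, v). v @ [i]" "\<lambda>w. (last w, butlast w)"])
       (use * in \<open>auto simp: permutations_of_set_def\<close>)
qed

text \<open>The inner faces cancel in pairs by the defining relations; the two outer faces give the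
  two terms of the Koszul differential.\<close>

lemma bdry_top_chain:
  "lin_ext bdry (top_chain \<alpha>) =
     (\<Sum>i\<in>{1..N}. \<Sum>v\<in>perms ({1..N} - {i}). single ((\<alpha> + unit_index i) # units v) (inv_coeff v * koszul_coeff \<alpha> i))"
proof (cases "N = 0")
  case True
  then have e: "{1..N} = {}" by simp
  show ?thesis unfolding top_chain_def e by (simp add: lin_ext_single bdry_def wrap_def)
next
  case False
  then have N: "N > 0" by simp
  let ?b = "\<lambda>w. \<alpha> # units w"
  let ?first = "\<lambda>i v. single ((\<alpha> + unit_index i) # units v) (inv_coeff (i # v) * reorder_coeff N q \<alpha> (unit_index i))"
  let ?last = "\<lambda>i v. single ((\<alpha> + unit_index i) # units v)
     (inv_coeff (v @ [i]) * ((-1) ^ N * p i * reorder_coeff N q (unit_index i) \<alpha>))"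
  have "fscale (inv_coeff w) (bdry (?b w)) = ?first (hd w) (tl w) + (\<Sum>i<N - 1. fscale ((-1) ^ Suc i)
      (single (\<alpha> # merge_at i (units w)) (inv_coeff w * reorder_coeff N q (unit_index (w ! i)) (unit_index (w ! Suc i)))))
      + ?last (last w) (butlast w)"
    if "w \<in> perms {1..N}" for w
  proof -
    have w: "set w = {1..N}" "distinct w" "length w = N"
      using permutations_of_setD[OF that] distinct_card[of w] by auto
    obtain x xs where xs: "w = x # xs" using w N by (cases w) auto
    have ne: "w \<noteq> []" using xs by simp
    have "last w \<in> {1..N}" using last_in_set[OF ne] w by simp
    then have "wrap (?b w) = single ((\<alpha> + unit_index (last w)) # units (butlast w))
        ((-1) ^ N * p (last w) * reorder_coeff N q (unit_index (last w)) \<alpha>)"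
      using ne w(3) N by (simp add: wrap_def weight_unit last_map map_butlast add.commute Suc_le_eq del: One_nat_def)
    then have 1: "fscale (inv_coeff w) (wrap (?b w)) = ?last (last w) (butlast w)" using ne by simp
    have "bar (?b w) = (\<Sum>i<Suc (N - 1). single (merge_at i (?b w)) ((-1) ^ i * reorder_coeff N q (?b w ! i) (?b w ! Suc i)))"
      using w(3) N by (simp add: bar_sum)
    also have "\<dots> = single ((\<alpha> + unit_index x) # units xs) (reorder_coeff N q \<alpha> (unit_index x)) +
       (\<Sum>i<N - 1. single (\<alpha> # merge_at i (units w)) ((-1) ^ Suc i * reorder_coeff N q (unit_index (w ! i)) (unit_index (w ! Suc i))))"
      unfolding sum.lessThan_Suc_shift using w(3)
      by (intro arg_cong2[of _ _ _ _ "(+)"] sum.cong) (auto simp: xs nth_Cons split: nat.split)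
    finally have B: "bar (?b w) = single ((\<alpha> + unit_index x) # units xs) (reorder_coeff N q \<alpha> (unit_index x)) +
       (\<Sum>i<N - 1. single (\<alpha> # merge_at i (units w)) ((-1) ^ Suc i * reorder_coeff N q (unit_index (w ! i)) (unit_index (w ! Suc i))))" .
    have "hd w = x" "tl w = xs" "x # xs = w" by (simp_all add: xs)
    then have 2: "fscale (inv_coeff w) (bar (?b w)) = ?first (hd w) (tl w) + (\<Sum>i<N - 1. fscale ((-1) ^ Suc i)
      (single (\<alpha> # merge_at i (units w)) (inv_coeff w * reorder_coeff N q (unit_index (w ! i)) (unit_index (w ! Suc i)))))"
      unfolding B by (simp add: fscale_add_right free_vs.scale_sum_right mult_ac del: inv_coeff.simps)
    show ?thesis unfolding bdry_def fscale_add_right 1 2 ..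
  qed
  then have "lin_ext bdry (top_chain \<alpha>) = (\<Sum>w\<in>perms {1..N}. ?first (hd w) (tl w))
    + (\<Sum>w\<in>perms {1..N}. \<Sum>i<N - 1. fscale ((-1) ^ Suc i)
      (single (\<alpha> # merge_at i (units w)) (inv_coeff w * reorder_coeff N q (unit_index (w ! i)) (unit_index (w ! Suc i)))))
    + (\<Sum>w\<in>perms {1..N}. ?last (last w) (butlast w))"
    unfolding top_chain_def lin_ext_sum lin_ext_single sum.distrib[symmetric] by (intro sum.cong) auto
  \<comment> \<open>After exchanging the two sums, every inner position cancels by itself.\<close>
  also have "(\<Sum>w\<in>perms {1..N}. \<Sum>i<N - 1. fscale ((-1) ^ Suc i)
      (single (\<alpha> # merge_at i (units w)) (inv_coeff w * reorder_coeff N q (unit_index (w ! i)) (unit_index (w ! Suc i))))) = 0"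
    unfolding sum.swap[of _ _ "perms {1..N}"] free_vs.scale_sum_right[symmetric]
    using inner_cancel[of _ \<alpha>] by (intro sum.neutral) simp
  also have "(\<Sum>w\<in>perms {1..N}. ?first (hd w) (tl w)) = (\<Sum>i\<in>{1..N}. \<Sum>v\<in>perms ({1..N} - {i}). ?first i v)"
    by (rule sum_perms_first[OF N])
  also have "(\<Sum>w\<in>perms {1..N}. ?last (last w) (butlast w)) = (\<Sum>i\<in>{1..N}. \<Sum>v\<in>perms ({1..N} - {i}). ?last i v)"
    by (rule sum_perms_last[OF N])
  finally have "lin_ext bdry (top_chain \<alpha>) = (\<Sum>i\<in>{1..N}. \<Sum>v\<in>perms ({1..N} - {i}). ?first i v + ?last i v)"
    by (simp only: sum.distrib add_0_right)
  also have "\<dots> = (\<Sum>i\<in>{1..N}. \<Sum>v\<in>perms ({1..N} - {i}). single ((\<alpha> + unit_index i) # units v) (inv_coeff v * koszul_coeff \<alpha> i))"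
  proof (intro sum.cong refl)
    fix i v assume iv: "i \<in> {1..N}" "v \<in> perms ({1..N} - {i})"
    obtain j where j: "i = Suc j" using iv(1) by (cases i) auto
    obtain k where k: "N = i + k" using iv(1) by (auto dest: le_Suc_ex)
    \<comment> \<open>The sign of the cyclic face and the inversions of a last letter
      \<open>i\<close> combine to the sign of the second term of \<open>Omega\<close>.\<close>
    have sg: "(-1::complex) ^ (N - i) * (-1) ^ N = - ((-1) ^ (i - 1))"
      unfolding k j by (cases "even k") (simp_all add: power_add)
    have "inv_coeff (v @ [i]) * ((-1) ^ N * p i * reorder_coeff N q (unit_index i) \<alpha>) =
       inv_coeff v * ((-1) ^ (N - i) * (-1) ^ N) * (\<Prod>s\<in>{i<..N}. q i s) * (p i * reorder_coeff N q (unit_index i) \<alpha>)"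
      by (simp add: inv_coeff_last[OF iv])
    then show "?first i v + ?last i v = single ((\<alpha> + unit_index i) # units v) (inv_coeff v * koszul_coeff \<alpha> i)"
      unfolding single_add[symmetric] sg by (simp add: inv_coeff_first[OF iv] koszul_coeff_def algebra_simps del: inv_coeff.simps)
  qed
  finally show ?thesis .
qed

text \<open>Merging adds exponents, and so does the cyclic face: the number of letters in all slots
  together is preserved.\<close>

lemma bdry_nondeg_keys:
  assumes "nondeg l" "x \<in> M"
  shows "bdry (x # l) \<in> supported {z. length (wcat z) = length (wcat (x # l))}"
  unfolding bdry_faces
proof (rule supported_sum)
  fix i assume i: "i \<in> {..<length (x # l)}"
  show "face i (x # l) \<in> supported {z. length (wcat z) = length (wcat (x # l))}"
  proof (cases "Suc i < length (x # l)")
    case True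
    then show ?thesis using length_wcat_merge_at[OF True] by (auto simp: face_def intro!: supported_single)
  next
    case False
    then show ?thesis
      by (cases l rule: rev_cases)
         (auto simp: face_def wrap_def length_nword_add supported_zero intro!: supported_single)
  qed
qed

text \<open>Chains with a zero in the tail form a subcomplex. A cell with even first run is a
  partner, and \<open>bdry_zsplit\<close> describes its boundary. A cell with odd first run is, up
  to a factor and a boundary, a combination of such cells, and boundaries have boundary 0.\<close>

lemma bdry_deg_keys:
  assumes "0 \<in> set l"
  shows "bdry (x # l) \<in> supported {z. 0 \<in> set (tl z)}"
proof -
  have ev: "bdry (y # l') \<in> supported {z. 0 \<in> set (tl z)}" if l': "0 \<in> set l'" "even (zrun l')" for y l'
  proof -
    obtain k where k: "0 \<in> set k" "odd (zrun k)" "zsplit k = l'" using zcover[OF l'] by blast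
    obtain \<epsilon> f where f: "bdry (y # l') = single (y # k) \<epsilon> + f"
      "\<forall>z\<in>keys f. 0 \<in> set (tl z) \<and> even (zrun (tl z))"
      using bdry_zsplit[OF k(1,2), of y] unfolding k(3) by blast
    show ?thesis unfolding f(1) using k(1) f(2)
      by (intro supported_add supported_single) (auto simp: supported_def)
  qed
  show ?thesis
  proof (cases "even (zrun l)")
    case False
    obtain \<epsilon> f where f: "bdry (x # zsplit l) = single (x # l) \<epsilon> + f" "\<epsilon> \<noteq> 0"
      "\<forall>z\<in>keys f. 0 \<in> set (tl z) \<and> even (zrun (tl z))"
      using bdry_zsplit[of l x] assms False by blast
    have "fscale \<epsilon> (bdry (x # l)) + lin_ext bdry f = 0"
      using bdry_bdry[of "x # zsplit l"] by (simp add: f(1) lin_ext_add lin_ext_single)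
    then have "fscale (inverse \<epsilon>) (fscale \<epsilon> (bdry (x # l))) = fscale (- inverse \<epsilon>) (lin_ext bdry f)"
      by (simp add: eq_neg_iff_add_eq_0 free_vs.scale_right_distrib[symmetric] del: free_vs.scale_scale)
    then have "bdry (x # l) = fscale (- inverse \<epsilon>) (lin_ext bdry f)" using f(2) by simp
    moreover have "lin_ext bdry f \<in> supported {z. 0 \<in> set (tl z)}"
    proof (rule lin_ext_in_subspace[OF subspace_supported])
      fix z assume "z \<in> keys f"
      then have z: "0 \<in> set (tl z)" "even (zrun (tl z))" using f(3) by auto
      then have "z = hd z # tl z" by (cases z) auto
      then show "bdry z \<in> supported {z. 0 \<in> set (tl z)}" using ev[OF z, of "hd z"] by simp
    qed
    ultimately show ?thesis by (metis supported_fscale)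
  qed (use ev assms in auto)
qed

lemma units_nondeg: "w \<in> words \<Longrightarrow> nondeg (units w)"
  by (auto simp: nondeg_def words_def intro!: unit_in_multiindices)

lemma perms_words: "w \<in> perms S \<Longrightarrow> S \<subseteq> {1..N} \<Longrightarrow> w \<in> words"
  by (auto simp: words_def permutations_of_set_def)

lemma wcat_units: "w \<in> words \<Longrightarrow> wcat (units w) = w"
proof (induction w)
  case (Cons i w)
  then have i: "i \<in> {1..N}" "w \<in> words" by (auto simp: words_def)
  have "nword N (unit_index i) = [i]"
    using i(1) by (intro nword_eqI) (auto simp: unit_index_apply)
  then show ?case using Cons i by simp
qed simp

lemma units_inject: "units v = units w \<longleftrightarrow> v = w"
  by (rule inj_map_eq_map) (simp add: inj_def)

lemma lookup_top_chain:
  "w \<in> perms {1..N} \<Longrightarrow> lookup (top_chain \<alpha>) (\<beta> # units w) = (if \<beta> = \<alpha> then inv_coeff w else 0)"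
  unfolding top_chain_def
  by (simp add: lookup_sum lookup_single when_def units_inject sum.delta eq_commute[of w] cong: if_cong conj_cong)

text \<open>The test cell is the increasing arrangement with exponent 0 in slot 0. It has N letters
  and no zero in its tail. Degenerate cells of degree N + 1 bound only degenerate ones, and
  nondegenerate cells of that degree have more than N letters, a number that the boundary
  preserves.\<close>

lemma top_chain_not_boundary:
  assumes "y \<in> supported (cells (Suc N))"
  shows "top_chain 0 \<noteq> lin_ext bdry y"
proof
  assume eq: "top_chain 0 = lin_ext bdry y"
  define w where "w = [1..<N + 1]"
  have w: "w \<in> perms {1..N}" "w \<in> words" "length w = N"
    by (auto simp: w_def permutations_of_set_def words_def simp del: upt_Suc)
  have "bdry b \<in> supported (- {0 # units w})" if b: "b \<in> cells (Suc N)" for b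
  proof -
    obtain x l where l: "b = x # l" "length l = Suc N" "x \<in> M" "set l \<subseteq> M"
      using b by (cases b) (auto simp: cells_def)
    show ?thesis
    proof (cases "0 \<in> set l")
      case True
      have "0 \<notin> set (tl (0 # units w))" using units_nondeg[OF w(2)] by (simp add: nondeg_def)
      then show ?thesis using bdry_deg_keys[OF True, of x] unfolding l(1) supported_def by blast
    next
      case False
      then have nd: "nondeg l" using l by (simp add: nondeg_def)
      have "length k \<le> length (wcat k)" if "nondeg k" for k
        using that
      proof (induction k)
        case (Cons m k)
        then have "nword N m \<noteq> []" by (simp add: nword_eq_Nil)
        then show ?case using Cons by (cases "nword N m") auto
      qed simp
      from this[OF nd] have "length (wcat (x # l)) > N" using l(2) by simp
      moreover have "length (wcat (0 # units w)) = N"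
        using wcat_units[OF w(2)] w(3) nword_eq_Nil[of 0 N] by simp
      ultimately show ?thesis using bdry_nondeg_keys[OF nd l(3)] unfolding l(1) supported_def by force
    qed
  qed
  then have "lin_ext bdry y \<in> supported (- {0 # units w})" by (rule lin_ext_supported[OF assms])
  then have "lookup (top_chain 0) (0 # units w) = 0" unfolding eq supported_iff by blast
  then show False using lookup_top_chain[OF w(1), of 0 0] inv_coeff_nonzero[OF w(2)] by simp
qed

text \<open>A run counts as a source only if some entry that is not a generator ends it.\<close>

lemma units_not_src: "w \<in> words \<Longrightarrow> \<not> src B (units w)"
  by (induction w arbitrary: B) (auto simp: words_def)

lemma units_not_source: "w \<in> words \<Longrightarrow> x # units w \<notin> sources n"
  using units_nondeg[of w] units_not_src by (auto simp: sources_def nondeg_def)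

lemma units_cells: "w \<in> words \<Longrightarrow> x \<in> M \<Longrightarrow> x # units w \<in> cells (length w)"
  using units_nondeg[of w] by (auto simp: cells_def nondeg_def)

lemma length_perm: "w \<in> perms {1..N} \<Longrightarrow> length w = N"
  using distinct_card[of w] by (auto simp: permutations_of_set_def)

lemma top_chain_supported:
  assumes "\<alpha> \<in> M"
  shows "top_chain \<alpha> \<in> supported (cells N)" "top_chain \<alpha> \<in> supported (- sources N)"
proof -
  have "\<alpha> # units w \<in> cells N \<and> \<alpha> # units w \<notin> sources N" if "w \<in> perms {1..N}" for w
    using units_cells[OF perms_words[OF that order.refl] assms] length_perm[OF that]
      units_not_source[OF perms_words[OF that order.refl]] by simp
  then show "top_chain \<alpha> \<in> supported (cells N)" "top_chain \<alpha> \<in> supported (- sources N)"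
    unfolding top_chain_def by (auto intro!: supported_sum supported_single simp del: One_nat_def)
qed

lemma bdry_top_chain_supported: "lin_ext bdry (top_chain \<alpha>) \<in> supported (- sources (N - 1))"
  unfolding bdry_top_chain
  by (intro supported_sum supported_single) (simp add: units_not_source perms_words)

text \<open>The critical cells in degree \<open>N\<close> are exactly the leading terms of the chains
  \<open>top_chain \<alpha>\<close>, so every cycle is homologous to a combination of these chains.\<close>

lemma cycle_top_chains:
  assumes z: "z \<in> supported (cells N)" "lin_ext bdry z = 0"
  shows "\<exists>y\<in>supported (cells (Suc N)). \<exists>k\<in>supported M. z = lin_ext bdry y + lin_ext top_chain k"
proof -
  let ?C = "crit_cells N \<union> match ` (if N = 0 then {} else sources (N - 1))"
  define w where "w = rev [1..<N + 1]"
  have w: "w \<in> perms {1..N}" "w \<in> words"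
    by (auto simp: w_def permutations_of_set_def words_def simp del: upt_Suc)
  obtain y where y: "y \<in> supported (cells (Suc N))" "z - lin_ext bdry y \<in> supported ?C"
    using chain_reduce[OF z(1)] by blast
  define u where "u = z - lin_ext bdry y"
  \<comment> \<open>On the critical cell with \<alpha> in slot 0, \<open>top_chain \<alpha>\<close>
    has the coefficient \<open>inv_coeff w\<close>. Dividing by it makes the critical parts of
    \<open>u\<close> and of the combination agree.\<close>
  define k where "k = (\<Sum>b\<in>keys u \<inter> crit_cells N. single (hd b) (lookup u b / inv_coeff w))"
  have k: "k \<in> supported M"
    unfolding k_def by (intro supported_sum supported_single) (auto simp: crit_cells_def)
  have bu: "lin_ext bdry u = 0" by (simp add: u_def lin_ext_diff z lin_ext_comp bdry_bdry)
  have t1: "lin_ext top_chain k \<in> supported ?C"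
  proof -
    have "lin_ext top_chain k \<in> supported (cells N)" "lin_ext top_chain k \<in> supported (- sources N)"
      using top_chain_supported by (auto intro!: lin_ext_supported[OF k])
    then show ?thesis using cells_cover[of N] unfolding supported_def by blast
  qed
  have t2: "lin_ext bdry (lin_ext top_chain k) \<in> supported (- sources (N - 1))"
    unfolding lin_ext_comp by (rule lin_ext_supported[OF k]) (rule bdry_top_chain_supported)
  have "lookup (u - lin_ext top_chain k) b = 0" if b: "b \<in> crit_cells N" for b
  proof -
    obtain \<alpha> where \<alpha>: "b = \<alpha> # units w" using crit_cells_top b by (auto simp: w_def)
    have "lookup (lin_ext top_chain k) b = (\<Sum>b'\<in>keys u \<inter> crit_cells N. lookup u b' / inv_coeff w * (if \<alpha> = hd b' then inv_coeff w else 0))"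
      unfolding k_def lin_ext_sum lin_ext_single by (simp add: lookup_sum \<alpha> lookup_top_chain[OF w(1)])
    also have "\<dots> = (\<Sum>b'\<in>keys u \<inter> crit_cells N. if b' = b then lookup u b else 0)"
    proof (intro sum.cong refl)
      fix b' assume "b' \<in> keys u \<inter> crit_cells N"
      then have "b' \<in> (\<lambda>x. x # units w) ` M" using crit_cells_top by (auto simp: w_def simp del: upt_Suc)
      then have "\<alpha> = hd b' \<longleftrightarrow> b' = b" by (auto simp: \<alpha>)
      then show "lookup u b' / inv_coeff w * (if \<alpha> = hd b' then inv_coeff w else 0) = (if b' = b then lookup u b else 0)"
        using inv_coeff_nonzero[OF w(2)] by simp
    qed
    also have "\<dots> = lookup u b" using b by (auto simp: sum.delta' in_keys_iff)
    finally show ?thesis by (simp add: lookup_minus)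
  qed
  moreover have "lin_ext bdry (u - lin_ext top_chain k) \<in> supported (- sources (N - 1))"
    using supported_diff[OF supported_zero t2] by (simp add: lin_ext_diff bu)
  moreover have "u - lin_ext top_chain k \<in> supported ?C"
    using y(2) t1 by (intro supported_diff) (simp add: u_def)
  ultimately have "u - lin_ext top_chain k = 0" by (intro chain_eq_0[of _ N])
  then have "z = lin_ext bdry y + lin_ext top_chain k" by (simp add: u_def algebra_simps)
  then show ?thesis using y(1) k by blast
qed

text \<open>The cell determines its origin: \<open>v\<close> reveals \<open>i\<close> as the missing
  letter, and cancelling \<open>unit_index i\<close> in slot 0 reveals the exponent. Hence
  boundaries of different top chains cannot cancel each other.\<close>

lemma lookup_bdry_top_chain:
  assumes "i \<in> {1..N}" "v \<in> perms ({1..N} - {i})"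
  shows "lookup (lin_ext bdry (top_chain \<alpha>)) ((\<beta> + unit_index i) # units v) = (if \<alpha> = \<beta> then inv_coeff v * koszul_coeff \<alpha> i else 0)"
proof -
  have eq: "(\<alpha> + unit_index j) # units v' = (\<beta> + unit_index i) # units v \<longleftrightarrow> \<alpha> = \<beta> \<and> j = i \<and> v' = v"
    if "j \<in> {1..N}" "v' \<in> perms ({1..N} - {j})" for j v'
  proof -
    have "j = i" if v': "v' = v"
    proof -
      have "{1..N} - {j} = {1..N} - {i}"
        using permutations_of_setD(1)[OF assms(2)] permutations_of_setD(1)[OF \<open>v' \<in> _\<close>] v' by simp
      then show ?thesis using \<open>j \<in> {1..N}\<close> by blast
    qed
    moreover have "\<alpha> + unit_index i = \<beta> + unit_index i \<longleftrightarrow> \<alpha> = \<beta>" by (rule add_right_cancel)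
    ultimately show ?thesis by (metis list.inject units_inject)
  qed
  have "lookup (lin_ext bdry (top_chain \<alpha>)) ((\<beta> + unit_index i) # units v) =
    (\<Sum>j\<in>{1..N}. \<Sum>v'\<in>perms ({1..N} - {j}). if \<alpha> = \<beta> \<and> j = i \<and> v' = v then inv_coeff v * koszul_coeff \<alpha> i else 0)"
    unfolding bdry_top_chain lookup_sum
    by (intro sum.cong refl) (simp add: lookup_single when_def eq del: list.inject)
  also have "\<dots> = (\<Sum>j\<in>{1..N}. if j = i then (if \<alpha> = \<beta> then inv_coeff v * koszul_coeff \<alpha> i else 0) else 0)"
    using assms(2) by (intro sum.cong refl) (auto simp: sum.delta)
  also have "\<dots> = (if \<alpha> = \<beta> then inv_coeff v * koszul_coeff \<alpha> i else 0)" using assms(1) by (simp add: sum.delta)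
  finally show ?thesis .
qed

lemma top_chains_cycle:
  assumes "lin_ext bdry (lin_ext top_chain k) = 0" "\<alpha> \<in> keys k" "i \<in> {1..N}"
  shows "koszul_coeff \<alpha> i = 0"
proof -
  have "perms ({1..N} - {i}) \<noteq> {}" by simp
  then obtain v where v: "v \<in> perms ({1..N} - {i})" by (metis ex_in_conv)
  have "lookup (lin_ext bdry (lin_ext top_chain k)) ((\<alpha> + unit_index i) # units v)
      = (\<Sum>\<beta>\<in>keys k. if \<beta> = \<alpha> then lookup k \<alpha> * (inv_coeff v * koszul_coeff \<alpha> i) else 0)"
    unfolding lin_ext_comp[of bdry top_chain] lookup_lin_ext[of "\<lambda>\<beta>. lin_ext bdry (top_chain \<beta>)"]
      lookup_bdry_top_chain[OF assms(3) v] by (intro sum.cong) auto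
  then have "lookup k \<alpha> * (inv_coeff v * koszul_coeff \<alpha> i) = 0" using assms(1,2) by simp
  moreover have "inv_coeff v \<noteq> 0" using inv_coeff_nonzero[OF perms_words[OF v]] by auto
  ultimately show ?thesis using assms(2) by (simp add: in_keys_iff)
qed

section \<open>Genericity\<close>

lemma reorder_coeff_unit_right:
  assumes "i \<in> {1..N}"
  shows "reorder_coeff N q \<alpha> (unit_index i) = (\<Prod>r\<in>{i<..N}. q r i ^ \<alpha> r)"
proof -
  have "reorder_coeff N q \<alpha> (unit_index i) = (\<Prod>r=1..N. if i < r then q r i ^ \<alpha> r else 1)"
    unfolding reorder_coeff_def
  proof (intro prod.cong refl)
    fix r assume "r \<in> {1..N}"
    have "(\<Prod>j\<in>{1..<r}. q r j ^ (\<alpha> r * unit_index i j)) = (\<Prod>j\<in>{1..<r}. if j = i then q r i ^ \<alpha> r else 1)"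
      by (intro prod.cong) (auto simp: unit_index_apply)
    then show "(\<Prod>j\<in>{1..<r}. q r j ^ (\<alpha> r * unit_index i j)) = (if i < r then q r i ^ \<alpha> r else 1)"
      using assms by (simp add: prod.delta)
  qed
  also have "\<dots> = (\<Prod>r\<in>{i<..N}. q r i ^ \<alpha> r)"
    using assms by (intro prod.mono_neutral_cong_right) auto
  finally show ?thesis .
qed

text \<open>Vanishing of \<open>koszul_coeff 0 i\<close> for all \<open>i\<close>, written without
  division.\<close>

definition modular :: bool where
  "modular \<longleftrightarrow> (\<forall>i\<in>{1..N}. (\<Prod>s\<in>{1..<i}. q s i) = p i * (\<Prod>s\<in>{i<..N}. q i s))"

lemma koszul_coeff_0: "koszul_coeff 0 i = (-1) ^ (i - 1) * ((\<Prod>s\<in>{1..<i}. q s i) - p i * (\<Prod>s\<in>{i<..N}. q i s))"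
  by (simp add: koszul_coeff_def)

text \<open>Modularity cancels the two exterior factors. What remains says that x^\<alpha> commutes
  with x_i, and moving all factors to one side gives the product in the genericity
  condition.\<close>

lemma koszul_coeff_eq_0_imp:
  assumes "modular" "i \<in> {1..N}" "koszul_coeff \<alpha> i = 0"
  shows "(\<Prod>k=1..N. q k i ^ \<alpha> k) = 1"
proof -
  have nz: "(\<Prod>s\<in>{1..<i}. q s i) \<noteq> 0" using assms(2) q_nonzero by auto
  have "(\<Prod>s\<in>{1..<i}. q s i) * reorder_coeff N q \<alpha> (unit_index i) = (\<Prod>s\<in>{1..<i}. q s i) * reorder_coeff N q (unit_index i) \<alpha>"
    using assms by (simp add: koszul_coeff_def modular_def)
  then have eq: "(\<Prod>r\<in>{i<..N}. q r i ^ \<alpha> r) = (\<Prod>r\<in>{1..<i}. q i r ^ \<alpha> r)"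
    using nz assms(2) by (simp add: reorder_coeff_unit_right reorder_coeff_unit_left del: One_nat_def)
  have split: "{1..N} = {1..<i} \<union> ({i} \<union> {i<..N})" using assms(2) by auto
  have "(\<Prod>k=1..N. q k i ^ \<alpha> k) = (\<Prod>k\<in>{1..<i}. q k i ^ \<alpha> k) * (q i i ^ \<alpha> i * (\<Prod>k\<in>{i<..N}. q k i ^ \<alpha> k))"
    unfolding split by (subst prod.union_disjoint, simp, simp, force, subst prod.union_disjoint) auto
  also have "\<dots> = (\<Prod>k\<in>{1..<i}. (q k i * q i k) ^ \<alpha> k)"
    using assms(2) by (simp add: eq q_diag power_mult_distrib prod.distrib)
  also have "\<dots> = 1" using assms(2) q_inverse by (intro prod.neutral) auto
  finally show ?thesis .
qed

text \<open>Genericity leaves the multiples m \<kappa>_j. If m > 0, the condition at another index i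
  makes q_ji an m-th root of unity, and then m \<kappa>_i + m \<kappa>_j is a forbidden index. With
  N = 1 there is no such i.\<close>

lemma generic_eq_0:
  assumes g: "generic N q" and N: "N \<noteq> 1" and \<alpha>: "\<alpha> \<in> M"
    and 1: "\<And>i. i \<in> {1..N} \<Longrightarrow> (\<Prod>k=1..N. q k i ^ \<alpha> k) = 1"
  shows "\<alpha> = 0"
proof (rule ccontr)
  assume "\<alpha> \<noteq> 0"
  then have "\<exists>j\<in>{1..N}. \<exists>m. \<alpha> = (\<lambda>i. m * unit_index j i)"
    using g 1 \<alpha> by (auto simp: generic_def bad_index_def zero_fun_eq)
  then obtain j m where j: "j \<in> {1..N}" and \<alpha>j: "\<alpha> = (\<lambda>i. m * unit_index j i)" by blast
  have m: "m > 0" using \<open>\<alpha> \<noteq> 0\<close> by (auto simp: \<alpha>j fun_eq_iff)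
  have "\<exists>i\<in>{1..N}. i \<noteq> j" using N j by (intro bexI[of _ "if j = 1 then 2 else 1"]) auto
  then obtain i where i: "i \<in> {1..N}" "i \<noteq> j" by blast
  have pr: "(\<Prod>k=1..N. q k l ^ (a * unit_index s k)) = q s l ^ a" if "s \<in> {1..N}" for l a s
    using that by (subst prod.remove[of _ s]) (auto simp: unit_index_apply intro!: prod.neutral)
  have qji: "q j i ^ m = 1" using 1[OF i(1)] pr[OF j] by (simp add: \<alpha>j)
  have "q i j ^ m * q j i ^ m = 1" using q_inverse[OF i(1) j] by (simp flip: power_mult_distrib)
  then have qij: "q i j ^ m = 1" using qji by simp
  \<comment> \<open>Both conditions on this index hold since q_ij and q_ji are mutually inverse m-th
    roots of unity; its support has two elements, so it is not exempt.\<close>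
  define \<gamma> where "\<gamma> = (\<lambda>k. m * unit_index j k + m * unit_index i k)"
  have "(\<Prod>k=1..N. q k l ^ \<gamma> k) = q j l ^ m * q i l ^ m" for l
    using pr[OF j, of l m] pr[OF i(1), of l m] by (simp add: \<gamma>_def power_add prod.distrib)
  then have "bad_index N q \<gamma>"
    using i j qji qij q_diag
    by (auto simp: bad_index_def multiindices_def \<gamma>_def unit_index_apply split: if_splits)
  moreover have "\<gamma> \<noteq> (\<lambda>_. 0)" using m by (auto simp: \<gamma>_def fun_eq_iff unit_index_apply)
  moreover have "\<gamma> \<noteq> (\<lambda>k. m' * unit_index l k)" for l m'
  proof
    assume eq: "\<gamma> = (\<lambda>k. m' * unit_index l k)"
    have "\<gamma> i = m" "\<gamma> j = m" using i by (simp_all add: \<gamma>_def unit_index_apply)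
    then show False using m i unfolding eq by (auto simp: unit_index_apply split: if_splits)
  qed
  ultimately show False using g unfolding generic_def by blast
qed

lemma top_cycle:
  assumes "modular"
  shows "lin_ext bdry (top_chain 0) = 0"
  unfolding bdry_top_chain using assms
  by (intro sum.neutral ballI) (simp add: koszul_coeff_0 modular_def)

lemma top_homology:
  assumes "modular" "generic N q" "N \<noteq> 1" "z \<in> supported (cells N)" "lin_ext bdry z = 0"
  shows "\<exists>y\<in>supported (cells (Suc N)). \<exists>c. z = lin_ext bdry y + fscale c (top_chain 0)"
proof -
  obtain y k where yk: "y \<in> supported (cells (Suc N))" "k \<in> supported M" "z = lin_ext bdry y + lin_ext top_chain k"
    using cycle_top_chains[OF assms(4,5)] by blast
  have "lin_ext bdry (lin_ext top_chain k) = 0"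
    using assms(5) by (simp add: yk(3) lin_ext_add lin_ext_comp[of bdry bdry] bdry_bdry)
  then have koszul_coeff: "koszul_coeff \<alpha> i = 0" if "\<alpha> \<in> keys k" "i \<in> {1..N}" for \<alpha> i
    using top_chains_cycle that by blast
  have 0: "\<alpha> = 0" if "\<alpha> \<in> keys k" for \<alpha>
  proof (rule generic_eq_0[OF assms(2,3)])
    show "\<alpha> \<in> M" using yk(2) that by (auto simp: supported_def)
    show "(\<Prod>k=1..N. q k i ^ \<alpha> k) = 1" if "i \<in> {1..N}" for i
      using koszul_coeff_eq_0_imp[OF assms(1) that koszul_coeff[OF \<open>\<alpha> \<in> keys k\<close> that]] .
  qed
  have "keys k \<subseteq> {0}" using 0 by blast
  then have "lin_ext top_chain k = fscale (lookup k 0) (top_chain 0)"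
    by (subst lin_ext_superset[of "{0}"]) simp_all
  then have "z = lin_ext bdry y + fscale (lookup k 0) (top_chain 0)" by (simp only: yk(3))
  then show ?thesis using yk(1) by blast
qed

end

section \<open>Homology of the quantum hyperplane\<close>

context quantum_hyperplane
begin

abbreviation "top_index \<equiv> (\<lambda>i. if i \<in> {1..N} then 1 else 0 :: nat)"

lemma Omega_top: "i \<in> {1..N} \<Longrightarrow> Omega N q p (\<lambda>_. 0) top_index i = koszul_coeff 0 i"
proof -
  assume i: "i \<in> {1..N}"
  have "(\<Sum>s\<in>{1..<i}. top_index s) = (\<Sum>s\<in>{1..<i}. 1)" using i by (intro sum.cong) auto
  moreover have "(\<Prod>s\<in>{1..<i}. q s i ^ top_index s) = (\<Prod>s\<in>{1..<i}. q s i)" using i by (intro prod.cong) auto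
  moreover have "(\<Prod>s\<in>{i<..N}. q i s ^ top_index s) = (\<Prod>s\<in>{i<..N}. q i s)" using i by (intro prod.cong) auto
  ultimately show ?thesis unfolding Omega_def koszul_coeff_0 by simp
qed

text \<open>The terms of the differential of the top chain sit on pairwise different basis vectors,
  one for each \<open>i\<close>, so the sum vanishes only termwise.\<close>

lemma koszul_top_cycle_iff: "koszul_top N \<in> koszul_cycles N q p N \<longleftrightarrow> modular"
proof -
  have supp: "{i \<in> {1..N}. top_index i = 1} = {1..N}" by auto
  define f where "f = (\<lambda>i. (\<lambda>j. 0 + unit_index i j, \<lambda>j. top_index j - unit_index i j))"
  have d: "koszul_d N q p (koszul_top N) = (\<Sum>i\<in>{1..N}. single (f i) (koszul_coeff 0 i))"
    unfolding koszul_d_def koszul_top_def lin_ext_single case_prod_conv supp f_def free_vs.scale_one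
    by (intro sum.cong refl) (simp only: Omega_top)
  have "f i = f j \<longleftrightarrow> i = j" for i j
  proof
    assume "f i = f j"
    then have "unit_index i = unit_index j" by (simp add: f_def)
    then show "i = j" by simp
  qed simp
  then have l: "lookup (koszul_d N q p (koszul_top N)) (f i) = koszul_coeff 0 i" if "i \<in> {1..N}" for i
    using that by (simp add: d lookup_sum lookup_single when_def sum.delta del: One_nat_def)
  have "koszul_top N \<in> koszul_chains N N"
    by (auto simp: koszul_top_def koszul_chains_def multiindices_def)
  then have "koszul_top N \<in> koszul_cycles N q p N \<longleftrightarrow> koszul_d N q p (koszul_top N) = 0"
    by (simp add: koszul_cycles_def)
  also have "\<dots> \<longleftrightarrow> (\<forall>i\<in>{1..N}. koszul_coeff 0 i = 0)"
  proof
    assume "koszul_d N q p (koszul_top N) = 0"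
    then show "\<forall>i\<in>{1..N}. koszul_coeff 0 i = 0" using l by simp
  next
    assume "\<forall>i\<in>{1..N}. koszul_coeff 0 i = 0"
    then show "koszul_d N q p (koszul_top N) = 0" unfolding d by (intro sum.neutral) simp
  qed
  also have "\<dots> \<longleftrightarrow> modular" by (simp add: koszul_coeff_0 modular_def)
  finally show ?thesis .
qed

abbreviation "top_image \<equiv> koszul_to_hochschild N q (koszul_top N)"

lemma top_image_eq: "top_image = (\<Sum>w\<in>perms {1..N}.
    single (hyperplane_monomial N q 0 # map (hyperplane_gen N q) w) (inv_coeff w))"
proof -
  have supp: "{i \<in> {1..N}. top_index i = 1} = {1..N}" by auto
  show ?thesis
    unfolding koszul_to_hochschild_def koszul_top_def lin_ext_single case_prod_conv supp
    by (simp add: arrangement_coeff_eq zero_fun_eq)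
qed

lemma homology:
  assumes "scaling_automorphism N q p \<sigma>"
  shows HH_above_top: "n > N \<Longrightarrow> HH A \<sigma> n = {HH_zero A \<sigma> n}"
    and HH_top_image: "modular \<Longrightarrow> HH_class A \<sigma> N top_image \<in> HH A \<sigma> N - {HH_zero A \<sigma> N}"
    and HH_top: "modular \<Longrightarrow> generic N q \<Longrightarrow> N \<noteq> 1 \<Longrightarrow>
      HH A \<sigma> N = {HH_class A \<sigma> N (fscale c top_image) | c. True}"
proof -
  interpret monomial_basis N q p A \<sigma> coords by (rule monomial_basis[OF assms])
  have zero: "0 \<in> hochschild_cycles A \<sigma> n" for n
  proof -
    have "0 \<in> free_tensors A n" by (simp add: free_tensors_eq supported_zero)
    then show ?thesis by (simp add: cycles_iff)
  qed
  have cyc_free: "z \<in> free_tensors A n" if "z \<in> hochschild_cycles A \<sigma> n" for z n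
    using that by (simp add: hochschild_cycles_def)
  show "HH A \<sigma> n = {HH_zero A \<sigma> n}" if n: "n > N" for n
  proof -
    have "HH_class A \<sigma> n z = HH_class A \<sigma> n 0" if z: "z \<in> hochschild_cycles A \<sigma> n" for z
    proof -
      have zf: "z \<in> free_tensors A n" by (rule cyc_free[OF z])
      have "lin_ext bdry (lin_ext tens z) = 0" using z cycles_iff[OF zf] by simp
      then have "z \<in> hochschild_boundaries A \<sigma> n"
        unfolding boundaries_iff using exact_above_top[OF n tens_chain[OF zf]] zf by blast
      then show ?thesis unfolding HH_class_eq_iff by simp
    qed
    then show ?thesis unfolding HH_def HH_zero_def using zero[of n] by blast
  qed
  have mem: "hyperplane_monomial N q 0 # map (hyperplane_gen N q) w \<in> tlists N"
    "tens (hyperplane_monomial N q 0 # map (hyperplane_gen N q) w) = single (0 # units w) 1"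
    if "w \<in> perms {1..N}" for w
  proof -
    have w: "set w = {1..N}" using that by (rule permutations_of_setD)
    show "hyperplane_monomial N q 0 # map (hyperplane_gen N q) w \<in> tlists N"
    proof -
      have "\<forall>i\<in>set w. hyperplane_gen N q i \<in> carrier A" unfolding w using gen_carrier by blast
      then show ?thesis by (simp add: tlists_def length_perm[OF that] monomial_carrier image_subset_iff)
    qed
    have "tens (map (hyperplane_gen N q) v) = single (units v) 1" if "set v \<subseteq> {1..N}" for v
      using that
    proof (induction v)
      case (Cons i v)
      then show ?case by (simp add: cons_tensor_def coords_gen lin_ext_single del: One_nat_def)
    qed simp
    then show "tens (hyperplane_monomial N q 0 # map (hyperplane_gen N q) w) = single (0 # units w) 1"
      using w by (simp add: cons_tensor_def coords_monomial lin_ext_single del: single_one)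
  qed
  have free: "fscale c top_image \<in> free_tensors A N" for c
    unfolding top_image_eq free_tensors_eq
    by (intro supported_fscale supported_sum supported_single mem)
  \<comment> \<open>The bridge to the monomial complex: cycle and boundary questions about the
    Koszul class become questions about \<open>top_chain 0\<close>.\<close>
  have tens: "lin_ext tens top_image = top_chain 0"
    unfolding top_image_eq top_chain_def lin_ext_sum lin_ext_single by (intro sum.cong refl) (simp only: mem(2) fscale_single mult_1_right)
  have cyc: "fscale c top_image \<in> hochschild_cycles A \<sigma> N" if modular for c
    using free[of c] top_cycle[OF that] by (simp add: cycles_iff lin_ext_fscale tens)
  have "HH_class A \<sigma> N top_image \<noteq> HH_class A \<sigma> N 0"
    unfolding HH_class_eq_iff boundaries_iff diff_zero tens using top_chain_not_boundary by blast
  moreover have "top_image \<in> hochschild_cycles A \<sigma> N" if modular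
    using cyc[OF that, of 1] by (simp only: free_vs.scale_one)
  ultimately show "HH_class A \<sigma> N top_image \<in> HH A \<sigma> N - {HH_zero A \<sigma> N}" if modular
    unfolding HH_def HH_zero_def using that by blast
  show "HH A \<sigma> N = {HH_class A \<sigma> N (fscale c top_image) | c. True}" if m: modular "generic N q" "N \<noteq> 1"
  proof (intro equalityI subsetI)
    fix X assume "X \<in> HH A \<sigma> N"
    then obtain z where z: "X = HH_class A \<sigma> N z" "z \<in> hochschild_cycles A \<sigma> N"
      unfolding HH_def by (rule imageE)
    have zf: "z \<in> free_tensors A N" by (rule cyc_free[OF z(2)])
    have "lin_ext bdry (lin_ext tens z) = 0" using z(2) cycles_iff[OF zf] by simp
    then obtain y c where y: "y \<in> supported (cells (Suc N))" "lin_ext tens z = lin_ext bdry y + fscale c (top_chain 0)"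
      using top_homology[OF m tens_chain[OF zf]] by blast
    have "z - fscale c top_image \<in> hochschild_boundaries A \<sigma> N"
      unfolding boundaries_iff
    proof
      show "z - fscale c top_image \<in> free_tensors A N"
        using zf free[of c] by (simp add: free_tensors_eq supported_diff)
      have "lin_ext tens (z - fscale c top_image) = lin_ext bdry y"
        by (simp add: lin_ext_diff lin_ext_fscale tens y(2))
      then show "\<exists>y\<in>supported (cells (Suc N)). lin_ext tens (z - fscale c top_image) = lin_ext bdry y"
        using y(1) by blast
    qed
    then have "X = HH_class A \<sigma> N (fscale c top_image)" unfolding z(1) HH_class_eq_iff .
    then show "X \<in> {HH_class A \<sigma> N (fscale c top_image) | c. True}" by blast
  next
    fix X assume "X \<in> {HH_class A \<sigma> N (fscale c top_image) | c. True}"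
    then show "X \<in> HH A \<sigma> N" unfolding HH_def using cyc[OF m(1)] by blast
  qed
qed

end

theorem proposition3p7:
  fixes N :: nat and q :: "nat \<Rightarrow> nat \<Rightarrow> complex"
  assumes "hyperplane_parameters N q" and "generic N q"
  shows
    "(\<exists>p \<sigma>. scaling_automorphism N q p \<sigma> \<and>
        HH (hyperplane N q) \<sigma> N \<noteq> {HH_zero (hyperplane N q) \<sigma> N} \<and>
        (\<forall>n>N. HH (hyperplane N q) \<sigma> n = {HH_zero (hyperplane N q) \<sigma> n}))
   \<and> (\<exists>!p. p \<in> {1..N} \<rightarrow>\<^sub>E (UNIV - {0}) \<and>
        (\<exists>\<sigma>. scaling_automorphism N q p \<sigma> \<and>
           koszul_top N \<in> koszul_cycles N q p N \<and>
           HH_class (hyperplane N q) \<sigma> N (koszul_to_hochschild N q (koszul_top N))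
             \<in> HH (hyperplane N q) \<sigma> N - {HH_zero (hyperplane N q) \<sigma> N}))
   \<and> (\<forall>p \<sigma>. scaling_automorphism N q p \<sigma> \<and> koszul_top N \<in> koszul_cycles N q p N \<longrightarrow>
        (\<forall>n>N. HH (hyperplane N q) \<sigma> n = {HH_zero (hyperplane N q) \<sigma> n}) \<and>
        (N \<noteq> 1 \<longrightarrow> HH (hyperplane N q) \<sigma> N =
           {HH_class (hyperplane N q) \<sigma> N (fscale c (koszul_to_hochschild N q (koszul_top N))) | c.
              True}))"
proof -
  let ?A = "hyperplane N q"
  let ?L = "\<lambda>i. \<Prod>s\<in>{1..<i}. q s i" and ?R = "\<lambda>i. \<Prod>s\<in>{i<..N}. q i s"
  have qh: "quantum_hyperplane N q" using assms(1) by unfold_locales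
  note cycle_iff = quantum_hyperplane.koszul_top_cycle_iff[OF qh]
  note modular_iff = quantum_hyperplane.modular_def[OF qh]
  note exists = quantum_hyperplane.scaling_automorphism_exists[OF qh]
  note above = quantum_hyperplane.HH_above_top[OF qh]
  note top_image = quantum_hyperplane.HH_top_image[OF qh, unfolded cycle_iff[symmetric]]
  note top = quantum_hyperplane.HH_top[OF qh, unfolded cycle_iff[symmetric]]
  have nz: "?L i \<noteq> 0" "?R i \<noteq> 0" if "i \<in> {1..N}" for i
    using that quantum_hyperplane.q_nonzero[OF qh] by auto
  \<comment> \<open>The cycle condition solved for each p_i. Restriction to \<open>{1..N}\<close>
    fixes the irrelevant values, without which uniqueness would fail.\<close>
  define p0 where "p0 = restrict (\<lambda>i. ?L i / ?R i) {1..N}"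
  have p0: "p0 \<in> {1..N} \<rightarrow>\<^sub>E (UNIV - {0})" using nz by (auto simp: p0_def simp del: One_nat_def)
  then obtain \<sigma> where \<sigma>: "scaling_automorphism N q p0 \<sigma>" using exists[of p0] by (auto simp: PiE_iff)
  have cyc: "koszul_top N \<in> koszul_cycles N q p0 N"
    unfolding cycle_iff modular_iff using nz by (simp add: p0_def del: One_nat_def)
  have unique: "p = p0" if p: "p \<in> {1..N} \<rightarrow>\<^sub>E (UNIV - {0})" "koszul_top N \<in> koszul_cycles N q p N" for p
  proof (rule PiE_ext[OF p(1) p0])
    fix i assume i: "i \<in> {1..N}"
    then have "?L i = p i * ?R i" using p(2) unfolding cycle_iff modular_iff by blast
    then show "p i = p0 i" using nz[OF i] i by (simp add: p0_def divide_simps del: One_nat_def)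
  qed
  note tc = top_image[OF \<sigma> cyc]
  show ?thesis
  proof (intro conjI allI impI)
    show "\<exists>p \<sigma>. scaling_automorphism N q p \<sigma> \<and> HH ?A \<sigma> N \<noteq> {HH_zero ?A \<sigma> N} \<and>
        (\<forall>n>N. HH ?A \<sigma> n = {HH_zero ?A \<sigma> n})"
    proof (intro exI conjI allI impI)
      show "scaling_automorphism N q p0 \<sigma>" by (rule \<sigma>)
      show "HH ?A \<sigma> N \<noteq> {HH_zero ?A \<sigma> N}" using tc by (metis DiffE)
      show "HH ?A \<sigma> n = {HH_zero ?A \<sigma> n}" if "n > N" for n by (rule above[OF \<sigma> that])
    qed
    show "\<exists>!p. p \<in> {1..N} \<rightarrow>\<^sub>E (UNIV - {0}) \<and>
        (\<exists>\<sigma>. scaling_automorphism N q p \<sigma> \<and> koszul_top N \<in> koszul_cycles N q p N \<and>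
           HH_class ?A \<sigma> N (koszul_to_hochschild N q (koszul_top N)) \<in> HH ?A \<sigma> N - {HH_zero ?A \<sigma> N})"
    proof (rule ex1I)
      show "p0 \<in> {1..N} \<rightarrow>\<^sub>E (UNIV - {0}) \<and>
        (\<exists>\<sigma>. scaling_automorphism N q p0 \<sigma> \<and> koszul_top N \<in> koszul_cycles N q p0 N \<and>
           HH_class ?A \<sigma> N (koszul_to_hochschild N q (koszul_top N)) \<in> HH ?A \<sigma> N - {HH_zero ?A \<sigma> N})"
        using p0 \<sigma> cyc tc by (intro conjI exI[of _ \<sigma>])
    qed (elim conjE exE, rule unique)
  next
    fix p \<sigma> n assume *: "scaling_automorphism N q p \<sigma> \<and> koszul_top N \<in> koszul_cycles N q p N" "n > N"
    show "HH ?A \<sigma> n = {HH_zero ?A \<sigma> n}" by (rule above[OF conjunct1[OF *(1)] *(2)])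
  next
    fix p \<sigma> assume *: "scaling_automorphism N q p \<sigma> \<and> koszul_top N \<in> koszul_cycles N q p N" "N \<noteq> 1"
    show "HH ?A \<sigma> N = {HH_class ?A \<sigma> N (fscale c (koszul_to_hochschild N q (koszul_top N))) | c. True}"
      by (rule top[OF conjunct1[OF *(1)] conjunct2[OF *(1)] assms(2) *(2)])
  qed
qed

end
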